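(* Let $d\ge2$ be an integer, let $a_1,a_2>0$ be real numbers with $da_1\ne a_2$, let $c\in\mathbb{R}$, and define $$A_tf(y)=\int_0^1 f\bigl(y_1-t^{a_1}x,\;y_2-t^{a_2}(x^d+c)\bigr)\,dx,\qquad y\in\mathbb{R}^2 .$$ There exist sets $E\subset[1,2]$, with upper Minkowski dimension $\beta\in(0,1)$ and upper Assouad dimension $\gamma\in(0,1)$, such that, with $\Delta,\widetilde\Delta$ the regions (depending on $d,\beta,\gamma$) defined in the context and bars denoting closures: (i) if $c\ne0$, the $L^p(\mathbb{R}^2)\to L^q(\mathbb{R}^2)$ estimate for the maximal operator $f\mapsto\sup_{t\in E}|A_tf|$ fails for every $(\frac1p,\frac1q)\in[0,1]^2$ with $(\frac1p,\frac1q)\notin\overline{\widetilde\Delta}$; (ii) if $c=0$, the $L^p(\mathbb{R}^2)\to L^q(\mathbb{R}^2)$ estimate for $f\mapsto\sup_{t\in E}|A_tf|$ fails for every $(\frac1p,\frac1q)\in[0,1]^2$ with $(\frac1p,\frac1q)\notin\overline{\Delta}$.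
   Context: For $E\subset\mathbb{R}$ and $\delta>0$, $N(E,\delta)$ is the minimal number of compact intervals of length $\delta$ needed to cover $E$. The upper Minkowski dimension of $E$ is the smallest $\beta$ such that for every $\epsilon>0$ there is $C(\epsilon)$ with $N(E,\delta)\le C(\epsilon)\delta^{-\beta-\epsilon}$ for all $0<\delta<1$. The upper Assouad dimension of $E$ is the smallest $\gamma$ such that there is $\delta_0>0$ and, for every $\epsilon>0$, a constant $C_\epsilon$ with $N(E\cap I,\delta)\le C_\epsilon(\delta/|I|)^{-\gamma-\epsilon}$ for all $\delta\in(0,\delta_0)$ and all intervals $I$ with $|I|\in(\delta,\delta_0)$. Let $\mathcal{Q}^2(\beta,\gamma)$ be the closed convex hull of the points $Q_1=(0,0)$, $Q_2=\bigl(\frac{1}{1+\beta},\frac{1}{1+\beta}\bigr)$, $Q_3=\bigl(\frac{2-\beta}{3-\beta},\frac{1}{3-\beta}\bigr)$, $Q_4=\bigl(\frac{2}{3+2\gamma},\frac{1}{3+2\gamma}\bigr)$, and let $\mathcal{R}^2(\beta,\gamma)$ be the union of the interior of $\mathcal{Q}^2(\beta,\gamma)$ with the line segment connecting $Q_1$ and $Q_2$, including $Q_1$ but excluding $Q_2$. Define $$\Delta=\Bigl\{(\tfrac1p,\tfrac1q)\in\mathcal{R}^2(\beta,\gamma):\ \tfrac{d+1}{p}-\tfrac{d+1}{q}-1<0\Bigr\},$$ $$\widetilde\Delta=\Bigl\{(\tfrac1p,\tfrac1q)\in\mathcal{R}^2(\beta,\gamma):\ \tfrac1q>\tfrac{d+1}{d-d\beta+1}\bigl(\tfrac1p-\tfrac1{d+1}\bigr)\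 \text{and}\ \tfrac1q>\tfrac{d\gamma+\beta}{2(d\gamma+\beta)-\beta(d+1+d\gamma)}\bigl(\tfrac1p-\tfrac{\beta}{d\gamma+\beta}\bigr)\Bigr\}.$$ The $L^p\to L^q$ estimate "fails" means that there is no finite constant $C$ with $\|\sup_{t\in E}|A_tf|\|_{L^q(\mathbb{R}^2)}\le C\|f\|_{L^p(\mathbb{R}^2)}$ for all admissible $f$ (e.g. all bounded Borel functions $f$ of compact support). *)

theory Defs
  imports "HOL-Analysis.Analysis"
begin

text \<open>The value is \<open>\<infinity>\<close> if no finite family of intervals of length \<open>\<delta>\<close> covers \<open>E\<close>.\<close>

definition covering_number :: "real set \<Rightarrow> real \<Rightarrow> enat" where
  "covering_number E \<delta> =
    (INF A \<in> {A. finite A \<and> E \<subseteq> (\<Union>a\<in>A. {a..a + \<delta>})}. enat (card A))"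

definition minkowski_bound :: "real set \<Rightarrow> real \<Rightarrow> bool" where
  "minkowski_bound E \<beta> \<longleftrightarrow>
    (\<forall>\<epsilon>>0. \<exists>C::real. \<forall>\<delta>. 0 < \<delta> \<and> \<delta> < 1 \<longrightarrow>
      ereal_of_enat (covering_number E \<delta>) \<le> ereal (C * \<delta> powr (- \<beta> - \<epsilon>)))"

definition has_upper_minkowski_dim :: "real set \<Rightarrow> real \<Rightarrow> bool" where
  "has_upper_minkowski_dim E \<beta> \<longleftrightarrow>
    minkowski_bound E \<beta> \<and> (\<forall>\<beta>'. minkowski_bound E \<beta>' \<longrightarrow> \<beta> \<le> \<beta>')"

text \<open>An interval \<open>I\<close> may be open, closed or half-open; its length \<open>\<bar>I\<bar>\<close> is its Lebesgue measure.
  An unbounded interval has \<open>measure lborel I = 0\<close>, so the condition \<open>\<delta> < \<bar>I\<bar>\<close> discards it.\<close>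

definition assouad_bound :: "real set \<Rightarrow> real \<Rightarrow> bool" where
  "assouad_bound E \<gamma> \<longleftrightarrow>
    (\<exists>\<delta>\<^sub>0>0. \<forall>\<epsilon>>0. \<exists>C::real. \<forall>\<delta> I.
      0 < \<delta> \<and> \<delta> < \<delta>\<^sub>0 \<and> is_interval I \<and> \<delta> < measure lborel I \<and> measure lborel I < \<delta>\<^sub>0 \<longrightarrow>
      ereal_of_enat (covering_number (E \<inter> I) \<delta>)
        \<le> ereal (C * (\<delta> / measure lborel I) powr (- \<gamma> - \<epsilon>)))"

definition has_upper_assouad_dim :: "real set \<Rightarrow> real \<Rightarrow> bool" where
  "has_upper_assouad_dim E \<gamma> \<longleftrightarrow>
    assouad_bound E \<gamma> \<and> (\<forall>\<gamma>'. assouad_bound E \<gamma>' \<longrightarrow> \<gamma> \<le> \<gamma>')"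

definition Q1 :: "real \<times> real" where
  "Q1 = (0, 0)"

definition Q2 :: "real \<Rightarrow> real \<times> real" where
  "Q2 \<beta> = (1 / (1 + \<beta>), 1 / (1 + \<beta>))"

definition Q3 :: "real \<Rightarrow> real \<times> real" where
  "Q3 \<beta> = ((2 - \<beta>) / (3 - \<beta>), 1 / (3 - \<beta>))"

definition Q4 :: "real \<Rightarrow> real \<times> real" where
  "Q4 \<gamma> = (2 / (3 + 2 * \<gamma>), 1 / (3 + 2 * \<gamma>))"

text \<open>The convex hull of finitely many points is already closed.\<close>

definition region_Q :: "real \<Rightarrow> real \<Rightarrow> (real \<times> real) set" where
  "region_Q \<beta> \<gamma> = convex hull {Q1, Q2 \<beta>, Q3 \<beta>, Q4 \<gamma>}"

definition region_R :: "real \<Rightarrow> real \<Rightarrow> (real \<times> real) set" where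
  "region_R \<beta> \<gamma> = interior (region_Q \<beta> \<gamma>) \<union> (closed_segment Q1 (Q2 \<beta>) - {Q2 \<beta>})"

text \<open>Points of the regions below are \<open>(u, v) = (1/p, 1/q)\<close>.\<close>

definition Delta :: "nat \<Rightarrow> real \<Rightarrow> real \<Rightarrow> (real \<times> real) set" where
  "Delta d \<beta> \<gamma> =
    {(u, v) \<in> region_R \<beta> \<gamma>. (real d + 1) * u - (real d + 1) * v - 1 < 0}"

definition Delta_tilde :: "nat \<Rightarrow> real \<Rightarrow> real \<Rightarrow> (real \<times> real) set" where
  "Delta_tilde d \<beta> \<gamma> =
    {(u, v) \<in> region_R \<beta> \<gamma>.
      v > (real d + 1) / (real d - real d * \<beta> + 1) * (u - 1 / (real d + 1)) \<and>
      v > (real d * \<gamma> + \<beta>) / (2 * (real d * \<gamma> + \<beta>) - \<beta> * (real d + 1 + real d * \<gamma>))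
            * (u - \<beta> / (real d * \<gamma> + \<beta>))}"

definition curve_avg ::
  "nat \<Rightarrow> real \<Rightarrow> real \<Rightarrow> real \<Rightarrow> real \<Rightarrow> (real \<times> real \<Rightarrow> real) \<Rightarrow> real \<times> real \<Rightarrow> real" where
  "curve_avg d a1 a2 c t f y =
    (LINT x:{0..1}|lborel. f (fst y - t powr a1 * x, snd y - t powr a2 * (x ^ d + c)))"

definition maximal_op ::
  "nat \<Rightarrow> real \<Rightarrow> real \<Rightarrow> real \<Rightarrow> real set \<Rightarrow> (real \<times> real \<Rightarrow> real) \<Rightarrow> real \<times> real \<Rightarrow> ennreal" where
  "maximal_op d a1 a2 c E f y = (SUP t\<in>E. ennreal \<bar>curve_avg d a1 a2 c t f y\<bar>)"

text \<open>Only used for exponents \<open>a > 0\<close>.\<close>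

definition ennreal_powr :: "ennreal \<Rightarrow> real \<Rightarrow> ennreal" where
  "ennreal_powr x a = (if x = \<infinity> then \<infinity> else ennreal (enn2real x powr a))"

text \<open>The norm of \<open>L\<^sup>p(\<real>\<^sup>2)\<close>, \<open>1 \<le> p \<le> \<infinity>\<close>, of a function with values in \<open>[0, \<infinity>]\<close>; for \<open>p = \<infinity>\<close>
  it is the essential supremum. For \<open>F\<close> not Lebesgue measurable (possible for a maximal function
  when \<open>E\<close> is uncountable) the integral is the lower one, so the failure of an estimate with
  finite target exponent is asserted in the strongest sense.\<close>

definition Lp_norm :: "ennreal \<Rightarrow> (real \<times> real \<Rightarrow> ennreal) \<Rightarrow> ennreal" where
  "Lp_norm p F =
    (if p = \<infinity> then Inf {z. AE y in lborel. F y \<le> z}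
     else ennreal_powr (\<integral>\<^sup>+ y. ennreal_powr (F y) (enn2real p) \<partial>lborel) (1 / enn2real p))"

definition admissible :: "(real \<times> real \<Rightarrow> real) \<Rightarrow> bool" where
  "admissible f \<longleftrightarrow>
    f \<in> borel_measurable borel \<and> bounded (range f) \<and> compact (closure {y. f y \<noteq> 0})"

definition maximal_estimate ::
  "nat \<Rightarrow> real \<Rightarrow> real \<Rightarrow> real \<Rightarrow> real set \<Rightarrow> ennreal \<Rightarrow> ennreal \<Rightarrow> bool" where
  "maximal_estimate d a1 a2 c E p q \<longleftrightarrow>
    (\<exists>C::real. \<forall>f. admissible f \<longrightarrow>
      Lp_norm q (maximal_op d a1 a2 c E f) \<le> ennreal C * Lp_norm p (\<lambda>y. ennreal \<bar>f y\<bar>))"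

text \<open>The point \<open>(1/p, 1/q)\<close> of \<open>[0, 1]\<^sup>2\<close> for \<open>p, q \<in> [1, \<infinity>]\<close>, with \<open>1/\<infinity> = 0\<close>.\<close>

definition exponent_point :: "ennreal \<Rightarrow> ennreal \<Rightarrow> real \<times> real" where
  "exponent_point p q = (enn2real (1 / p), enn2real (1 / q))"

end

(* Proof idea. The set E consists of the numbers 1 + eta * (sum of rho^i over i in A), where rho^gamma = 1/2
   and A ranges over the subsets of the windows {floor(theta M), ..., M - 1} with theta = 1 - beta/gamma.
   At every scale rho^M it contains a cluster T M of (rho^M)^(-beta) points separated by rho^M within distance
   (rho^M)^theta of 1. Testing an L^p -> L^q estimate on indicator functions gives one linear inequality
   between u = 1/p and v = 1/q for each side of the region: large boxes give v <= u; small balls, with t in T M,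
   give 2u <= 1 + (1 - beta)v; neighbourhoods of arcs at a point of nonvanishing curvature give u <= 2v for
   t = 1 alone and the line through Q3 and Q4 for t in T M; neighbourhoods of arcs at the point x = 0, where
   the curve is flat of order d, give the additional lines. At x = 0 the curve moves with t in the normal
   direction only if c is nonzero, so for c = 0 only the single value t = 1 can be used there. *)

theory Submission
  imports Defs
begin

section \<open>The set of dilations\<close>

text \<open>All arc tests are instances of one inequality. Let \<open>D = \<rho> ^ M\<close>. Arcs
  of length about \<open>D powr \<xi>\<close> at a point of contact of order \<open>m\<close>, taken
  for about \<open>D powr (- B)\<close> dilations, give
  \<open>(1 + \<xi>) * u \<le> \<xi> + (2 - B - (m - 1) * \<xi>) * v\<close>. The exponent is
  limited by \<open>m * \<xi> \<le> 1\<close> (the neighbourhood must not be thicker than the arc is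
  high) and by \<open>1 - \<theta> \<le> m * \<xi>\<close> (the spread of the cluster must stay
  invisible on the arc), where \<open>1 - \<theta> = \<beta> / \<gamma>\<close>. The inequality is
  affine in \<open>\<xi>\<close>, so only the ends of this range matter, and each line coming from
  arcs is such an end. The obstacle is that a dilation may slide the curve along itself, so that
  separated dilations need not give separated arcs. The derivative in \<open>t\<close> at
  \<open>t = 1\<close> of the height over \<open>s\<close> is
  \<open>c * a2 + s ^ d * (a2 - d * a1)\<close>. As \<open>d * a1\<close> differs from
  \<open>a2\<close>, it is nonzero at a suitable base point \<open>s0\<close>, where the balls and
  the arcs of nonvanishing curvature are tested. The factor \<open>\<eta>\<close> then confines
  \<open>E\<close> to a neighbourhood of 1 on which this separation persists.\<close>

lemma covering_number_le:
  assumes "finite A" "E \<subseteq> (\<Union>a\<in>A. {a..a + \<delta>})"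
  shows "covering_number E \<delta> \<le> enat (card A)"
  unfolding covering_number_def using assms by (intro INF_lower) auto

text \<open>No interval of length \<open>\<delta>\<close> can hold two points of \<open>S\<close>,
  so choosing an interval for each point is injective.\<close>

lemma covering_number_ge:
  assumes "finite S" "S \<subseteq> E" and sep: "\<And>x y. x \<in> S \<Longrightarrow> y \<in> S \<Longrightarrow> x \<noteq> y \<Longrightarrow> \<bar>x - y\<bar> > \<delta>"
  shows "enat (card S) \<le> covering_number E \<delta>"
  unfolding covering_number_def
proof (intro INF_greatest)
  fix A assume "A \<in> {A. finite A \<and> E \<subseteq> (\<Union>a\<in>A. {a..a + \<delta>})}"
  then have fin: "finite A" and cov: "E \<subseteq> (\<Union>a\<in>A. {a..a + \<delta>})"
    by auto
  have "\<forall>x\<in>S. \<exists>a. a \<in> A \<and> x \<in> {a..a + \<delta>}"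
    using cov \<open>S \<subseteq> E\<close> by fastforce
  then obtain g where g: "\<And>x. x \<in> S \<Longrightarrow> g x \<in> A \<and> x \<in> {g x..g x + \<delta>}"
    by metis
  have "inj_on g S"
  proof (rule inj_onI)
    fix x y assume "x \<in> S" "y \<in> S" "g x = g y"
    then have "\<bar>x - y\<bar> \<le> \<delta>"
      using g[of x] g[of y] by auto
    then show "x = y"
      using sep \<open>x \<in> S\<close> \<open>y \<in> S\<close> by force
  qed
  then have "card S \<le> card A"
    using g fin by (intro card_inj_on_le[of g]) auto
  then show "enat (card S) \<le> enat (card A)"
    by simp
qed

section \<open>Sums of distinct powers of \<open>\<rho>\<close>\<close>

definition digit_sum :: "real \<Rightarrow> nat set \<Rightarrow> real" where
  "digit_sum \<rho> A = (\<Sum>i\<in>A. \<rho> ^ i)"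

text \<open>Equal to \<open>1 - \<rho> / (1 - \<rho>)\<close>: one digit minus all the digits that
  can follow it, in units of that digit.\<close>

definition gap :: "real \<Rightarrow> real" where
  "gap \<rho> = (1 - 2 * \<rho>) / (1 - \<rho>)"

lemma gap_pos: "0 < \<rho> \<Longrightarrow> \<rho> < 1 / 2 \<Longrightarrow> 0 < gap \<rho>"
  by (simp add: gap_def)

lemma scaled_gap:
  assumes "0 < \<eta>" "\<eta> \<le> 1 - \<rho>" "0 < \<rho>" "\<rho> < 1 / 2"
  shows "0 < \<eta> * gap \<rho>" "\<eta> * gap \<rho> < 1"
proof -
  show "0 < \<eta> * gap \<rho>"
    using assms gap_pos[of \<rho>] by simp
  have "\<eta> * gap \<rho> \<le> (1 - \<rho>) * gap \<rho>"
    using assms gap_pos[of \<rho>] by (intro mult_right_mono) auto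
  also have "\<dots> = 1 - 2 * \<rho>"
    using assms by (simp add: gap_def)
  finally show "\<eta> * gap \<rho> < 1"
    using assms by linarith
qed

lemma digit_sum_tail:
  assumes "0 < \<rho>" "\<rho> < 1" "finite A" "A \<subseteq> {n..}"
  shows "0 \<le> digit_sum \<rho> A" "digit_sum \<rho> A \<le> \<rho> ^ n / (1 - \<rho>)"
proof -
  show "0 \<le> digit_sum \<rho> A"
    unfolding digit_sum_def using assms by (intro sum_nonneg) auto
  obtain N where N: "A \<subseteq> {..<N}"
    using \<open>finite A\<close> finite_nat_iff_bounded by blast
  have *: "(\<Sum>i = n..<n + k. \<rho> ^ i) = (\<rho> ^ n - \<rho> ^ (n + k)) / (1 - \<rho>)" for k
  proof (induction k)
    case (Suc k)
    then have "(\<Sum>i = n..<n + Suc k. \<rho> ^ i) = (\<rho> ^ n - \<rho> ^ (n + k)) / (1 - \<rho>) + \<rho> ^ (n + k)"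
      by simp
    also have "\<dots> = (\<rho> ^ n - \<rho> ^ (n + Suc k)) / (1 - \<rho>)"
      using assms by (simp add: divide_simps) (simp add: algebra_simps)
    finally show ?case .
  qed simp
  have "digit_sum \<rho> A \<le> (\<Sum>i = n..<n + N. \<rho> ^ i)"
    unfolding digit_sum_def using N assms by (intro sum_mono2) fastforce+
  also have "\<dots> \<le> \<rho> ^ n / (1 - \<rho>)"
    unfolding * using assms by (intro divide_right_mono) auto
  finally show "digit_sum \<rho> A \<le> \<rho> ^ n / (1 - \<rho>)" .
qed

lemma digit_sum_split:
  assumes "finite A"
  shows "digit_sum \<rho> A = digit_sum \<rho> (A \<inter> {..<n}) + digit_sum \<rho> (A \<inter> {n..})"
proof -
  have "A = (A \<inter> {..<n}) \<union> (A \<inter> {n..})"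
    by auto
  then have "digit_sum \<rho> A = digit_sum \<rho> ((A \<inter> {..<n}) \<union> (A \<inter> {n..}))"
    by simp
  also have "\<dots> = digit_sum \<rho> (A \<inter> {..<n}) + digit_sum \<rho> (A \<inter> {n..})"
    unfolding digit_sum_def using assms by (intro sum.union_disjoint) auto
  finally show ?thesis .
qed

text \<open>At the first index where \<open>A\<close> and \<open>B\<close> differ, one sum gains a
  power that the later digits of the other cannot make up. The bound is stated for every index
  \<open>k\<close> of the symmetric difference because it is also used in reverse: two close points
  must agree in all their early digits.\<close>

lemma digit_sum_separation:
  assumes \<rho>: "0 < \<rho>" "\<rho> < 1 / 2" and fin: "finite A" "finite B"
    and k: "k \<in> (A - B) \<union> (B - A)"
  shows "\<bar>digit_sum \<rho> A - digit_sum \<rho> B\<bar> \<ge> gap \<rho> * \<rho> ^ k"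
proof -
  \<comment> \<open>Here \<open>A\<close> is the set that owns the first differing index; the other
    case follows by exchanging the two sets.\<close>
  have *: "digit_sum \<rho> A - digit_sum \<rho> B \<ge> gap \<rho> * \<rho> ^ k"
    if "finite A" "finite B" "k \<in> (A - B) \<union> (B - A)" "i = Min ((A - B) \<union> (B - A))" "i \<in> A" for A B i
  proof -
    have m: "i \<in> (A - B) \<union> (B - A)" and le: "\<And>j. j \<in> (A - B) \<union> (B - A) \<Longrightarrow> i \<le> j"
      using that Min_in[of "(A - B) \<union> (B - A)"] by auto
    have iB: "i \<notin> B"
      using m that(5) by auto
    have eq: "A \<inter> {..<i} = B \<inter> {..<i}"
    proof -
      have "j \<in> A \<longleftrightarrow> j \<in> B" if "j < i" for j
        using le[of j] that by auto
      then show ?thesis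
        by auto
    qed
    have "digit_sum \<rho> A - digit_sum \<rho> B = digit_sum \<rho> (A \<inter> {i..}) - digit_sum \<rho> (B \<inter> {i..})"
      using digit_sum_split[of A \<rho> i] digit_sum_split[of B \<rho> i] eq that by simp
    also have "digit_sum \<rho> (A \<inter> {i..}) \<ge> \<rho> ^ i"
      unfolding digit_sum_def using that \<rho> by (intro member_le_sum) auto
    moreover have "B \<inter> {i..} \<subseteq> {Suc i..}"
      using iB by (auto simp: Suc_le_eq order_le_less)
    then have "digit_sum \<rho> (B \<inter> {i..}) \<le> \<rho> ^ Suc i / (1 - \<rho>)"
      using \<rho> that by (intro digit_sum_tail) auto
    moreover have "\<rho> ^ i - \<rho> ^ Suc i / (1 - \<rho>) = gap \<rho> * \<rho> ^ i"
      using \<rho> by (simp add: gap_def field_simps)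
    moreover have "gap \<rho> * \<rho> ^ i \<ge> gap \<rho> * \<rho> ^ k"
      using le[OF that(3)] \<rho> gap_pos[of \<rho>] by (intro mult_left_mono power_decreasing) auto
    ultimately show ?thesis
      by linarith
  qed
  define i where "i = Min ((A - B) \<union> (B - A))"
  have "i \<in> (A - B) \<union> (B - A)"
    unfolding i_def using k fin by (intro Min_in) auto
  then show ?thesis
    using *[of A B i] *[of B A i] fin k by (auto simp: i_def Un_commute)
qed

text \<open>\<open>\<rho>\<close> is chosen with \<open>\<rho> powr \<gamma> = 1 / 2\<close>, so the points with arbitrary digit sets form a Cantor set
  of dimension \<open>\<gamma>\<close>. Letting only the digits from \<open>\<theta> M\<close> to \<open>M\<close> vary leaves about
  \<open>(\<rho> ^ M) powr (- \<gamma> * (1 - \<theta>))\<close> points at scale \<open>\<rho> ^ M\<close>, all within \<open>\<rho> powr (\<theta> * M)\<close> of \<open>1\<close>;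
  with \<open>\<theta> = 1 - \<beta> / \<gamma>\<close> this is the Minkowski count \<open>(\<rho> ^ M) powr (- \<beta>)\<close> concentrated on
  the shortest interval that the Assouad dimension \<open>\<gamma>\<close> permits.\<close>

definition window :: "real \<Rightarrow> nat \<Rightarrow> nat set" where
  "window \<theta> M = {nat \<lfloor>\<theta> * real M\<rfloor>..<M}"

definition digit_point :: "real \<Rightarrow> real \<Rightarrow> nat set \<Rightarrow> real" where
  "digit_point \<eta> \<rho> A = 1 + \<eta> * digit_sum \<rho> A"

definition window_set :: "real \<Rightarrow> real \<Rightarrow> real \<Rightarrow> nat \<Rightarrow> real set" where
  "window_set \<eta> \<rho> \<theta> M = digit_point \<eta> \<rho> ` Pow (window \<theta> M)"

definition dilation_set :: "real \<Rightarrow> real \<Rightarrow> real \<Rightarrow> real set" where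
  "dilation_set \<eta> \<rho> \<theta> = (\<Union>M. window_set \<eta> \<rho> \<theta> M)"

lemma finite_window [simp]: "finite (window \<theta> M)"
  by (simp add: window_def)

lemma finite_window_set [simp]: "finite (window_set \<eta> \<rho> \<theta> M)"
  by (simp add: window_set_def)

lemma window_set_subset: "window_set \<eta> \<rho> \<theta> M \<subseteq> dilation_set \<eta> \<rho> \<theta>"
  by (auto simp: dilation_set_def)

lemma one_in_dilation_set: "1 \<in> dilation_set \<eta> \<rho> \<theta>"
  by (auto simp: dilation_set_def window_set_def digit_point_def digit_sum_def image_iff
      intro!: exI[of _ 0] bexI[of _ "{}"])

lemma digit_point_separation:
  assumes "0 < \<eta>" "0 < \<rho>" "\<rho> < 1 / 2" "finite A" "finite B" "k \<in> (A - B) \<union> (B - A)"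
  shows "\<bar>digit_point \<eta> \<rho> A - digit_point \<eta> \<rho> B\<bar> \<ge> \<eta> * gap \<rho> * \<rho> ^ k"
proof -
  have "\<bar>digit_point \<eta> \<rho> A - digit_point \<eta> \<rho> B\<bar> = \<eta> * \<bar>digit_sum \<rho> A - digit_sum \<rho> B\<bar>"
    using assms by (simp add: digit_point_def abs_mult flip: right_diff_distrib)
  then show ?thesis
    using digit_sum_separation[OF assms(2-6)] assms(1) by (simp add: mult.assoc)
qed

lemma digit_point_separation':
  assumes "0 < \<eta>" "0 < \<rho>" "\<rho> < 1 / 2" "A \<subseteq> {..<M}" "B \<subseteq> {..<M}" "A \<noteq> B"
  shows "\<bar>digit_point \<eta> \<rho> A - digit_point \<eta> \<rho> B\<bar> \<ge> \<eta> * gap \<rho> * \<rho> ^ M"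
proof -
  obtain k where k: "k \<in> (A - B) \<union> (B - A)"
    using assms(6) by blast
  then have "k < M"
    using assms(4,5) by auto
  have "finite A" "finite B"
    using assms(4,5) finite_subset by blast+
  then have "\<eta> * gap \<rho> * \<rho> ^ k \<le> \<bar>digit_point \<eta> \<rho> A - digit_point \<eta> \<rho> B\<bar>"
    using digit_point_separation[OF assms(1-3) _ _ k] by blast
  moreover have "\<eta> * gap \<rho> * \<rho> ^ M \<le> \<eta> * gap \<rho> * \<rho> ^ k"
    using assms(1-3) gap_pos[of \<rho>] \<open>k < M\<close> by (intro mult_left_mono power_decreasing) auto
  ultimately show ?thesis
    by linarith
qed

lemma digit_point_inj:
  assumes "0 < \<eta>" "0 < \<rho>" "\<rho> < 1 / 2"
  shows "inj_on (digit_point \<eta> \<rho>) (Pow {..<M})"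
proof (rule inj_onI, rule ccontr)
  fix A B assume "A \<in> Pow {..<M}" "B \<in> Pow {..<M}" "digit_point \<eta> \<rho> A = digit_point \<eta> \<rho> B" "A \<noteq> B"
  then have "\<eta> * gap \<rho> * \<rho> ^ M \<le> 0"
    using digit_point_separation'[OF assms, of A M B] by simp
  moreover have "0 < \<eta> * gap \<rho> * \<rho> ^ M"
    using assms gap_pos[of \<rho>] by simp
  ultimately show False
    by linarith
qed

lemma window_set_separation:
  assumes "0 < \<eta>" "0 < \<rho>" "\<rho> < 1 / 2"
    "x \<in> window_set \<eta> \<rho> \<theta> M" "y \<in> window_set \<eta> \<rho> \<theta> M" "x \<noteq> y"
  shows "\<bar>x - y\<bar> \<ge> \<eta> * gap \<rho> * \<rho> ^ M"
proof -
  obtain A B where "A \<subseteq> window \<theta> M" "B \<subseteq> window \<theta> M"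
      and xy: "x = digit_point \<eta> \<rho> A" "y = digit_point \<eta> \<rho> B"
    using assms(4,5) by (auto simp: window_set_def)
  then have "A \<subseteq> {..<M}" "B \<subseteq> {..<M}"
    by (auto simp: window_def)
  with xy show ?thesis
    using digit_point_separation'[OF assms(1-3), of A M B] assms(6) by auto
qed

lemma card_window_set:
  assumes "0 < \<eta>" "0 < \<rho>" "\<rho> < 1 / 2"
  shows "card (window_set \<eta> \<rho> \<theta> M) = 2 ^ (M - nat \<lfloor>\<theta> * real M\<rfloor>)"
proof -
  have "inj_on (digit_point \<eta> \<rho>) (Pow (window \<theta> M))"
    by (rule inj_on_subset[OF digit_point_inj[OF assms, of M]]) (auto simp: window_def)
  then show ?thesis
    unfolding window_set_def by (simp add: card_image card_Pow) (simp add: window_def)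
qed

text \<open>The digits from \<open>n\<close> on contribute at most
  \<open>\<eta> * \<rho> ^ n / (1 - \<rho>)\<close>. The normalisation
  \<open>\<eta> \<le> 1 - \<rho>\<close> turns this into \<open>\<rho> ^ n\<close>, so that
  truncated points are left endpoints of covering intervals of length
  \<open>\<rho> ^ n\<close>.\<close>

lemma digit_point_prefix:
  assumes "0 < \<eta>" "\<eta> \<le> 1 - \<rho>" "0 < \<rho>" "\<rho> < 1 / 2" "finite A"
  shows "digit_point \<eta> \<rho> A \<in> {digit_point \<eta> \<rho> (A \<inter> {..<n})..digit_point \<eta> \<rho> (A \<inter> {..<n}) + \<rho> ^ n}"
proof -
  have t: "0 \<le> digit_sum \<rho> (A \<inter> {n..})" "digit_sum \<rho> (A \<inter> {n..}) \<le> \<rho> ^ n / (1 - \<rho>)"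
    using assms by (auto intro!: digit_sum_tail)
  have "\<eta> * digit_sum \<rho> (A \<inter> {n..}) \<le> (1 - \<rho>) * (\<rho> ^ n / (1 - \<rho>))"
    using assms t by (intro mult_mono) auto
  then have "\<eta> * digit_sum \<rho> (A \<inter> {n..}) \<le> \<rho> ^ n"
    using assms by simp
  moreover have "0 \<le> \<eta> * digit_sum \<rho> (A \<inter> {n..})"
    using assms t by simp
  ultimately show ?thesis
    using digit_sum_split[OF assms(5), of \<rho> n] by (simp add: digit_point_def distrib_left)
qed

text \<open>The second bound confines all dilations to a neighbourhood of 1 controlled by
  \<open>\<eta>\<close>; the third is the clustering at scale \<open>\<rho> ^ M\<close>. Rounding
  \<open>\<theta> * M\<close> down costs at most one power of \<open>\<rho>\<close>, hence the
  division by \<open>\<rho>\<close>.\<close>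

lemma window_set_range:
  assumes "0 < \<eta>" "\<eta> \<le> 1 - \<rho>" "0 < \<rho>" "\<rho> < 1 / 2" "0 \<le> \<theta>" "x \<in> window_set \<eta> \<rho> \<theta> M"
  shows "1 \<le> x" "x - 1 \<le> \<eta> / (1 - \<rho>)" "x - 1 \<le> (\<rho> ^ M) powr \<theta> / \<rho>"
proof -
  define n where "n = nat \<lfloor>\<theta> * real M\<rfloor>"
  obtain A where A: "A \<subseteq> window \<theta> M" "x = digit_point \<eta> \<rho> A"
    using assms(6) by (auto simp: window_set_def)
  have fin: "finite A"
    using A by (meson finite_subset finite_window)
  have t: "0 \<le> digit_sum \<rho> A" "digit_sum \<rho> A \<le> \<rho> ^ n / (1 - \<rho>)"
    using A fin assms by (auto intro!: digit_sum_tail simp: window_def n_def subset_iff)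
  then show "1 \<le> x"
    using A assms by (simp add: digit_point_def)
  have le: "\<eta> * digit_sum \<rho> A \<le> \<eta> * (\<rho> ^ n / (1 - \<rho>))"
    using t assms by (intro mult_left_mono) auto
  moreover have "\<eta> * (\<rho> ^ n / (1 - \<rho>)) \<le> \<eta> * (1 / (1 - \<rho>))"
    using assms by (intro mult_left_mono divide_right_mono power_le_one) auto
  ultimately show "x - 1 \<le> \<eta> / (1 - \<rho>)"
    using A by (simp add: digit_point_def)
  have "\<eta> * (\<rho> ^ n / (1 - \<rho>)) \<le> (1 - \<rho>) * (\<rho> ^ n / (1 - \<rho>))"
    using assms by (intro mult_right_mono) auto
  also have "\<dots> = \<rho> powr real n"
    using assms by (simp add: powr_realpow)
  also have "\<dots> \<le> \<rho> powr (\<theta> * real M - 1)"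
    using assms unfolding n_def by (intro powr_mono') linarith+
  also have "\<dots> = (\<rho> ^ M) powr \<theta> / \<rho>"
    using assms by (simp add: powr_diff powr_powr mult.commute flip: powr_realpow)
  finally show "x - 1 \<le> (\<rho> ^ M) powr \<theta> / \<rho>"
    using A le by (simp add: digit_point_def)
qed

lemma dilation_set_range:
  assumes "0 < \<eta>" "\<eta> \<le> 1 - \<rho>" "0 < \<rho>" "\<rho> < 1 / 2" "0 \<le> \<theta>"
  shows "dilation_set \<eta> \<rho> \<theta> \<subseteq> {1..1 + \<eta> / (1 - \<rho>)}"
  using window_set_range(1,2)[OF assms] by (force simp: dilation_set_def)

section \<open>Scales and comparison of exponents\<close>

lemma power_bracket:
  fixes \<rho> \<delta> :: real
  assumes "0 < \<rho>" "\<rho> < 1" "0 < \<delta>" "\<delta> < 1"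
  obtains n :: nat where "\<rho> ^ n \<le> \<delta>" "\<delta> < \<rho> ^ n / \<rho>"
proof -
  define n where "n = (LEAST n. \<rho> ^ n \<le> \<delta>)"
  obtain n0 where "\<rho> ^ n0 < \<delta>"
    using real_arch_pow_inv[OF assms(3) assms(2)] by auto
  then have n: "\<rho> ^ n \<le> \<delta>"
    unfolding n_def by (intro LeastI[of "\<lambda>n. \<rho> ^ n \<le> \<delta>" n0]) auto
  \<comment> \<open>\<open>\<delta> < 1\<close> excludes \<open>n = 0\<close>, so \<open>n\<close>
    has a predecessor, and that one violates the bound.\<close>
  have "n \<noteq> 0"
    using n assms by (intro notI) auto
  then obtain k where k: "n = Suc k"
    using not0_implies_Suc by blast
  then have "\<not> \<rho> ^ k \<le> \<delta>"
    using not_less_Least[of k "\<lambda>n. \<rho> ^ n \<le> \<delta>"] n_def by auto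
  then show thesis
    using that[of n] n k assms by auto
qed

text \<open>Otherwise \<open>(\<rho> ^ M) powr (Y - X)\<close> would tend to 0 and beat any
  constant. The lower bounds for the dimensions and all necessary conditions are proved scale by
  scale and read off through this.\<close>

lemma exponent_le_of_powr_le:
  fixes \<rho> X Y C :: real
  assumes "0 < \<rho>" "\<rho> < 1" and le: "\<And>M::nat. (\<rho> ^ M) powr X \<le> C * (\<rho> ^ M) powr Y"
  shows "Y \<le> X"
proof (rule ccontr)
  assume "\<not> Y \<le> X"
  define q where "q = \<rho> powr (Y - X)"
  have q: "0 < q" "q < 1"
    using assms(1,2) \<open>\<not> Y \<le> X\<close> powr_less_mono2[of "Y - X" \<rho> 1] by (auto simp: q_def)
  have C: "1 \<le> C * q ^ M" for M
  proof -
    have "(\<rho> ^ M) powr X * 1 \<le> (\<rho> ^ M) powr X * (C * q ^ M)"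
      using le[of M] assms(1)
      by (simp add: q_def powr_powr mult_ac powr_add[symmetric] algebra_simps flip: powr_realpow)
    then show ?thesis
      using assms(1) by simp
  qed
  \<comment> \<open>\<open>C\<close> enters without a sign; the scale \<open>M = 0\<close> forces it
    to be positive.\<close>
  then have "0 < C"
    using C[of 0] by simp
  then obtain M where "q ^ M < 1 / C"
    using real_arch_pow_inv[of "1 / C" q] q by auto
  then have "C * q ^ M < 1"
    using \<open>0 < C\<close> by (simp add: field_simps)
  with C[of M] show False
    by simp
qed

lemma two_power_eq_powr:
  fixes \<rho> \<gamma> :: real
  assumes "0 < \<rho>" "\<rho> powr \<gamma> = 1 / 2"
  shows "2 ^ k = (\<rho> ^ k) powr (- \<gamma>)"
proof -
  have "(\<rho> ^ k) powr (- \<gamma>) = (\<rho> powr (- \<gamma>)) ^ k"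
    using assms(1) by (simp add: powr_powr mult_ac flip: powr_realpow)
  then show ?thesis
    using assms by (simp add: powr_minus)
qed

lemma two_powr_eq_powr:
  fixes \<rho> \<gamma> :: real
  assumes "0 < \<rho>" "\<rho> powr \<gamma> = 1 / 2"
  shows "2 powr (s * real M) = (\<rho> ^ M) powr (- (\<gamma> * s))"
proof -
  have "2 = \<rho> powr (- \<gamma>)"
    using assms by (simp add: powr_minus field_simps)
  then have "2 powr (s * real M) = (\<rho> powr (- \<gamma>)) powr (s * real M)"
    by simp
  then show ?thesis
    using assms(1) by (simp add: powr_powr mult_ac flip: powr_realpow)
qed

lemma card_window_set_ge:
  assumes "0 < \<eta>" "0 < \<rho>" "\<rho> < 1 / 2" "\<rho> powr \<gamma> = 1 / 2" "0 \<le> \<theta>" "\<theta> < 1"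
  shows "(\<rho> ^ M) powr (- (\<gamma> * (1 - \<theta>))) \<le> real (card (window_set \<eta> \<rho> \<theta> M))"
proof -
  have nn: "0 \<le> \<theta> * real M" "\<theta> * real M \<le> real M"
    using assms by (auto intro: mult_left_le_one_le)
  then have "nat \<lfloor>\<theta> * real M\<rfloor> \<le> M"
    by linarith
  then have "(1 - \<theta>) * real M \<le> real (M - nat \<lfloor>\<theta> * real M\<rfloor>)"
    using nn by (simp add: of_nat_diff left_diff_distrib)
  then have "2 powr ((1 - \<theta>) * real M) \<le> 2 powr real (M - nat \<lfloor>\<theta> * real M\<rfloor>)"
    by (intro powr_mono) auto
  also have "\<dots> = real (card (window_set \<eta> \<rho> \<theta> M))"
    using assms by (subst card_window_set) (auto simp: powr_realpow)
  finally show ?thesis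
    using two_powr_eq_powr[OF assms(2,4), of "1 - \<theta>" M] by simp
qed

section \<open>Minkowski dimension\<close>

lemma minkowski_lower:
  assumes "0 < \<eta>" "\<eta> \<le> 1 - \<rho>" "0 < \<rho>" "\<rho> < 1 / 2" "\<rho> powr \<gamma> = 1 / 2" "0 \<le> \<theta>" "\<theta> < 1"
    and bd: "minkowski_bound (dilation_set \<eta> \<rho> \<theta>) \<beta>'"
  shows "\<gamma> * (1 - \<theta>) \<le> \<beta>'"
proof (rule field_le_epsilon)
  fix \<epsilon> :: real assume "0 < \<epsilon>"
  with bd obtain C where C: "\<And>\<delta>. 0 < \<delta> \<Longrightarrow> \<delta> < 1 \<Longrightarrow>
      ereal_of_enat (covering_number (dilation_set \<eta> \<rho> \<theta>) \<delta>) \<le> ereal (C * \<delta> powr (- \<beta>' - \<epsilon>))"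
    unfolding minkowski_bound_def by blast
  \<comment> \<open>Half the separation constant, since \<open>covering_number_ge\<close> asks for
    strict separation. \<open>\<kappa> < 1\<close> makes \<open>\<kappa> * \<rho> ^ M\<close> an
    admissible \<open>\<delta>\<close> even for \<open>M = 0\<close>.\<close>
  define \<kappa> where "\<kappa> = \<eta> * gap \<rho> / 2"
  have \<kappa>: "0 < \<kappa>" "\<kappa> < 1"
    using scaled_gap[OF assms(1-4)] by (auto simp: \<kappa>_def)
  have "(\<rho> ^ M) powr (- (\<gamma> * (1 - \<theta>))) \<le> (C * \<kappa> powr (- \<beta>' - \<epsilon>)) * (\<rho> ^ M) powr (- \<beta>' - \<epsilon>)" for M
  proof -
    have "\<rho> ^ M \<le> 1"
      using assms by (intro power_le_one) auto
    then have "\<kappa> * \<rho> ^ M \<le> \<kappa> * 1"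
      using \<kappa> by (intro mult_left_mono) auto
    then have \<delta>: "\<kappa> * \<rho> ^ M < 1"
      using \<kappa>(2) by linarith
    have \<delta>': "0 < \<kappa> * \<rho> ^ M"
      using assms(3) \<kappa> by simp
    have "\<bar>x - y\<bar> > \<kappa> * \<rho> ^ M"
      if "x \<in> window_set \<eta> \<rho> \<theta> M" "y \<in> window_set \<eta> \<rho> \<theta> M" "x \<noteq> y" for x y
      using window_set_separation[OF assms(1,3,4) that] \<delta>' by (simp add: \<kappa>_def)
    then have "enat (card (window_set \<eta> \<rho> \<theta> M)) \<le> covering_number (dilation_set \<eta> \<rho> \<theta>) (\<kappa> * \<rho> ^ M)"
      by (intro covering_number_ge window_set_subset) auto
    then have "ereal_of_enat (enat (card (window_set \<eta> \<rho> \<theta> M)))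
        \<le> ereal_of_enat (covering_number (dilation_set \<eta> \<rho> \<theta>) (\<kappa> * \<rho> ^ M))"
      by (simp only: ereal_of_enat_le_iff)
    also note C[OF \<delta>' \<delta>]
    finally have "real (card (window_set \<eta> \<rho> \<theta> M)) \<le> C * (\<kappa> * \<rho> ^ M) powr (- \<beta>' - \<epsilon>)"
      by simp
    with card_window_set_ge[OF assms(1,3-7), of M] show ?thesis
      using \<kappa> assms by (simp add: powr_mult mult.assoc)
  qed
  from exponent_le_of_powr_le[OF assms(3) _ this] have "- \<beta>' - \<epsilon> \<le> - (\<gamma> * (1 - \<theta>))"
    using assms(4) by simp
  then show "\<gamma> * (1 - \<theta>) \<le> \<beta>' + \<epsilon>"
    by linarith
qed

text \<open>The left end of the window never decreases as \<open>M\<close> grows, so cutting a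
  longer window at \<open>n\<close> leaves a subset of \<open>window \<theta> n\<close>, while
  windows with \<open>M \<le> n\<close> are not cut at all. Hence only finitely many prefixes occur
  at each scale, although the set is a union over all \<open>M\<close>.\<close>

lemma window_prefix:
  assumes "0 \<le> \<theta>" "A \<subseteq> window \<theta> M"
  shows "A \<inter> {..<n} \<in> (\<Union>k\<le>n. Pow (window \<theta> k))"
proof (cases "M \<le> n")
  case True
  then show ?thesis
    using assms by blast
next
  case False
  then have "\<theta> * real n \<le> \<theta> * real M"
    using assms(1) by (intro mult_left_mono) auto
  then have "nat \<lfloor>\<theta> * real n\<rfloor> \<le> nat \<lfloor>\<theta> * real M\<rfloor>"
    by (intro nat_mono floor_mono)
  then have "A \<inter> {..<n} \<subseteq> window \<theta> n"
    using assms(2) by (auto simp: window_def)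
  then show ?thesis
    by blast
qed

text \<open>The window for \<open>k\<close> has about \<open>(1 - \<theta>) * k\<close> digits, so
  its number of subsets grows geometrically with ratio \<open>2 powr (1 - \<theta>) > 1\<close>. The
  sum over \<open>k \<le> n\<close> is comparable with its last term: uniting all scales costs only
  a constant.\<close>

lemma card_prefixes:
  assumes "0 \<le> \<theta>" "\<theta> < 1"
  shows "real (card (\<Union>k\<le>n. Pow (window \<theta> k))) \<le> 2 * 2 powr (1 - \<theta>) / (2 powr (1 - \<theta>) - 1) * 2 powr ((1 - \<theta>) * real n)"
proof -
  define q where "q = (2::real) powr (1 - \<theta>)"
  have q: "1 < q"
    using assms by (simp add: q_def)
  have "card (\<Union>k\<le>n. Pow (window \<theta> k)) \<le> (\<Sum>k\<le>n. card (Pow (window \<theta> k)))"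
    by (rule card_UN_le) auto
  then have "real (card (\<Union>k\<le>n. Pow (window \<theta> k))) \<le> (\<Sum>k\<le>n. real (card (Pow (window \<theta> k))))"
    by (simp flip: of_nat_sum)
  also have "\<dots> \<le> (\<Sum>k\<le>n. 2 * q ^ k)"
  proof (rule sum_mono)
    fix k
    have nn: "0 \<le> \<theta> * real k" "\<theta> * real k \<le> real k"
      using assms by (auto intro: mult_left_le_one_le)
    then have "nat \<lfloor>\<theta> * real k\<rfloor> \<le> k"
      by linarith
    moreover have "real (nat \<lfloor>\<theta> * real k\<rfloor>) \<ge> \<theta> * real k - 1"
      using nn by linarith
    ultimately have "real (k - nat \<lfloor>\<theta> * real k\<rfloor>) \<le> (1 - \<theta>) * real k + 1"
      by (simp add: of_nat_diff left_diff_distrib)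
    then have "2 powr real (k - nat \<lfloor>\<theta> * real k\<rfloor>) \<le> 2 powr ((1 - \<theta>) * real k + 1)"
      by (intro powr_mono) auto
    also have "\<dots> = 2 * q ^ k"
      using q by (simp add: q_def powr_add powr_powr flip: powr_realpow)
    finally show "real (card (Pow (window \<theta> k))) \<le> 2 * q ^ k"
      by (simp add: card_Pow powr_realpow window_def)
  qed
  also have "\<dots> = 2 * ((q ^ Suc n - 1) / (q - 1))"
    using q by (simp add: sum_distrib_left[symmetric] lessThan_Suc_atMost[symmetric] geometric_sum del: sum.lessThan_Suc)
  also have "\<dots> \<le> 2 * (q ^ Suc n / (q - 1))"
    using q by (intro mult_left_mono divide_right_mono) auto
  also have "\<dots> = 2 * q / (q - 1) * q ^ n"
    by simp
  also have "q ^ n = 2 powr ((1 - \<theta>) * real n)"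
    using q by (simp add: q_def powr_powr flip: powr_realpow)
  finally show ?thesis
    by (simp add: q_def)
qed

lemma minkowski_upper:
  assumes "0 < \<eta>" "\<eta> \<le> 1 - \<rho>" "0 < \<rho>" "\<rho> < 1 / 2" "\<rho> powr \<gamma> = 1 / 2" "0 < \<gamma>" "0 \<le> \<theta>" "\<theta> < 1"
  shows "minkowski_bound (dilation_set \<eta> \<rho> \<theta>) (\<gamma> * (1 - \<theta>))"
  unfolding minkowski_bound_def
proof (intro allI impI)
  fix \<epsilon> :: real assume "0 < \<epsilon>"
  define \<beta> where "\<beta> = \<gamma> * (1 - \<theta>)"
  have "0 < \<beta>"
    using assms by (simp add: \<beta>_def)
  define K where "K = 2 * 2 powr (1 - \<theta>) / (2 powr (1 - \<theta>) - (1::real))"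
  have "0 < K"
    using assms by (simp add: K_def)
  show "\<exists>C. \<forall>\<delta>. 0 < \<delta> \<and> \<delta> < 1 \<longrightarrow> ereal_of_enat (covering_number (dilation_set \<eta> \<rho> \<theta>) \<delta>)
      \<le> ereal (C * \<delta> powr (- (\<gamma> * (1 - \<theta>)) - \<epsilon>))"
  proof (intro exI[of _ "K * \<rho> powr (- \<beta>)"] allI impI)
    fix \<delta> :: real assume "0 < \<delta> \<and> \<delta> < 1"
    then have \<delta>: "0 < \<delta>" "\<delta> < 1"
      by auto
    obtain n where n: "\<rho> ^ n \<le> \<delta>" "\<delta> < \<rho> ^ n / \<rho>"
      using power_bracket[of \<rho> \<delta>] assms \<delta> by auto
    define F where "F = (\<Union>k\<le>n. Pow (window \<theta> k))"
    have "dilation_set \<eta> \<rho> \<theta> \<subseteq> (\<Union>a\<in>digit_point \<eta> \<rho> ` F. {a..a + \<delta>})"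
    proof
      fix x assume "x \<in> dilation_set \<eta> \<rho> \<theta>"
      then obtain M A where A: "A \<subseteq> window \<theta> M" "x = digit_point \<eta> \<rho> A"
        by (auto simp: dilation_set_def window_set_def)
      then have "finite A"
        by (meson finite_subset finite_window)
      then have "x \<in> {digit_point \<eta> \<rho> (A \<inter> {..<n})..digit_point \<eta> \<rho> (A \<inter> {..<n}) + \<delta>}"
        using digit_point_prefix[OF assms(1-4), of A n] n A by auto
      moreover have "A \<inter> {..<n} \<in> F"
        unfolding F_def by (rule window_prefix[OF assms(7) A(1)])
      ultimately show "x \<in> (\<Union>a\<in>digit_point \<eta> \<rho> ` F. {a..a + \<delta>})"
        by blast
    qed
    moreover have fin: "finite F"
      by (auto simp: F_def)
    ultimately have "covering_number (dilation_set \<eta> \<rho> \<theta>) \<delta> \<le> enat (card (digit_point \<eta> \<rho> ` F))"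
      by (intro covering_number_le) auto
    also have "\<dots> \<le> enat (card F)"
      using fin by (simp add: card_image_le)
    finally have "ereal_of_enat (covering_number (dilation_set \<eta> \<rho> \<theta>) \<delta>) \<le> ereal (real (card F))"
      using ereal_of_enat_le_iff[of _ "enat (card F)"] by simp
    also have "real (card F) \<le> K * (\<rho> ^ n) powr (- \<beta>)"
      using card_prefixes[OF assms(7,8), of n] two_powr_eq_powr[OF assms(3,5), of "1 - \<theta>" n]
      by (simp add: F_def K_def \<beta>_def)
    also have "\<dots> \<le> K * (\<rho> * \<delta>) powr (- \<beta>)"
      using n \<open>0 < K\<close> \<open>0 < \<beta>\<close> \<delta> assms
      by (intro mult_left_mono powr_mono2') (auto simp: field_simps)
    also have "\<dots> = K * \<rho> powr (- \<beta>) * \<delta> powr (- \<beta>)"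
      using assms \<delta> by (simp add: powr_mult)
    also have "\<dots> \<le> K * \<rho> powr (- \<beta>) * \<delta> powr (- \<beta> - \<epsilon>)"
      using \<open>0 < K\<close> \<open>0 < \<epsilon>\<close> \<delta> by (intro mult_left_mono powr_mono') auto
    finally show "ereal_of_enat (covering_number (dilation_set \<eta> \<rho> \<theta>) \<delta>)
      \<le> ereal (K * \<rho> powr (- \<beta>) * \<delta> powr (- (\<gamma> * (1 - \<theta>)) - \<epsilon>))"
      by (simp add: \<beta>_def)
  qed
qed

lemma has_upper_minkowski_dim_dilation_set:
  assumes "0 < \<eta>" "\<eta> \<le> 1 - \<rho>" "0 < \<rho>" "\<rho> < 1 / 2" "\<rho> powr \<gamma> = 1 / 2" "0 < \<gamma>" "0 \<le> \<theta>" "\<theta> < 1"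
  shows "has_upper_minkowski_dim (dilation_set \<eta> \<rho> \<theta>) (\<gamma> * (1 - \<theta>))"
  unfolding has_upper_minkowski_dim_def
  using minkowski_upper[OF assms] minkowski_lower[OF assms(1-5,7,8)] by blast

section \<open>Assouad dimension\<close>

text \<open>For any prescribed \<open>k\<close>, the window of a large \<open>M\<close> ends in a
  block of \<open>k\<close> free digits. Varying only this block gives \<open>2 ^ k\<close> points
  in an interval of length \<open>\<rho> ^ (M - k)\<close>: the full Cantor set at relative scale
  \<open>\<rho> ^ k\<close>, whatever \<open>\<theta>\<close> is.\<close>

lemma assouad_lower:
  assumes "0 < \<eta>" "\<eta> \<le> 1 - \<rho>" "0 < \<rho>" "\<rho> < 1 / 2" "\<rho> powr \<gamma> = 1 / 2" "0 \<le> \<theta>" "\<theta> < 1"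
    and bd: "assouad_bound (dilation_set \<eta> \<rho> \<theta>) \<gamma>'"
  shows "\<gamma> \<le> \<gamma>'"
proof (rule field_le_epsilon)
  fix \<epsilon> :: real assume "0 < \<epsilon>"
  let ?E = "dilation_set \<eta> \<rho> \<theta>"
  obtain \<delta>0 where "0 < \<delta>0" and \<delta>0: "\<And>\<epsilon>. \<epsilon> > 0 \<Longrightarrow> \<exists>C::real. \<forall>\<delta> I.
      0 < \<delta> \<and> \<delta> < \<delta>0 \<and> is_interval I \<and> \<delta> < measure lborel I \<and> measure lborel I < \<delta>0 \<longrightarrow>
      ereal_of_enat (covering_number (?E \<inter> I) \<delta>)
        \<le> ereal (C * (\<delta> / measure lborel I) powr (- \<gamma>' - \<epsilon>))"
    using bd unfolding assouad_bound_def by blast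
  obtain C where C: "\<And>\<delta> I. \<lbrakk>0 < \<delta>; \<delta> < \<delta>0; is_interval I; \<delta> < measure lborel I; measure lborel I < \<delta>0\<rbrakk> \<Longrightarrow>
      ereal_of_enat (covering_number (?E \<inter> I) \<delta>)
        \<le> ereal (C * (\<delta> / measure lborel I) powr (- \<gamma>' - \<epsilon>))"
    using \<delta>0[OF \<open>0 < \<epsilon>\<close>] by blast
  define \<kappa> where "\<kappa> = \<eta> * gap \<rho> / 2"
  have \<kappa>: "0 < \<kappa>" "\<kappa> < 1"
    using scaled_gap[OF assms(1-4)] by (auto simp: \<kappa>_def)
  obtain j0 where j0: "\<rho> ^ j0 < \<delta>0"
    using real_arch_pow_inv[OF \<open>0 < \<delta>0\<close>, of \<rho>] assms by auto
  have "(\<rho> ^ k) powr (- \<gamma>) \<le> (C * \<kappa> powr (- \<gamma>' - \<epsilon>)) * (\<rho> ^ k) powr (- \<gamma>' - \<epsilon>)" for k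
  proof -
    \<comment> \<open>The first bound makes the interval shorter than \<open>\<delta>0\<close>; the
      second puts the last \<open>k\<close> digits inside the window.\<close>
    obtain M :: nat where "real M \<ge> max (real (j0 + k)) (real k / (1 - \<theta>))"
      using real_arch_simple by blast
    then have M: "M \<ge> j0 + k" "real k \<le> (1 - \<theta>) * real M"
      using assms by (auto simp: field_simps)
    define j where "j = M - k"
    have j: "j0 \<le> j" "j + k = M"
      using M by (auto simp: j_def)
    have "\<theta> * real M \<le> real j"
      using M by (simp add: j_def of_nat_diff algebra_simps)
    then have win: "{j..<M} \<subseteq> window \<theta> M"
      by (auto simp: window_def) linarith
    define S where "S = digit_point \<eta> \<rho> ` Pow {j..<M}"
    define I where "I = {1..1 + \<rho> ^ j}"
    have mI: "measure lborel I = \<rho> ^ j"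
      using assms by (simp add: I_def)
    have SI: "S \<subseteq> ?E \<inter> I"
    proof
      fix x assume "x \<in> S"
      then obtain A where A: "A \<subseteq> {j..<M}" "x = digit_point \<eta> \<rho> A"
        by (auto simp: S_def)
      then have "finite A"
        using finite_subset by blast
      moreover have "A \<inter> {..<j} = {}"
        using A by auto
      ultimately have "x \<in> I"
        using digit_point_prefix[OF assms(1-4), of A j] A
        by (simp add: I_def digit_point_def digit_sum_def)
      moreover have "x \<in> ?E"
        using A win by (auto simp: dilation_set_def window_set_def)
      ultimately show "x \<in> ?E \<inter> I"
        by blast
    qed
    have pos: "0 < \<rho> ^ j" "0 < \<rho> ^ M"
      using assms by auto
    have Mj: "\<rho> ^ M \<le> \<rho> ^ j"
      using j assms by (intro power_decreasing) auto
    have jj: "\<rho> ^ j \<le> \<rho> ^ j0"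
      using j assms by (intro power_decreasing) auto
    have "\<kappa> * \<rho> ^ M < 1 * \<rho> ^ M"
      using \<kappa> pos by (intro mult_strict_right_mono) auto
    then have \<delta>: "0 < \<kappa> * \<rho> ^ M" "\<kappa> * \<rho> ^ M < \<rho> ^ j" "\<rho> ^ j < \<delta>0"
      using \<kappa>(1) pos Mj jj j0 by (simp, linarith+)
    have "\<bar>x - y\<bar> > \<kappa> * \<rho> ^ M" if "x \<in> S" "y \<in> S" "x \<noteq> y" for x y
    proof -
      have "x \<in> window_set \<eta> \<rho> \<theta> M" "y \<in> window_set \<eta> \<rho> \<theta> M"
        using that win by (auto simp: S_def window_set_def)
      then show ?thesis
        using window_set_separation[OF assms(1,3,4) _ _ that(3), of \<theta> M] \<delta> by (simp add: \<kappa>_def)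
    qed
    then have "enat (card S) \<le> covering_number (?E \<inter> I) (\<kappa> * \<rho> ^ M)"
      using SI by (intro covering_number_ge) (auto simp: S_def)
    then have "ereal_of_enat (enat (card S)) \<le> ereal_of_enat (covering_number (?E \<inter> I) (\<kappa> * \<rho> ^ M))"
      by (simp only: ereal_of_enat_le_iff)
    also have "\<dots> \<le> ereal (C * (\<kappa> * \<rho> ^ M / measure lborel I) powr (- \<gamma>' - \<epsilon>))"
      using \<delta> by (intro C) (auto simp: mI, auto simp: I_def is_interval_cc)
    finally have "real (card S) \<le> C * (\<kappa> * \<rho> ^ M / \<rho> ^ j) powr (- \<gamma>' - \<epsilon>)"
      by (simp add: mI)
    also have "\<kappa> * \<rho> ^ M / \<rho> ^ j = \<kappa> * \<rho> ^ k"
      using assms(3) unfolding j(2)[symmetric] by (simp add: power_add)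
    finally have "real (card S) \<le> C * (\<kappa> * \<rho> ^ k) powr (- \<gamma>' - \<epsilon>)" .
    moreover have "card S = 2 ^ k"
    proof -
      have "inj_on (digit_point \<eta> \<rho>) (Pow {j..<M})"
        by (rule inj_on_subset[OF digit_point_inj[OF assms(1,3,4), of M]]) auto
      then show ?thesis
        using j unfolding S_def by (simp add: card_image card_Pow)
    qed
    ultimately show ?thesis
      using \<kappa> assms two_power_eq_powr[OF assms(3,5), of k] by (simp add: powr_mult mult.assoc)
  qed
  from exponent_le_of_powr_le[OF assms(3) _ this] have "- \<gamma>' - \<epsilon> \<le> - \<gamma>"
    using assms(4) by simp
  then show "\<gamma> \<le> \<gamma>' + \<epsilon>"
    by linarith
qed

lemma interval_diff_le_measure:
  fixes I :: "real set"
  assumes "is_interval I" "0 < measure lborel I" "x \<in> I" "y \<in> I"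
  shows "\<bar>x - y\<bar> \<le> measure lborel I"
proof -
  \<comment> \<open>\<open>measure\<close> is 0 on sets of infinite measure and on nonmeasurable
    sets, so its positivity rules out both.\<close>
  have "emeasure lborel I \<noteq> \<infinity>"
    using assms(2) by (intro notI) (simp add: measure_def)
  moreover have "I \<in> sets lborel"
  proof (rule ccontr)
    assume "I \<notin> sets lborel"
    then have "emeasure lborel I = 0"
      by (rule emeasure_notin_sets)
    with assms(2) show False
      by (simp add: measure_def)
  qed
  ultimately have "I \<in> fmeasurable lborel"
    by (intro fmeasurableI) (auto simp: less_top)
  moreover have "{min x y..max x y} \<subseteq> I"
  proof
    fix z assume "z \<in> {min x y..max x y}"
    then have "x \<le> z \<and> z \<le> y \<or> y \<le> z \<and> z \<le> x"
      by (auto simp: min_def max_def split: if_splits)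
    then show "z \<in> I"
      using assms unfolding is_interval_1 by blast
  qed
  ultimately have "measure lborel {min x y..max x y} \<le> measure lborel I"
    by (intro measure_mono_fmeasurable) auto
  then show ?thesis
    by (simp add: min_def max_def abs_if split: if_splits)
qed

text \<open>Points of \<open>E\<close> in one interval \<open>I\<close> share all digits below an
  index \<open>j\<close> with \<open>\<rho> ^ j\<close> of order \<open>\<bar>I\<bar>\<close>, and
  digits from \<open>n\<close> on, with \<open>\<rho> ^ n\<close> of order \<open>\<delta>\<close>,
  are absorbed by the covering intervals. Only the digits from \<open>j\<close> to \<open>n\<close>
  are free.\<close>

lemma assouad_upper:
  assumes "0 < \<eta>" "\<eta> \<le> 1 - \<rho>" "0 < \<rho>" "\<rho> < 1 / 2" "\<rho> powr \<gamma> = 1 / 2" "0 < \<gamma>"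
  shows "assouad_bound (dilation_set \<eta> \<rho> \<theta>) \<gamma>"
  unfolding assouad_bound_def
proof (rule exI[of _ "1::real"], intro conjI allI impI)
  fix \<epsilon> :: real assume "0 < \<epsilon>"
  let ?E = "dilation_set \<eta> \<rho> \<theta>"
  define \<kappa> where "\<kappa> = \<eta> * gap \<rho>"
  have \<kappa>: "0 < \<kappa>" "\<kappa> < 1"
    using scaled_gap[OF assms(1-4)] by (auto simp: \<kappa>_def)
  \<comment> \<open>From \<open>\<rho> ^ j \<le> L / \<kappa>\<close> and
    \<open>\<rho> * \<delta> \<le> \<rho> ^ n\<close>. That \<open>K\<close> is at least 1 settles
    the case \<open>n \<le> j\<close>, where one interval suffices.\<close>
  define K where "K = (1 / (\<kappa> * \<rho>)) powr \<gamma>"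
  have "\<kappa> * \<rho> \<le> 1"
    using \<kappa> assms by (simp add: mult_le_one)
  then have K: "1 \<le> K"
    unfolding K_def using \<kappa> assms by (intro ge_one_powr_ge_zero) auto
  show "\<exists>C. \<forall>\<delta> I. 0 < \<delta> \<and> \<delta> < 1 \<and> is_interval I \<and> \<delta> < measure lborel I \<and> measure lborel I < 1 \<longrightarrow>
      ereal_of_enat (covering_number (?E \<inter> I) \<delta>) \<le> ereal (C * (\<delta> / measure lborel I) powr (- \<gamma> - \<epsilon>))"
  proof (intro exI[of _ K] allI impI)
    fix \<delta> and I :: "real set"
    assume "0 < \<delta> \<and> \<delta> < 1 \<and> is_interval I \<and> \<delta> < measure lborel I \<and> measure lborel I < 1"
    then have \<delta>: "0 < \<delta>" "\<delta> < 1" "is_interval I" "\<delta> < measure lborel I"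
      by auto
    define L where "L = measure lborel I"
    have L: "0 < L" "\<delta> < L"
      using \<delta> by (auto simp: L_def)
    obtain n where n: "\<rho> ^ n \<le> \<delta>" "\<delta> < \<rho> ^ n / \<rho>"
      using power_bracket[of \<rho> \<delta>] assms \<delta> by auto
    define j where "j = (LEAST j. \<kappa> * \<rho> ^ j \<le> L)"
    obtain j0 where "\<rho> ^ j0 < L / \<kappa>"
      using real_arch_pow_inv[of "L / \<kappa>" \<rho>] L \<kappa> assms by auto
    then have "\<kappa> * \<rho> ^ j0 \<le> L"
      using \<kappa> by (simp add: field_simps)
    then have j: "\<kappa> * \<rho> ^ j \<le> L"
      unfolding j_def by (rule LeastI)
    have least: "j \<le> i" if "\<kappa> * \<rho> ^ i \<le> L" for i
      unfolding j_def using that by (rule Least_le)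
    have "\<exists>A. finite A \<and> card A \<le> 2 ^ (n - j) \<and> ?E \<inter> I \<subseteq> (\<Union>a\<in>A. {a..a + \<delta>})"
    proof (cases "?E \<inter> I = {}")
      case True
      then show ?thesis
        by (intro exI[of _ "{}"]) auto
    next
      case False
      then obtain A0 M0 where A0: "A0 \<subseteq> window \<theta> M0" "digit_point \<eta> \<rho> A0 \<in> I"
        by (auto simp: dilation_set_def window_set_def)
      \<comment> \<open>The common digits are read off from one fixed point of \<open>I\<close>. The
        extra cut at \<open>n\<close> matters when \<open>n < j\<close>: then \<open>{j..<n}\<close>
        is empty and a single prefix remains.\<close>
      define h where "h R = digit_point \<eta> \<rho> ((A0 \<inter> {..<j} \<inter> {..<n}) \<union> R)" for R
      have "?E \<inter> I \<subseteq> (\<Union>a\<in>h ` Pow {j..<n}. {a..a + \<delta>})"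
      proof
        fix x assume "x \<in> ?E \<inter> I"
        then obtain A M where A: "A \<subseteq> window \<theta> M" "x = digit_point \<eta> \<rho> A" "x \<in> I"
          by (auto simp: dilation_set_def window_set_def)
        have fin: "finite A" "finite A0"
          using A A0 by (meson finite_subset finite_window)+
        have le: "j \<le> i" if "i \<in> (A - A0) \<union> (A0 - A)" for i
        proof -
          have "\<kappa> * \<rho> ^ i \<le> \<bar>digit_point \<eta> \<rho> A - digit_point \<eta> \<rho> A0\<bar>"
            unfolding \<kappa>_def using digit_point_separation[OF assms(1,3,4) fin that] .
          also have "\<dots> \<le> L"
            using interval_diff_le_measure[of I] A A0 \<delta> unfolding L_def by auto
          finally show ?thesis
            by (rule least)
        qed
        have "A \<inter> {..<n} = (A0 \<inter> {..<j} \<inter> {..<n}) \<union> (A \<inter> {j..<n})"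
        proof -
          have "i \<in> A \<longleftrightarrow> i \<in> A0" if "i < j" for i
            using le[of i] that by auto
          then show ?thesis
            by auto
        qed
        then have "digit_point \<eta> \<rho> (A \<inter> {..<n}) = h (A \<inter> {j..<n})"
          by (simp add: h_def)
        then have "x \<in> {h (A \<inter> {j..<n})..h (A \<inter> {j..<n}) + \<delta>}"
          using digit_point_prefix[OF assms(1-4) fin(1), of n] n A by auto
        then show "x \<in> (\<Union>a\<in>h ` Pow {j..<n}. {a..a + \<delta>})"
          by (rule UN_I[rotated]) auto
      qed
      moreover have "card (h ` Pow {j..<n}) \<le> 2 ^ (n - j)"
      proof -
        have "card (h ` Pow {j..<n}) \<le> card (Pow {j..<n})"
          by (rule card_image_le) simp
        then show ?thesis
          by (simp add: card_Pow)
      qed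
      moreover have "finite (h ` Pow {j..<n})"
        by simp
      ultimately show ?thesis
        by blast
    qed
    then obtain A where A: "finite A" "card A \<le> 2 ^ (n - j)" "?E \<inter> I \<subseteq> (\<Union>a\<in>A. {a..a + \<delta>})"
      by blast
    have "covering_number (?E \<inter> I) \<delta> \<le> enat (2 ^ (n - j))"
      using covering_number_le[OF A(1,3)] A(2) by (meson enat_ord_simps(1) order_trans)
    then have "ereal_of_enat (covering_number (?E \<inter> I) \<delta>) \<le> ereal (2 ^ (n - j))"
      using ereal_of_enat_le_iff[of _ "enat (2 ^ (n - j))"] by simp
    also have "(2::real) ^ (n - j) \<le> K * (L / \<delta>) powr \<gamma>"
    proof (cases "n \<le> j")
      case True
      have "1 \<le> (L / \<delta>) powr \<gamma>"
        using L \<delta> assms by (intro ge_one_powr_ge_zero) auto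
      then have "1 * 1 \<le> K * (L / \<delta>) powr \<gamma>"
        using K by (intro mult_mono) auto
      then show ?thesis
        using True by simp
    next
      case False
      have "(2::real) ^ (n - j) = (\<rho> ^ (n - j)) powr (- \<gamma>)"
        by (rule two_power_eq_powr[OF assms(3,5)])
      also have "\<dots> = (\<rho> ^ j / \<rho> ^ n) powr \<gamma>"
        using False assms by (simp add: powr_minus power_diff powr_divide)
      also have "\<dots> \<le> ((L / \<kappa>) / (\<rho> * \<delta>)) powr \<gamma>"
      proof -
        have "\<rho> ^ j \<le> L / \<kappa>" "\<rho> * \<delta> \<le> \<rho> ^ n"
          using j n \<kappa> assms(3) by (auto simp: field_simps)
        then show ?thesis
          using \<kappa> assms(3,6) \<delta> L by (intro powr_mono2 frac_le) auto
      qed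
      also have "\<dots> = K * (L / \<delta>) powr \<gamma>"
      proof -
        have "L / \<kappa> / (\<rho> * \<delta>) = 1 / (\<kappa> * \<rho>) * (L / \<delta>)"
          by simp
        then show ?thesis
          unfolding K_def using L \<delta> \<kappa> assms(3) by (simp only: powr_mult)
      qed
      finally show ?thesis .
    qed
    also have "\<dots> \<le> K * (L / \<delta>) powr (\<gamma> + \<epsilon>)"
      using K L \<delta> \<open>0 < \<epsilon>\<close> by (intro mult_left_mono powr_mono) auto
    also have "(L / \<delta>) powr (\<gamma> + \<epsilon>) = (\<delta> / L) powr (- \<gamma> - \<epsilon>)"
    proof -
      have "(\<delta> / L) powr (- s) = (L / \<delta>) powr s" for s
        using L \<delta> by (simp add: powr_divide powr_minus)
      from this[of "\<gamma> + \<epsilon>"] show ?thesis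
        by simp
    qed
    finally show "ereal_of_enat (covering_number (?E \<inter> I) \<delta>)
        \<le> ereal (K * (\<delta> / measure lborel I) powr (- \<gamma> - \<epsilon>))"
      by (simp add: L_def)
  qed
qed simp

lemma has_upper_assouad_dim_dilation_set:
  assumes "0 < \<eta>" "\<eta> \<le> 1 - \<rho>" "0 < \<rho>" "\<rho> < 1 / 2" "\<rho> powr \<gamma> = 1 / 2" "0 < \<gamma>" "0 \<le> \<theta>" "\<theta> < 1"
  shows "has_upper_assouad_dim (dilation_set \<eta> \<rho> \<theta>) \<gamma>"
  unfolding has_upper_assouad_dim_def
  using assouad_upper[OF assms(1-6)] assouad_lower[OF assms(1-5,7,8)] by blast

section \<open>The regions of exponents\<close>

text \<open>The four inequalities are the sides \<open>Q1 Q2\<close>, \<open>Q1 Q4\<close>,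
  \<open>Q2 Q3\<close> and \<open>Q3 Q4\<close>, in this order. The ray from \<open>Q1\<close>
  through \<open>Q3\<close> cuts the quadrilateral into two triangles; \<open>a\<close> and
  \<open>b\<close> are the barycentric coordinates in each of them, and \<open>a + b \<le> 1\<close>
  is the side opposite \<open>Q1\<close>.\<close>

lemma region_Q_memI:
  assumes \<beta>: "0 < \<beta>" "\<beta> < 1" and \<gamma>: "0 < \<gamma>"
    and "v \<le> u" "u \<le> 2 * v" "2 * u \<le> 1 + (1 - \<beta>) * v"
    and "u * (2 * \<gamma> + \<beta>) \<le> \<beta> + v * (4 * \<gamma> - 2 * \<beta> * \<gamma> - \<beta>)"
  shows "(u, v) \<in> region_Q \<beta> \<gamma>"
proof (cases "u \<le> (2 - \<beta>) * v")
  case True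
  define a where "a = (1 + \<beta>) * (v * (2 - \<beta>) - u) / (1 - \<beta>)"
  define b where "b = (u - v) * (3 - \<beta>) / (1 - \<beta>)"
  have nn: "0 \<le> a" "0 \<le> b"
    using assms True by (auto simp: a_def b_def mult.commute)
  have "a + b = 2 * u - v * (1 - \<beta>)"
    using \<beta> by (simp add: a_def b_def divide_simps) (simp add: algebra_simps)
  then have "a + b \<le> 1"
    using assms by (simp add: mult.commute)
  moreover have "(u, v) = Q1 + a *\<^sub>R (Q2 \<beta> - Q1) + b *\<^sub>R (Q3 \<beta> - Q1)"
    using \<beta> by (simp add: Q1_def Q2_def Q3_def a_def b_def divide_simps) (simp add: algebra_simps)
  ultimately have "(u, v) \<in> convex hull {Q1, Q2 \<beta>, Q3 \<beta>}"
    using nn unfolding convex_hull_3_alt by blast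
  then show ?thesis
    unfolding region_Q_def using hull_mono[of "{Q1, Q2 \<beta>, Q3 \<beta>}" "{Q1, Q2 \<beta>, Q3 \<beta>, Q4 \<gamma>}" convex]
    by blast
next
  case False
  define a where "a = (3 - \<beta>) * (2 * v - u) / \<beta>"
  define b where "b = (3 + 2 * \<gamma>) * (u - (2 - \<beta>) * v) / \<beta>"
  have nn: "0 \<le> a" "0 \<le> b"
    using assms False by (auto simp: a_def b_def)
  have "a + b = (u * (2 * \<gamma> + \<beta>) - v * (4 * \<gamma> - 2 * \<beta> * \<gamma> - \<beta>)) / \<beta>"
    using \<beta> by (simp add: a_def b_def divide_simps) (simp add: algebra_simps)
  also have "\<dots> \<le> 1"
    using assms by (simp add: divide_simps)
  finally have "a + b \<le> 1" .
  moreover have "(u, v) = Q1 + a *\<^sub>R (Q3 \<beta> - Q1) + b *\<^sub>R (Q4 \<gamma> - Q1)"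
    using \<beta> \<gamma> by (simp add: Q1_def Q3_def Q4_def a_def b_def divide_simps) (simp add: algebra_simps)
  ultimately have "(u, v) \<in> convex hull {Q1, Q3 \<beta>, Q4 \<gamma>}"
    using nn unfolding convex_hull_3_alt by blast
  then show ?thesis
    unfolding region_Q_def using hull_mono[of "{Q1, Q3 \<beta>, Q4 \<gamma>}" "{Q1, Q2 \<beta>, Q3 \<beta>, Q4 \<gamma>}" convex]
    by blast
qed

lemma region_R_memI:
  assumes \<beta>: "0 < \<beta>" "\<beta> < 1" and \<gamma>: "0 < \<gamma>"
    and uv: "v < u" "u < 2 * v" "2 * u < 1 + (1 - \<beta>) * v"
      "u * (2 * \<gamma> + \<beta>) < \<beta> + v * (4 * \<gamma> - 2 * \<beta> * \<gamma> - \<beta>)"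
  shows "(u, v) \<in> region_R \<beta> \<gamma>"
proof -
  let ?O = "{z :: real \<times> real. snd z < fst z} \<inter> {z. fst z < 2 * snd z} \<inter> {z. 2 * fst z < 1 + (1 - \<beta>) * snd z} \<inter>
    {z. fst z * (2 * \<gamma> + \<beta>) < \<beta> + snd z * (4 * \<gamma> - 2 * \<beta> * \<gamma> - \<beta>)}"
  have "open ?O"
    by (intro open_Int open_Collect_less continuous_intros)
  moreover have "?O \<subseteq> region_Q \<beta> \<gamma>"
    using region_Q_memI[OF \<beta> \<gamma>] by (auto simp: less_imp_le)
  moreover have "(u, v) \<in> ?O"
    using uv by simp
  ultimately show ?thesis
    unfolding region_R_def using interiorI by blast
qed

lemma affine_combination_less:
  fixes A B c :: real
  assumes "A * u + B * v \<le> c" "A * u0 + B * v0 < c" "0 < e" "e \<le> 1"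
  shows "A * ((1 - e) * u + e * u0) + B * ((1 - e) * v + e * v0) < c"
proof -
  have "(1 - e) * (A * u + B * v) \<le> (1 - e) * c" "e * (A * u0 + B * v0) < e * c"
    using assms by (auto intro: mult_left_mono)
  then show ?thesis
    by (simp add: algebra_simps)
qed

text \<open>Near the origin every strict inequality other than \<open>v < u < 2 v\<close> is trivial, so moving a
  point slightly towards \<open>(3 \<kappa>, 2 \<kappa>)\<close> makes all of them strict.\<close>

lemma closure_region_R_half_planes:
  assumes \<beta>: "0 < \<beta>" "\<beta> < 1" and \<gamma>: "0 < \<gamma>"
    and uv: "v \<le> u" "u \<le> 2 * v" "2 * u \<le> 1 + (1 - \<beta>) * v"
      "u * (2 * \<gamma> + \<beta>) \<le> \<beta> + v * (4 * \<gamma> - 2 * \<beta> * \<gamma> - \<beta>)"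
    and L: "A * u + B * v \<le> 1" "A' * u + B' * v \<le> 1"
  shows "(u, v) \<in> closure {(u, v) \<in> region_R \<beta> \<gamma>. A * u + B * v < 1 \<and> A' * u + B' * v < 1}"
  unfolding closure_approachable
proof (intro allI impI)
  fix \<epsilon> :: real assume "0 < \<epsilon>"
  let ?D = "4 * \<gamma> - 2 * \<beta> * \<gamma> - \<beta>"
  have ev: "eventually (\<lambda>\<kappa>. f \<kappa> < c) (at_right (0::real))"
    if "continuous (at_right 0) f" "f 0 < (c::real)" for f c
    using that by (auto simp: continuous_within intro: order_tendstoD)
  have "eventually (\<lambda>\<kappa>. 2 * (3 * \<kappa>) + (\<beta> - 1) * (2 * \<kappa>) < 1 \<and>
      (2 * \<gamma> + \<beta>) * (3 * \<kappa>) + (- ?D) * (2 * \<kappa>) < \<beta> \<and>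
      A * (3 * \<kappa>) + B * (2 * \<kappa>) < 1 \<and> A' * (3 * \<kappa>) + B' * (2 * \<kappa>) < 1 \<and> 0 < \<kappa>) (at_right (0::real))"
    using \<beta> by (intro eventually_conj ev continuous_intros eventually_at_right_less) auto
  then obtain \<kappa> where \<kappa>: "2 * (3 * \<kappa>) + (\<beta> - 1) * (2 * \<kappa>) < 1"
      "(2 * \<gamma> + \<beta>) * (3 * \<kappa>) + (- ?D) * (2 * \<kappa>) < \<beta>"
      "A * (3 * \<kappa>) + B * (2 * \<kappa>) < 1" "A' * (3 * \<kappa>) + B' * (2 * \<kappa>) < 1" "0 < \<kappa>"
    using eventually_happens'[OF trivial_limit_at_right_real] by blast
  define p where "p e = ((1 - e) * u + e * (3 * \<kappa>), (1 - e) * v + e * (2 * \<kappa>))" for e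
  have "((\<lambda>e. dist (p e) (u, v)) \<longlongrightarrow> dist (p 0) (u, v)) (at_right 0)"
    unfolding p_def by (intro tendsto_intros)
  then have "eventually (\<lambda>e. dist (p e) (u, v) < \<epsilon>) (at_right 0)"
    using \<open>0 < \<epsilon>\<close> by (intro order_tendstoD) (auto simp: p_def)
  moreover have "eventually (\<lambda>e::real. e < 1) (at_right 0)"
    unfolding eventually_at_right_field by (auto intro: exI[of _ 1])
  ultimately have "eventually (\<lambda>e. dist (p e) (u, v) < \<epsilon> \<and> e < 1 \<and> 0 < e) (at_right 0)"
    by (intro eventually_conj eventually_at_right_less)
  then obtain e where e: "dist (p e) (u, v) < \<epsilon>" "e < 1" "0 < e"
    using eventually_happens'[OF trivial_limit_at_right_real] by blast
  have comb: "A * fst (p e) + B * snd (p e) < c"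
    if "A * u + B * v \<le> c" "A * (3 * \<kappa>) + B * (2 * \<kappa>) < c" for A B c
    using affine_combination_less[OF that, of e] e by (simp add: p_def)
  have "p e \<in> region_R \<beta> \<gamma>"
    using comb[of "-1" 1 0] comb[of 1 "-2" 0] comb[of 2 "\<beta> - 1" 1] comb[of "2 * \<gamma> + \<beta>" "- ?D" \<beta>] \<kappa> uv
    by (subst surjective_pairing, intro region_R_memI[OF \<beta> \<gamma>]) (simp_all add: algebra_simps)
  moreover have "A * fst (p e) + B * snd (p e) < 1" "A' * fst (p e) + B' * snd (p e) < 1"
    using comb \<kappa> L by auto
  ultimately show "\<exists>y\<in>{(u, v) \<in> region_R \<beta> \<gamma>. A * u + B * v < 1 \<and> A' * u + B' * v < 1}. dist y (u, v) < \<epsilon>"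
    using e by (intro bexI[of _ "p e"]) (auto simp: case_prod_beta)
qed

lemma closure_DeltaI:
  assumes \<beta>: "0 < \<beta>" "\<beta> < 1" and \<gamma>: "0 < \<gamma>"
    and uv: "v \<le> u" "u \<le> 2 * v" "2 * u \<le> 1 + (1 - \<beta>) * v"
      "u * (2 * \<gamma> + \<beta>) \<le> \<beta> + v * (4 * \<gamma> - 2 * \<beta> * \<gamma> - \<beta>)"
    and "(real d + 1) * (u - v) \<le> 1"
  shows "(u, v) \<in> closure (Delta d \<beta> \<gamma>)"
proof -
  \<comment> \<open>There is only one additional half-plane here, so it is supplied twice.\<close>
  have "(u, v) \<in> closure {(u, v) \<in> region_R \<beta> \<gamma>. (real d + 1) * u + (- (real d + 1)) * v < 1 \<and>
      (real d + 1) * u + (- (real d + 1)) * v < 1}"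
    using assms by (intro closure_region_R_half_planes) (auto simp: algebra_simps)
  also have "{(u, v) \<in> region_R \<beta> \<gamma>. (real d + 1) * u + (- (real d + 1)) * v < 1 \<and>
      (real d + 1) * u + (- (real d + 1)) * v < 1} = Delta d \<beta> \<gamma>"
    by (auto simp: Delta_def algebra_simps)
  finally show ?thesis .
qed

lemma closure_Delta_tildeI:
  assumes \<beta>: "0 < \<beta>" "\<beta> < 1" and \<gamma>: "0 < \<gamma>" "\<beta> \<le> \<gamma>" and d: "d \<ge> 2"
    and uv: "v \<le> u" "u \<le> 2 * v" "2 * u \<le> 1 + (1 - \<beta>) * v"
      "u * (2 * \<gamma> + \<beta>) \<le> \<beta> + v * (4 * \<gamma> - 2 * \<beta> * \<gamma> - \<beta>)"
    and L: "u * (real d + 1) \<le> 1 + v * (real d - real d * \<beta> + 1)"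
      "u * (real d * \<gamma> + \<beta>) \<le> \<beta> + v * (2 * (real d * \<gamma> + \<beta>) - \<beta> * (real d + 1 + real d * \<gamma>))"
  shows "(u, v) \<in> closure (Delta_tilde d \<beta> \<gamma>)"
proof -
  define m where "m = real d * \<gamma> + \<beta>"
  define n where "n = 2 * m - \<beta> * (real d + 1 + real d * \<gamma>)"
  define k where "k = real d - real d * \<beta> + 1"
  have d': "real d \<ge> 2"
    using d by linarith
  have "real d * \<beta> < real d"
    using \<beta> d' by simp
  then have k: "0 < k"
    by (simp add: k_def)
  have m: "0 < m"
    using \<beta> \<gamma> d' by (simp add: m_def add_pos_pos)
  text \<open>This is where \<open>\<beta> \<le> \<gamma>\<close> is used: without it the slope of the second line may be negative.\<close>
  have n: "0 < n"
  proof -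
    have "n = \<beta> * (1 + real d - real d * \<beta>) + real d * (2 - \<beta>) * (\<gamma> - \<beta>)"
      by (simp add: n_def m_def algebra_simps)
    moreover have "0 < \<beta> * (1 + real d - real d * \<beta>)"
      using k \<beta> by (simp add: k_def)
    moreover have "0 \<le> real d * (2 - \<beta>) * (\<gamma> - \<beta>)"
      using \<beta> \<gamma> by simp
    ultimately show ?thesis
      by linarith
  qed
  have "m * u - n * v \<le> \<beta>"
    using L by (simp add: m_def n_def mult.commute)
  then have "(m / \<beta>) * u + (- n / \<beta>) * v \<le> 1"
    using \<beta> by (simp add: field_simps)
  moreover have "(real d + 1) * u + (- k) * v \<le> 1"
    using L by (simp add: k_def algebra_simps)
  ultimately have "(u, v) \<in> closure {(u, v) \<in> region_R \<beta> \<gamma>. (real d + 1) * u + (- k) * v < 1 \<and>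
      (m / \<beta>) * u + (- n / \<beta>) * v < 1}"
    using assms by (intro closure_region_R_half_planes) auto
  also have "{(u, v) \<in> region_R \<beta> \<gamma>. (real d + 1) * u + (- k) * v < 1 \<and> (m / \<beta>) * u + (- n / \<beta>) * v < 1}
      = Delta_tilde d \<beta> \<gamma>"
  proof -
    have "(real d + 1) * u + (- k) * v < 1 \<longleftrightarrow> v > (real d + 1) / k * (u - 1 / (real d + 1))" for u v
    proof -
      have "D / k * (u - 1 / D) = (D * u - 1) / k" if "0 < D" for D
        using that k by (simp add: field_simps)
      from this[of "real d + 1"] show ?thesis
        using k by (auto simp: divide_less_eq algebra_simps)
    qed
    moreover have "(m / \<beta>) * u + (- n / \<beta>) * v < 1 \<longleftrightarrow> v > m / n * (u - \<beta> / m)" for u v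
    proof -
      have "m / n * (u - \<beta> / m) = (m * u - \<beta>) / n"
        using m n by (simp add: field_simps)
      moreover have "(m / \<beta>) * u + (- n / \<beta>) * v = (m * u - n * v) / \<beta>"
        by (simp add: diff_divide_distrib)
      ultimately show ?thesis
        using n \<beta> by (auto simp: divide_less_eq algebra_simps)
    qed
    ultimately show ?thesis
      by (simp add: Delta_tilde_def k_def n_def m_def)
  qed
  finally show ?thesis .
qed

section \<open>Testing on indicator functions\<close>

lemma ennreal_powr_ennreal: "0 \<le> r \<Longrightarrow> ennreal_powr (ennreal r) a = ennreal (r powr a)"
  by (simp add: ennreal_powr_def)

lemma ennreal_powr_mono:
  assumes "x \<le> y" "0 \<le> a"
  shows "ennreal_powr x a \<le> ennreal_powr y a"
proof (cases "y = \<infinity>")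
  case False
  then obtain r s where "x = ennreal r" "0 \<le> r" "y = ennreal s" "0 \<le> s" "r \<le> s"
    using assms(1) by (cases x; cases y) (auto simp: top_unique)
  then show ?thesis
    using assms(2) by (simp add: ennreal_powr_ennreal powr_mono2)
qed (simp add: ennreal_powr_def)

lemma enn2real_inverse_exponent:
  assumes "1 \<le> p" "p \<noteq> \<infinity>"
  shows "1 \<le> enn2real p" "enn2real (1 / p) = 1 / enn2real p"
proof -
  obtain r where r: "p = ennreal r" "0 \<le> r"
    using assms(2) by (cases p) auto
  then have "1 \<le> r"
    using assms(1) by (simp flip: ennreal_1)
  then show "1 \<le> enn2real p" "enn2real (1 / p) = 1 / enn2real p"
    using r by (simp_all add: divide_ennreal flip: ennreal_1)
qed

text \<open>Chebyshev's inequality, including \<open>q = \<infinity>\<close>: there the exponent of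
  the measure is 0, and the positive measure of \<open>G\<close> rules out any essential bound below
  \<open>l\<close>. Monotonicity of the integral suffices, so \<open>F\<close> may be a
  nonmeasurable maximal function.\<close>

lemma Lp_norm_ge:
  assumes "1 \<le> q" "0 \<le> l" "G \<in> sets lborel" "emeasure lborel G < \<infinity>" "0 < measure lborel G"
    and F: "\<And>y. y \<in> G \<Longrightarrow> ennreal l \<le> F y"
  shows "ennreal (l * measure lborel G powr enn2real (1 / q)) \<le> Lp_norm q F"
proof (cases "q = \<infinity>")
  case True
  have "ennreal l \<le> z" if "AE y in lborel. F y \<le> z" for z
  proof (rule ccontr)
    assume "\<not> ennreal l \<le> z"
    have "AE y in lborel. y \<notin> G"
      using that
    proof (rule eventually_mono)
      fix y assume "F y \<le> z"
      then show "y \<notin> G"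
        using F[of y] \<open>\<not> ennreal l \<le> z\<close> by (meson order_trans)
    qed
    then have "emeasure lborel G = 0"
      using assms(3) by (simp add: AE_iff_measurable[of G])
    then show False
      using assms(5) by (simp add: measure_def)
  qed
  then show ?thesis
    using True assms by (auto simp: Lp_norm_def intro!: Inf_greatest)
next
  case False
  note q = enn2real_inverse_exponent[OF assms(1) False]
  define r where "r = enn2real q"
  define m where "m = measure lborel G"
  have m: "emeasure lborel G = ennreal m" "0 < m"
    using assms by (auto simp: m_def emeasure_eq_ennreal_measure)
  have "l * m powr (1 / r) = (l powr r * m) powr (1 / r)"
    using assms m q by (simp add: powr_mult powr_powr r_def)
  then have "ennreal (l * m powr (1 / r)) = ennreal_powr (ennreal (l powr r * m)) (1 / r)"
    using m by (simp add: ennreal_powr_ennreal)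
  also have "ennreal (l powr r * m) = (\<integral>\<^sup>+ y. ennreal (l powr r) * indicator G y \<partial>lborel)"
    using assms(3) m by (simp add: nn_integral_cmult_indicator ennreal_mult)
  also have "ennreal_powr \<dots> (1 / r) \<le> ennreal_powr (\<integral>\<^sup>+ y. ennreal_powr (F y) r \<partial>lborel) (1 / r)"
  proof (intro ennreal_powr_mono nn_integral_mono)
    fix y
    show "ennreal (l powr r) * indicator G y \<le> ennreal_powr (F y) r"
    proof (cases "y \<in> G")
      case True
      then have "ennreal_powr (ennreal l) r \<le> ennreal_powr (F y) r"
        using F q by (intro ennreal_powr_mono) (auto simp: r_def)
      then show ?thesis
        using True assms by (simp add: ennreal_powr_ennreal)
    qed simp
  qed (use q in \<open>simp add: r_def\<close>)
  finally show ?thesis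
    using False q by (simp add: Lp_norm_def m_def r_def)
qed

lemma Lp_norm_indicator_le:
  assumes "1 \<le> p" "F \<in> sets lborel" "emeasure lborel F < \<infinity>" "0 < measure lborel F"
  shows "Lp_norm p (\<lambda>y. ennreal \<bar>indicator F y\<bar>) \<le> ennreal (measure lborel F powr enn2real (1 / p))"
proof (cases "p = \<infinity>")
  case True
  have "Inf {z. AE y in lborel. ennreal \<bar>indicator F (y :: real \<times> real)\<bar> \<le> z} \<le> 1"
    by (intro Inf_lower) (auto simp: indicator_def)
  then show ?thesis
    using True assms by (simp add: Lp_norm_def)
next
  case False
  note p = enn2real_inverse_exponent[OF assms(1) False]
  have "ennreal_powr (ennreal \<bar>indicator F y\<bar>) (enn2real p) = indicator F y" for y :: "real \<times> real"
    using p by (auto simp: indicator_def ennreal_powr_ennreal ennreal_powr_def)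
  then have "(\<integral>\<^sup>+ y. ennreal_powr (ennreal \<bar>indicator F y\<bar>) (enn2real p) \<partial>lborel) = emeasure lborel F"
    using assms by simp
  then show ?thesis
    using False assms p by (simp add: Lp_norm_def emeasure_eq_ennreal_measure ennreal_powr_ennreal)
qed

section \<open>From norm estimates to inequalities between measures\<close>

lemma curve_avg_indicator_ge:
  assumes F: "F \<in> sets borel" and "0 \<le> b" "0 \<le> l" "b + l \<le> 1"
    and inF: "\<And>x. x \<in> {b..b + l} \<Longrightarrow> (fst y - t powr a1 * x, snd y - t powr a2 * (x ^ d + c)) \<in> F"
  shows "l \<le> curve_avg d a1 a2 c t (indicator F) y"
proof -
  define S where "S = {0..1} \<inter> (\<lambda>x. (fst y - t powr a1 * x, snd y - t powr a2 * (x ^ d + c))) -` F"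
  have "continuous_on UNIV (\<lambda>x. (fst y - A * x, snd y - B * (x ^ d + c)))" for A B
    by (intro continuous_intros)
  then have "(\<lambda>x. (fst y - t powr a1 * x, snd y - t powr a2 * (x ^ d + c))) \<in> borel_measurable borel"
    by (rule borel_measurable_continuous_onI)
  then have "(\<lambda>x. (fst y - t powr a1 * x, snd y - t powr a2 * (x ^ d + c))) -` F \<in> sets borel"
    by (rule measurable_sets_borel) (rule F)
  then have S: "S \<in> sets borel"
    by (simp add: S_def)
  have "l = measure lborel {b..b + l}"
    using assms by simp
  also have "\<dots> \<le> measure lborel S"
  proof (rule measure_mono_fmeasurable)
    show "{b..b + l} \<subseteq> S"
      using assms by (auto simp: S_def)
    have "emeasure lborel S \<le> emeasure lborel {0..1::real}"
      by (intro emeasure_mono) (auto simp: S_def)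
    then show "S \<in> fmeasurable lborel"
      using S by (intro fmeasurableI) (auto simp: top_unique less_top intro: le_less_trans)
  qed simp
  also have "measure lborel S = (LINT x|lborel. indicator S x)"
    by simp
  also have "\<dots> = curve_avg d a1 a2 c t (indicator F) y"
    unfolding curve_avg_def set_lebesgue_integral_def
    by (intro Bochner_Integration.integral_cong) (auto simp: S_def indicator_def)
  finally show ?thesis .
qed

text \<open>Both \<open>t\<close> and \<open>b\<close> may depend on the point \<open>y\<close>:
  this is the freedom that the supremum offers. The constant is fixed before \<open>F\<close>,
  \<open>G\<close> and \<open>l\<close>, as needed to vary the scale afterwards.\<close>

lemma maximal_estimate_test:
  assumes est: "maximal_estimate d a1 a2 c E p q" and pq: "1 \<le> p" "1 \<le> q"
    and uv: "exponent_point p q = (u, v)"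
  obtains C where "0 < C" and
    "\<And>F G l. \<lbrakk>F \<in> sets borel; bounded F; 0 < measure lborel F;
       G \<in> sets borel; bounded G; 0 < measure lborel G; 0 \<le> l;
       \<And>y. y \<in> G \<Longrightarrow> \<exists>t\<in>E. \<exists>b\<ge>0. b + l \<le> 1 \<and>
         (\<forall>x\<in>{b..b + l}. (fst y - t powr a1 * x, snd y - t powr a2 * (x ^ d + c)) \<in> F)\<rbrakk>
     \<Longrightarrow> l * measure lborel G powr v \<le> C * measure lborel F powr u"
proof -
  obtain C0 where C0: "\<And>f. admissible f \<Longrightarrow>
      Lp_norm q (maximal_op d a1 a2 c E f) \<le> ennreal C0 * Lp_norm p (\<lambda>y. ennreal \<bar>f y\<bar>)"
    using est unfolding maximal_estimate_def by blast
  have u: "u = enn2real (1 / p)" and v: "v = enn2real (1 / q)"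
    using uv by (auto simp: exponent_point_def)
  show thesis
  \<comment> \<open>The constant of the estimate is an arbitrary real, possibly negative; the
    maximum makes it positive.\<close>
  proof (rule that[of "max 1 C0"])
    fix F G :: "(real \<times> real) set" and l :: real
    assume F: "F \<in> sets borel" "bounded F" "0 < measure lborel F"
      and G: "G \<in> sets borel" "bounded G" "0 < measure lborel G" and l: "0 \<le> l"
      and FG: "\<And>y. y \<in> G \<Longrightarrow> \<exists>t\<in>E. \<exists>b\<ge>0. b + l \<le> 1 \<and>
         (\<forall>x\<in>{b..b + l}. (fst y - t powr a1 * x, snd y - t powr a2 * (x ^ d + c)) \<in> F)"
    have adm: "admissible (indicator F)"
      unfolding admissible_def
    proof (intro conjI)
      show "(indicator F :: _ \<Rightarrow> real) \<in> borel_measurable borel"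
        using F by simp
      have "range (indicator F :: real \<times> real \<Rightarrow> real) \<subseteq> {0, 1}"
        by (auto simp: indicator_def)
      then show "bounded (range (indicator F :: real \<times> real \<Rightarrow> real))"
        by (rule bounded_subset[rotated]) simp
      have "{y. indicator F y \<noteq> (0::real)} = F"
        by (auto simp: indicator_def)
      then show "compact (closure {y. indicator F y \<noteq> (0::real)})"
        using F by simp
    qed
    have "ennreal (l * measure lborel G powr v) \<le> Lp_norm q (maximal_op d a1 a2 c E (indicator F))"
      unfolding v
    proof (rule Lp_norm_ge)
      fix y assume "y \<in> G"
      then obtain t b where t: "t \<in> E" "0 \<le> b" "b + l \<le> 1"
          "\<And>x. x \<in> {b..b + l} \<Longrightarrow> (fst y - t powr a1 * x, snd y - t powr a2 * (x ^ d + c)) \<in> F"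
        using FG by blast
      have "l \<le> curve_avg d a1 a2 c t (indicator F) y"
        by (rule curve_avg_indicator_ge[OF F(1) t(2) l t(3,4)])
      then have "ennreal l \<le> ennreal \<bar>curve_avg d a1 a2 c t (indicator F) y\<bar>"
        by (intro ennreal_leI) auto
      also have "\<dots> \<le> maximal_op d a1 a2 c E (indicator F) y"
        unfolding maximal_op_def using t by (intro SUP_upper)
      finally show "ennreal l \<le> maximal_op d a1 a2 c E (indicator F) y" .
    qed (use pq G l emeasure_bounded_finite in auto)
    also have "\<dots> \<le> ennreal C0 * Lp_norm p (\<lambda>y. ennreal \<bar>indicator F y\<bar>)"
      by (rule C0[OF adm])
    also have "\<dots> \<le> ennreal (max 1 C0) * ennreal (measure lborel F powr u)"
      unfolding u using pq F emeasure_bounded_finite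
      by (intro mult_mono Lp_norm_indicator_le ennreal_leI) auto
    also have "\<dots> = ennreal (max 1 C0 * measure lborel F powr u)"
      by (simp add: ennreal_mult)
    finally show "l * measure lborel G powr v \<le> max 1 C0 * measure lborel F powr u"
      by (subst (asm) ennreal_le_iff) auto
  qed simp
qed

section \<open>Neighbourhoods of graphs\<close>

text \<open>The thickening is vertical, so the measure is width times height, independently of the
  slope of the graph.\<close>

definition strip :: "real \<Rightarrow> real \<Rightarrow> (real \<Rightarrow> real) \<Rightarrow> real \<Rightarrow> (real \<times> real) set" where
  "strip a b \<phi> h = {z. fst z \<in> {a..b} \<and> \<bar>snd z - \<phi> (fst z)\<bar> \<le> h}"

lemma strip_measure:
  assumes cont: "continuous_on UNIV \<phi>" and "a \<le> b" "0 \<le> h"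
  shows "strip a b \<phi> h \<in> sets borel" "bounded (strip a b \<phi> h)" "measure lborel (strip a b \<phi> h) = (b - a) * (2 * h)"
proof -
  have "closed {z. \<bar>snd z - \<phi> (fst z)\<bar> \<le> h}" "closed {z :: real \<times> real. a \<le> fst z}" "closed {z :: real \<times> real. fst z \<le> b}"
    by (intro closed_Collect_le continuous_intros continuous_on_compose2[OF cont]; simp)+
  then have "closed ({z. \<bar>snd z - \<phi> (fst z)\<bar> \<le> h} \<inter> {z. a \<le> fst z} \<inter> {z. fst z \<le> b})"
    by auto
  moreover have "{z. \<bar>snd z - \<phi> (fst z)\<bar> \<le> h} \<inter> {z. a \<le> fst z} \<inter> {z. fst z \<le> b} = strip a b \<phi> h"
    by (auto simp: strip_def)
  ultimately have cl: "closed (strip a b \<phi> h)"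
    by simp
  then show meas: "strip a b \<phi> h \<in> sets borel"
    by (rule borel_closed)
  have "compact (\<phi> ` {a..b})"
    by (intro compact_continuous_image continuous_on_subset[OF cont]) auto
  then have "bounded (\<phi> ` {a..b})"
    by (rule compact_imp_bounded)
  then obtain B where B: "\<forall>x\<in>{a..b}. \<bar>\<phi> x\<bar> \<le> B"
    unfolding bounded_iff by auto
  have "strip a b \<phi> h \<subseteq> {a..b} \<times> {- B - h..B + h}"
    using B by (force simp: strip_def abs_le_iff)
  then show "bounded (strip a b \<phi> h)"
    by (rule bounded_subset[rotated]) (intro bounded_Times bounded_closed_interval)
  have "emeasure lborel (strip a b \<phi> h) = emeasure (lborel \<Otimes>\<^sub>M lborel) (strip a b \<phi> h)"
    by (simp add: lborel_prod)
  also have "\<dots> = (\<integral>\<^sup>+ x. emeasure lborel (Pair x -` strip a b \<phi> h) \<partial>lborel)"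
    using meas by (intro lborel.emeasure_pair_measure_alt) (simp only: lborel_prod sets_lborel)
  also have "\<dots> = (\<integral>\<^sup>+ x. ennreal (2 * h) * indicator {a..b} x \<partial>lborel)"
  proof (intro nn_integral_cong)
    fix x
    have "Pair x -` strip a b \<phi> h = (if x \<in> {a..b} then {\<phi> x - h..\<phi> x + h} else {})"
      by (auto simp: strip_def)
    then show "emeasure lborel (Pair x -` strip a b \<phi> h) = ennreal (2 * h) * indicator {a..b} x"
      using \<open>0 \<le> h\<close> by simp
  qed
  also have "\<dots> = ennreal (2 * h) * emeasure lborel {a..b}"
    by (rule nn_integral_cmult_indicator) simp
  also have "\<dots> = ennreal ((b - a) * (2 * h))"
    using assms by (simp add: mult.commute flip: ennreal_mult)
  finally show "measure lborel (strip a b \<phi> h) = (b - a) * (2 * h)"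
    using assms by (simp add: measure_def)
qed

lemma measure_UN_strip:
  fixes \<psi> :: "real \<Rightarrow> real \<Rightarrow> real"
  assumes "finite T" "0 \<le> w" "0 \<le> h"
    and cont: "\<And>t. t \<in> T \<Longrightarrow> continuous_on UNIV (\<psi> t)"
    and sep: "\<And>t t' x. \<lbrakk>t \<in> T; t' \<in> T; t \<noteq> t'; x \<in> {\<alpha> t..\<alpha> t + w}; x \<in> {\<alpha> t'..\<alpha> t' + w}\<rbrakk> \<Longrightarrow> 2 * h < \<bar>\<psi> t x - \<psi> t' x\<bar>"
  shows "measure lborel (\<Union>t\<in>T. strip (\<alpha> t) (\<alpha> t + w) (\<psi> t) h) = real (card T) * (w * (2 * h))"
proof -
  have "measure lborel (\<Union>t\<in>T. strip (\<alpha> t) (\<alpha> t + w) (\<psi> t) h)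
      = (\<Sum>t\<in>T. measure lborel (strip (\<alpha> t) (\<alpha> t + w) (\<psi> t) h))"
  proof (rule measure_finite_Union)
    show "disjoint_family_on (\<lambda>t. strip (\<alpha> t) (\<alpha> t + w) (\<psi> t) h) T"
      unfolding disjoint_family_on_def
    proof (intro ballI impI equals0I)
      fix t t' z assume t: "t \<in> T" "t' \<in> T" "t \<noteq> t'"
        and "z \<in> strip (\<alpha> t) (\<alpha> t + w) (\<psi> t) h \<inter> strip (\<alpha> t') (\<alpha> t' + w) (\<psi> t') h"
      then show False
        using sep[OF t, of "fst z"] by (auto simp: strip_def)
    qed
    fix t assume "t \<in> T"
    then have "bounded (strip (\<alpha> t) (\<alpha> t + w) (\<psi> t) h)"
      using assms by (intro strip_measure(2) cont) auto
    then show "emeasure lborel (strip (\<alpha> t) (\<alpha> t + w) (\<psi> t) h) \<noteq> \<infinity>"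
      using emeasure_bounded_finite by (metis less_irrefl)
  qed (use strip_measure(1)[OF cont] assms in \<open>auto simp: image_subset_iff\<close>)
  also have "\<dots> = (\<Sum>t\<in>T. w * (2 * h))"
    using strip_measure(3)[OF cont] assms by (intro sum.cong) auto
  finally show ?thesis
    by simp
qed

text \<open>After the substitution \<open>s = t powr a1 * x\<close> the dilated curve is the graph of \<open>curve_height d a1 a2 c t\<close>.\<close>

definition curve_height :: "nat \<Rightarrow> real \<Rightarrow> real \<Rightarrow> real \<Rightarrow> real \<Rightarrow> real \<Rightarrow> real" where
  "curve_height d a1 a2 c t s = t powr (a2 - real d * a1) * s ^ d + c * t powr a2"

lemma curve_height_param:
  assumes "0 < t"
  shows "t powr a2 * (x ^ d + c) = curve_height d a1 a2 c t (t powr a1 * x)"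
proof -
  have "(t powr a1) ^ d = t powr (real d * a1)"
    using assms by (simp add: powr_powr mult.commute flip: powr_realpow)
  then have "t powr (a2 - real d * a1) * (t powr a1) ^ d = t powr a2"
    by (simp flip: powr_add)
  then show ?thesis
    by (simp add: curve_height_def power_mult_distrib algebra_simps)
qed

text \<open>The common form of the ball and arc tests: \<open>F\<close> is one strip around
  \<open>\<phi>\<close>, \<open>G\<close> a union of disjoint strips, one for each dilation. The
  curve parameter is \<open>s = t powr a1 * x\<close>, and \<open>K\<close> absorbs both this change
  of variable and all constant factors in the size of \<open>F\<close>.\<close>

lemma strips_test:
  assumes est: "maximal_estimate d a1 a2 c E p q" and pq: "1 \<le> p" "1 \<le> q"
    and uv: "exponent_point p q = (u, v)" and E: "E \<subseteq> {1..2}" and K: "2 powr a1 \<le> K" and a1: "0 < a1"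
  obtains C where "0 < C" and
    "\<And>T \<alpha> \<psi> \<phi> z \<delta> l w. \<lbrakk>finite T; T \<subseteq> E; T \<noteq> {}; 0 < \<delta>; 0 < l; 0 < w;
       \<And>t. t \<in> T \<Longrightarrow> continuous_on UNIV (\<psi> t); continuous_on UNIV \<phi>;
       \<And>t t' x. \<lbrakk>t \<in> T; t' \<in> T; t \<noteq> t'; x \<in> {\<alpha> t..\<alpha> t + w}; x \<in> {\<alpha> t'..\<alpha> t' + w}\<rbrakk> \<Longrightarrow> 2 * \<delta> < \<bar>\<psi> t x - \<psi> t' x\<bar>;
       \<And>t x y. \<lbrakk>t \<in> T; x \<in> {\<alpha> t..\<alpha> t + w}; \<bar>y - \<psi> t x\<bar> \<le> \<delta>\<rbrakk> \<Longrightarrow> \<exists>r\<ge>0. r + l \<le> 1 \<and>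
         (\<forall>s\<in>{r..r + l}. x - s \<in> {z..z + K * l} \<and> \<bar>y - curve_height d a1 a2 c t s - \<phi> (x - s)\<bar> \<le> K * \<delta>)\<rbrakk>
     \<Longrightarrow> l * (real (card T) * w * \<delta>) powr v \<le> C * (l * \<delta>) powr u"
proof -
  obtain C where "0 < C" and C: "\<And>F G l. \<lbrakk>F \<in> sets borel; bounded F; 0 < measure lborel F;
       G \<in> sets borel; bounded G; 0 < measure lborel G; 0 \<le> l;
       \<And>y. y \<in> G \<Longrightarrow> \<exists>t\<in>E. \<exists>b\<ge>0. b + l \<le> 1 \<and>
         (\<forall>x\<in>{b..b + l}. (fst y - t powr a1 * x, snd y - t powr a2 * (x ^ d + c)) \<in> F)\<rbrakk>
     \<Longrightarrow> l * measure lborel G powr v \<le> C * measure lborel F powr u"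
    using maximal_estimate_test[OF est pq uv] by blast
  have "1 \<le> 2 powr a1"
    using a1 by (intro ge_one_powr_ge_zero) auto
  then have K1: "1 \<le> K"
    using K by simp
  have v: "0 \<le> v"
    using uv by (auto simp: exponent_point_def)
  show thesis
  \<comment> \<open>The factor \<open>2 * K * K\<close> is the measure of \<open>F\<close> divided
    by \<open>l * \<delta>\<close>; the single \<open>K\<close> pays for averaging over length
    \<open>l / K\<close> instead of \<open>l\<close>.\<close>
  proof (rule that[of "C * K * (2 * K * K) powr u"])
    fix T \<alpha> and \<psi> :: "real \<Rightarrow> real \<Rightarrow> real" and \<phi> z \<delta> l w
    assume T: "finite T" "T \<subseteq> E" "T \<noteq> {}" and pos: "0 < \<delta>" "0 < l" "0 < w"
      and \<psi>: "\<And>t. t \<in> T \<Longrightarrow> continuous_on UNIV (\<psi> t)" and \<phi>: "continuous_on UNIV \<phi>"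
      and sep: "\<And>t t' x. \<lbrakk>t \<in> T; t' \<in> T; t \<noteq> t'; x \<in> {\<alpha> t..\<alpha> t + w}; x \<in> {\<alpha> t'..\<alpha> t' + w}\<rbrakk>
          \<Longrightarrow> 2 * \<delta> < \<bar>\<psi> t x - \<psi> t' x\<bar>"
      and curve: "\<And>t x y. \<lbrakk>t \<in> T; x \<in> {\<alpha> t..\<alpha> t + w}; \<bar>y - \<psi> t x\<bar> \<le> \<delta>\<rbrakk> \<Longrightarrow> \<exists>r\<ge>0. r + l \<le> 1 \<and>
         (\<forall>s\<in>{r..r + l}. x - s \<in> {z..z + K * l} \<and> \<bar>y - curve_height d a1 a2 c t s - \<phi> (x - s)\<bar> \<le> K * \<delta>)"
    define F where "F = strip z (z + K * l) \<phi> (K * \<delta>)"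
    define G where "G = (\<Union>t\<in>T. strip (\<alpha> t) (\<alpha> t + w) (\<psi> t) \<delta>)"
    have F: "F \<in> sets borel" "bounded F" "measure lborel F = (2 * K * K) * (l * \<delta>)"
      unfolding F_def using strip_measure[OF \<phi>, of z "z + K * l" "K * \<delta>"] K1 pos by auto
    have G: "G \<in> sets borel" "bounded G"
      unfolding G_def using strip_measure(1,2)[OF \<psi>] pos T by (auto intro!: bounded_UN)
    have mG: "measure lborel G = real (card T) * (w * (2 * \<delta>))"
      unfolding G_def using T pos \<psi> sep by (intro measure_UN_strip) auto
    have card: "0 < card T"
      using T by (simp add: card_gt_0_iff)
    have "l / K * measure lborel G powr v \<le> C * measure lborel F powr u"
    proof (rule C)
      fix y assume "y \<in> G"
      then obtain t where t: "t \<in> T" "fst y \<in> {\<alpha> t..\<alpha> t + w}" "\<bar>snd y - \<psi> t (fst y)\<bar> \<le> \<delta>"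
        by (auto simp: G_def strip_def)
      then obtain r where r: "0 \<le> r" "r + l \<le> 1" and inF: "\<And>s. s \<in> {r..r + l} \<Longrightarrow>
          fst y - s \<in> {z..z + K * l} \<and> \<bar>snd y - curve_height d a1 a2 c t s - \<phi> (fst y - s)\<bar> \<le> K * \<delta>"
        using curve by blast
      have "t \<in> {1..2}"
        using t T E by blast
      then have "1 \<le> t powr a1" "t powr a1 \<le> 2 powr a1"
        using a1 by (auto intro!: ge_one_powr_ge_zero powr_mono2)
      then have \<tau>: "1 \<le> t powr a1" "t powr a1 \<le> K"
        using K by auto
      \<comment> \<open>Since \<open>1 \<le> t powr a1 \<le> K\<close>, multiplication by
        \<open>t powr a1\<close> maps \<open>{b..b + l / K}\<close> into \<open>{r..r + l}\<close>,
        and \<open>b + l / K\<close> stays at most 1.\<close>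
      define b where "b = r / t powr a1"
      have "b + l / K \<le> (r + l) / t powr a1"
        unfolding b_def add_divide_distrib using \<tau> pos K1 by (intro add_left_mono divide_left_mono mult_pos_pos) auto
      also have "\<dots> \<le> 1"
        using r \<tau> by (simp add: divide_le_eq)
      finally have b: "0 \<le> b" "b + l / K \<le> 1"
        using r by (auto simp: b_def)
      have "(fst y - t powr a1 * x, snd y - t powr a2 * (x ^ d + c)) \<in> F" if "x \<in> {b..b + l / K}" for x
      proof -
        have "t powr a1 * b \<le> t powr a1 * x" "t powr a1 * x \<le> t powr a1 * (b + l / K)"
          using that \<tau> by (auto intro!: mult_left_mono)
        moreover have "t powr a1 * b = r"
          using \<open>t \<in> {1..2}\<close> by (simp add: b_def)
        moreover have "t powr a1 * (l / K) \<le> l"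
          using \<tau> pos K1 by (simp add: field_simps mult_right_mono)
        ultimately have "t powr a1 * x \<in> {r..r + l}"
          by (auto simp: distrib_left)
        moreover have "t powr a2 * (x ^ d + c) = curve_height d a1 a2 c t (t powr a1 * x)"
          using \<open>t \<in> {1..2}\<close> by (intro curve_height_param) auto
        ultimately show ?thesis
          using inF by (simp add: F_def strip_def)
      qed
      then show "\<exists>t\<in>E. \<exists>b\<ge>0. b + l / K \<le> 1 \<and>
          (\<forall>x\<in>{b..b + l / K}. (fst y - t powr a1 * x, snd y - t powr a2 * (x ^ d + c)) \<in> F)"
        using t(1) T(2) b by blast
    qed (use F G mG card pos K1 in auto)
    then have 1: "l / K * (real (card T) * (w * (2 * \<delta>))) powr v \<le> C * ((2 * K * K) powr u * (l * \<delta>) powr u)"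
      using F mG K1 pos by (simp add: powr_mult)
    have "(real (card T) * w * \<delta>) powr v \<le> (real (card T) * (w * (2 * \<delta>))) powr v"
      using v pos by (intro powr_mono2) auto
    then have "l * (real (card T) * w * \<delta>) powr v \<le> K * (l / K * (real (card T) * (w * (2 * \<delta>))) powr v)"
      using pos K1 by simp
    also have "\<dots> \<le> K * (C * ((2 * K * K) powr u * (l * \<delta>) powr u))"
      using 1 K1 by (intro mult_left_mono) auto
    finally show "l * (real (card T) * w * \<delta>) powr v \<le> C * K * (2 * K * K) powr u * (l * \<delta>) powr u"
      by (simp add: mult_ac)
  qed (use \<open>0 < C\<close> K1 in auto)
qed

section \<open>Boxes and balls\<close>

text \<open>The unit-scale curve maps a box of side \<open>2 * R\<close> into the box enlarged by
  the constant \<open>A\<close>, so the average is 1 on \<open>G\<close> while both measures are of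
  order \<open>R * R\<close>. Letting \<open>R\<close> grow compares the exponents.\<close>

lemma translation_condition:
  assumes est: "maximal_estimate d a1 a2 c E p q" and pq: "1 \<le> p" "1 \<le> q"
    and uv: "exponent_point p q = (u, v)" and "1 \<in> E"
  shows "v \<le> u"
proof -
  obtain C where "0 < C" and C: "\<And>F G l. \<lbrakk>F \<in> sets borel; bounded F; 0 < measure lborel F;
       G \<in> sets borel; bounded G; 0 < measure lborel G; 0 \<le> l;
       \<And>y. y \<in> G \<Longrightarrow> \<exists>t\<in>E. \<exists>b\<ge>0. b + l \<le> 1 \<and>
         (\<forall>x\<in>{b..b + l}. (fst y - t powr a1 * x, snd y - t powr a2 * (x ^ d + c)) \<in> F)\<rbrakk>
     \<Longrightarrow> l * measure lborel G powr v \<le> C * measure lborel F powr u"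
    using maximal_estimate_test[OF est pq uv] by blast
  have u: "0 \<le> u"
    using uv by (auto simp: exponent_point_def)
  define A where "A = 1 + \<bar>c\<bar>"
  have A: "1 \<le> A"
    by (simp add: A_def)
  \<comment> \<open>\<open>R = 2 ^ M\<close> is written through powers of \<open>1 / 2\<close>, with
    negative exponents, to match \<open>exponent_le_of_powr_le\<close>.\<close>
  have "((1/2::real) ^ M) powr (- (2 * v)) \<le> C * ((4 * A) * (4 * A)) powr u * ((1/2) ^ M) powr (- (2 * u))" for M
  proof -
    define R :: real where "R = 2 ^ M"
    have R: "1 \<le> R"
      by (simp add: R_def)
    define F where "F = strip (- (R + A)) (R + A) (\<lambda>_. 0) (R + A)"
    define G where "G = strip (- R) R (\<lambda>_. 0) R"
    have F: "F \<in> sets borel" "bounded F" "measure lborel F = (2 * (R + A)) * (2 * (R + A))"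
      unfolding F_def using strip_measure[of "\<lambda>_. 0" "- (R + A)" "R + A" "R + A"] A R by auto
    have G: "G \<in> sets borel" "bounded G" "measure lborel G = (2 * R) * (2 * R)"
      unfolding G_def using strip_measure[of "\<lambda>_. 0" "- R" R R] R by auto
    have "1 * measure lborel G powr v \<le> C * measure lborel F powr u"
    proof (rule C)
      fix y assume y: "y \<in> G"
      have "(fst y - 1 powr a1 * x, snd y - 1 powr a2 * (x ^ d + c)) \<in> F" if "x \<in> {0..1}" for x
      proof -
        have "0 \<le> x ^ d" "x ^ d \<le> 1"
          using that by (auto intro: power_le_one)
        then have "\<bar>x ^ d + c\<bar> \<le> A"
          by (simp add: A_def)
        then show ?thesis
          using y that A by (auto simp: F_def G_def strip_def)
      qed
      then have "0 \<le> (0::real) \<and> 0 + 1 \<le> (1::real) \<and>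
          (\<forall>x\<in>{0..0 + 1}. (fst y - 1 powr a1 * x, snd y - 1 powr a2 * (x ^ d + c)) \<in> F)"
        by (simp only: add_0 order_refl) blast
      then show "\<exists>t\<in>E. \<exists>b\<ge>0. b + 1 \<le> 1 \<and>
          (\<forall>x\<in>{b..b + 1}. (fst y - t powr a1 * x, snd y - t powr a2 * (x ^ d + c)) \<in> F)"
        using \<open>1 \<in> E\<close> by blast
    qed (use F G A R in auto)
    moreover have "(R * R) powr v \<le> measure lborel G powr v"
    proof -
      have "0 \<le> v"
        using uv by (auto simp: exponent_point_def)
      then show ?thesis
        using R unfolding G by (intro powr_mono2) auto
    qed
    moreover have "measure lborel F powr u \<le> ((4 * A) * (4 * A) * (R * R)) powr u"
    proof -
      have "1 * R \<le> A * R" "A * 1 \<le> A * R"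
        using A R by (intro mult_mono; simp)+
      then have "R + A \<le> A * R + A * R"
        by (intro add_mono) simp_all
      then have "2 * (R + A) \<le> 4 * A * R"
        by simp
      moreover have "0 \<le> 4 * A * R" "0 \<le> 2 * (R + A)"
        using A R by (auto intro!: mult_nonneg_nonneg)
      ultimately have "(2 * (R + A)) * (2 * (R + A)) \<le> (4 * A * R) * (4 * A * R)"
        by - (rule mult_mono)
      then show ?thesis
        using F(3) u A R by (intro powr_mono2) (auto simp: mult_ac)
    qed
    then have "C * measure lborel F powr u \<le> C * ((4 * A) * (4 * A) * (R * R)) powr u"
      using \<open>0 < C\<close> by simp
    ultimately have "(R * R) powr v \<le> C * (((4 * A) * (4 * A)) powr u * (R * R) powr u)"
      using A R by (simp add: powr_mult)
    moreover have "(R * R) powr s = ((1/2) ^ M) powr (- (2 * s))" for s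
    proof -
      have "((1/2) ^ M) powr (- (2 * s)) = (1 / R) powr (- (2 * s))"
        by (simp add: R_def power_divide)
      also have "\<dots> = R powr (2 * s)"
        using R by (simp add: powr_divide powr_minus_divide)
      also have "\<dots> = (R * R) powr s"
        using R by (simp add: powr_mult flip: powr_add)
      finally show ?thesis
        by simp
    qed
    ultimately show ?thesis
      by (simp add: mult.assoc)
  qed
  from exponent_le_of_powr_le[OF _ _ this] have "- (2 * u) \<le> - (2 * v)"
    by simp
  then show "v \<le> u"
    by simp
qed

text \<open>With \<open>D = \<rho> ^ M\<close>, \<open>F\<close> is a box with sides of order
  \<open>D\<close> and \<open>G\<close> consists of about \<open>D powr (- B)\<close> disjoint
  strips of thickness about \<open>D\<close> around the curves over \<open>{s0..s1}\<close>. Curves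
  through \<open>F\<close> meet it in length about \<open>D\<close>, so
  \<open>D * (D powr (1 - B)) powr v\<close> is bounded by a multiple of
  \<open>D powr (2 * u)\<close>.\<close>

lemma ball_condition:
  fixes T :: "nat \<Rightarrow> real set"
  assumes est: "maximal_estimate d a1 a2 c E p q" and pq: "1 \<le> p" "1 \<le> q"
    and uv: "exponent_point p q = (u, v)" and E: "E \<subseteq> {1..2}" and a1: "0 < a1"
    and \<rho>: "0 < \<rho>" "\<rho> < 1" and pos: "0 < h" "0 \<le> K1" and s: "0 \<le> s0" "s0 < s1" "s1 < 1"
    and T: "\<And>M. finite (T M)" "\<And>M. T M \<subseteq> E" "\<And>M. (\<rho> ^ M) powr (- B) \<le> real (card (T M))"
    and sep: "\<And>M t t' s. \<lbrakk>t \<in> T M; t' \<in> T M; t \<noteq> t'; s \<in> {s0..s1}\<rbrakk> \<Longrightarrow>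
      h * \<rho> ^ M \<le> \<bar>curve_height d a1 a2 c t s - curve_height d a1 a2 c t' s\<bar>"
    and lip: "\<And>t s s'. \<lbrakk>t \<in> E; s \<in> {0..1}; s' \<in> {0..1}\<rbrakk> \<Longrightarrow>
      \<bar>curve_height d a1 a2 c t s - curve_height d a1 a2 c t s'\<bar> \<le> K1 * \<bar>s - s'\<bar>"
  shows "2 * u \<le> 1 + (1 - B) * v"
proof -
  define g where "g = curve_height d a1 a2 c"
  \<comment> \<open>\<open>\<epsilon>\<close> is the room left beyond \<open>s1\<close> for an arc
    of length \<open>l\<close>; \<open>c1 = h / 4\<close> makes \<open>2 * \<delta> < h * D\<close>;
    the last term of \<open>K\<close> converts the rise \<open>K1 * l\<close> of the curve along the
    arc into a multiple of \<open>\<delta>\<close>.\<close>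
  define \<epsilon> where "\<epsilon> = 1 - s1"
  define c1 where "c1 = h / 4"
  define K where "K = 2 powr a1 + 1 + K1 * \<epsilon> / c1"
  have c: "0 < \<epsilon>" "0 < c1" "0 \<le> K1 * \<epsilon> / c1"
    using s pos by (auto simp: \<epsilon>_def c1_def)
  have "0 < 2 powr a1"
    by simp
  then have K: "2 powr a1 \<le> K" "1 + K1 * \<epsilon> / c1 \<le> K" "1 \<le> K"
    using c unfolding K_def by linarith+
  obtain C where "0 < C" and C: "\<And>T \<alpha> \<psi> \<phi> z \<delta> l w. \<lbrakk>finite T; T \<subseteq> E; T \<noteq> {}; 0 < \<delta>; 0 < l; 0 < w;
       \<And>t. t \<in> T \<Longrightarrow> continuous_on UNIV (\<psi> t); continuous_on UNIV \<phi>;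
       \<And>t t' x. \<lbrakk>t \<in> T; t' \<in> T; t \<noteq> t'; x \<in> {\<alpha> t..\<alpha> t + w}; x \<in> {\<alpha> t'..\<alpha> t' + w}\<rbrakk> \<Longrightarrow> 2 * \<delta> < \<bar>\<psi> t x - \<psi> t' x\<bar>;
       \<And>t x y. \<lbrakk>t \<in> T; x \<in> {\<alpha> t..\<alpha> t + w}; \<bar>y - \<psi> t x\<bar> \<le> \<delta>\<rbrakk> \<Longrightarrow> \<exists>r\<ge>0. r + l \<le> 1 \<and>
         (\<forall>s\<in>{r..r + l}. x - s \<in> {z..z + K * l} \<and> \<bar>y - g t s - \<phi> (x - s)\<bar> \<le> K * \<delta>)\<rbrakk>
     \<Longrightarrow> l * (real (card T) * w * \<delta>) powr v \<le> C * (l * \<delta>) powr u"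
    using strips_test[OF est pq uv E K(1) a1] unfolding g_def by blast
  have v: "0 \<le> v"
    using uv by (auto simp: exponent_point_def)
  define k where "k = \<epsilon> * ((s1 - s0) * c1) powr v"
  have k: "0 < k"
    using c s by (simp add: k_def)
  have "(\<rho> ^ M) powr (1 + (1 - B) * v) \<le> (C * (\<epsilon> * c1) powr u / k) * (\<rho> ^ M) powr (2 * u)" for M
  proof -
    define D where "D = \<rho> ^ M"
    have D: "0 < D" "D \<le> 1"
      using \<rho> by (auto simp: D_def power_le_one)
    define l where "l = \<epsilon> * D"
    define \<delta> where "\<delta> = c1 * D"
    have l: "0 < l" "0 < \<delta>" "s1 + l \<le> 1"
    proof -
      have "\<epsilon> * D \<le> \<epsilon> * 1"
        using c D by (intro mult_left_mono) auto
      then show "s1 + l \<le> 1"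
        by (simp add: l_def \<epsilon>_def)
    qed (use c D in \<open>auto simp: l_def \<delta>_def\<close>)
    have "0 < (\<rho> ^ M) powr (- B)"
      using \<rho> by simp
    then have ne: "T M \<noteq> {}"
      using T(3)[of M] by (intro notI) simp
    have "l * (real (card (T M)) * (s1 - s0) * \<delta>) powr v \<le> C * (l * \<delta>) powr u"
    proof (rule C[where \<alpha> = "\<lambda>_. s0" and \<psi> = g and \<phi> = "\<lambda>_. 0" and z = "- l"])
      show "continuous_on UNIV (g t)" for t
        unfolding g_def curve_height_def[abs_def] by (intro continuous_intros)
      show "2 * \<delta> < \<bar>g t x - g t' x\<bar>"
        if "t \<in> T M" "t' \<in> T M" "t \<noteq> t'" "x \<in> {s0..s0 + (s1 - s0)}" for t t' x
        using sep[OF that(1-3), of x] that(4) l(2) by (auto simp: g_def \<delta>_def c1_def D_def)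
      fix t x y assume t: "t \<in> T M" and x: "x \<in> {s0..s0 + (s1 - s0)}" and y: "\<bar>y - g t x\<bar> \<le> \<delta>"
      have "\<bar>y - g t s\<bar> \<le> K * \<delta>" if s': "s \<in> {x..x + l}" for s
      proof -
        have "\<bar>g t x - g t s\<bar> \<le> K1 * \<bar>x - s\<bar>"
          unfolding g_def using t T(2) s x l s' by (intro lip) auto
        also have "\<dots> \<le> K1 * l"
          using s' pos by (intro mult_left_mono) auto
        also have "K1 * l = K1 * \<epsilon> / c1 * \<delta>"
          using c by (simp add: l_def \<delta>_def)
        finally have "\<bar>y - g t s\<bar> \<le> (1 + K1 * \<epsilon> / c1) * \<delta>"
          using y by (simp add: distrib_right)
        also have "\<dots> \<le> K * \<delta>"
          using K l by (intro mult_right_mono) auto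
        finally show ?thesis .
      qed
      moreover have "x - s \<in> {- l..- l + K * l}" if "s \<in> {x..x + l}" for s
      proof -
        have "1 * l \<le> K * l"
          using K l by (intro mult_right_mono) auto
        then show ?thesis
          using that by auto
      qed
      ultimately show "\<exists>r\<ge>0. r + l \<le> 1 \<and> (\<forall>s\<in>{r..r + l}. x - s \<in> {- l..- l + K * l} \<and> \<bar>y - g t s - 0\<bar> \<le> K * \<delta>)"
        using x s l by (intro exI[of _ x]) auto
    qed (use T ne l s in auto)
    moreover have "k * D powr (1 + (1 - B) * v) \<le> l * (real (card (T M)) * (s1 - s0) * \<delta>) powr v"
    proof -
      have "D powr (1 - B) * ((s1 - s0) * c1) = D powr (- B) * (s1 - s0) * \<delta>"
        using D by (simp add: \<delta>_def powr_diff powr_minus_divide)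
      also have "\<dots> \<le> real (card (T M)) * (s1 - s0) * \<delta>"
        using T(3)[of M] s l by (intro mult_right_mono) (auto simp: D_def)
      finally have "(D powr (1 - B) * ((s1 - s0) * c1)) powr v \<le> (real (card (T M)) * (s1 - s0) * \<delta>) powr v"
        using v c s D by (intro powr_mono2) auto
      then have "l * (D powr (1 - B) * ((s1 - s0) * c1)) powr v \<le> l * (real (card (T M)) * (s1 - s0) * \<delta>) powr v"
        using l by simp
      also have "l * (D powr (1 - B) * ((s1 - s0) * c1)) powr v = k * D powr (1 + (1 - B) * v)"
        using D c s by (simp add: l_def k_def powr_mult powr_powr powr_add)
      finally show ?thesis .
    qed
    moreover have "(l * \<delta>) powr u = (\<epsilon> * c1) powr u * D powr (2 * u)"
    proof -
      have "l * \<delta> = (\<epsilon> * c1) * (D * D)"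
        by (simp add: l_def \<delta>_def)
      also have "\<dots> powr u = (\<epsilon> * c1) powr u * (D powr u * D powr u)"
        using D c by (simp only: powr_mult mult_nonneg_nonneg less_imp_le)
      finally show ?thesis
        by (simp flip: powr_add)
    qed
    ultimately have "k * D powr (1 + (1 - B) * v) \<le> C * (\<epsilon> * c1) powr u * D powr (2 * u)"
      by (simp add: mult.assoc)
    then show ?thesis
      using k by (simp add: D_def field_simps)
  qed
  then show ?thesis
    by (rule exponent_le_of_powr_le[OF \<rho>])
qed

section \<open>Powers and binomial remainders\<close>

lemma powr_le_two_powr:
  assumes "t \<in> {1..2::real}"
  shows "t powr b \<le> 2 powr \<bar>b\<bar>"
proof -
  have "t powr b \<le> t powr \<bar>b\<bar>"
    using assms by (intro powr_mono) auto
  also have "\<dots> \<le> 2 powr \<bar>b\<bar>"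
    using assms by (intro powr_mono2) auto
  finally show ?thesis .
qed

lemma powr_lipschitz:
  fixes t t' b :: real
  assumes "t \<in> {1..2}" "t' \<in> {1..2}"
  shows "\<bar>t powr b - t' powr b\<bar> \<le> \<bar>b\<bar> * 2 powr \<bar>b - 1\<bar> * \<bar>t - t'\<bar>"
proof -
  have "norm (t powr b - t' powr b) \<le> \<bar>b\<bar> * 2 powr \<bar>b - 1\<bar> * norm (t - t')"
  proof (rule field_differentiable_bound[where S = "{1..2}" and f' = "\<lambda>z. b * z powr (b - 1)"])
    fix z :: real assume z: "z \<in> {1..2}"
    then show "((\<lambda>z. z powr b) has_field_derivative b * z powr (b - 1)) (at z within {1..2})"
      by (intro has_field_derivative_at_within[OF has_real_derivative_powr]) auto
    show "norm (b * z powr (b - 1)) \<le> \<bar>b\<bar> * 2 powr \<bar>b - 1\<bar>"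
      using powr_le_two_powr[OF z, of "b - 1"] by (simp add: abs_mult mult_left_mono)
  qed (use assms in auto)
  then show ?thesis
    by simp
qed

lemma power_lipschitz:
  fixes x y l :: real
  assumes "0 \<le> x" "x \<le> l" "0 \<le> y" "y \<le> l"
  shows "\<bar>x ^ n - y ^ n\<bar> \<le> real n * l ^ (n - 1) * \<bar>x - y\<bar>"
proof -
  have "norm (x ^ n - y ^ n) \<le> real n * l ^ (n - 1) * norm (x - y)"
  proof (rule field_differentiable_bound[where S = "{0..l}" and f' = "\<lambda>z. real n * z ^ (n - 1)"])
    fix z :: real assume z: "z \<in> {0..l}"
    show "((\<lambda>z. z ^ n) has_field_derivative real n * z ^ (n - 1)) (at z within {0..l})"
      by (auto intro!: derivative_eq_intros)
    show "norm (real n * z ^ (n - 1)) \<le> real n * l ^ (n - 1)"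
      using z by (auto simp: abs_mult intro!: mult_left_mono power_mono)
  qed (use assms in auto)
  then show ?thesis
    by simp
qed

text \<open>The hypothesis says that the derivative at 1 is nonzero; near 1 it keeps at least half
  its size, and the mean value theorem gives the separation.\<close>

lemma powr_sum_expanding:
  fixes A B a b :: real
  assumes "A * a + B * b \<noteq> 0"
  obtains \<eta> h where "0 < \<eta>" "0 < h"
    "\<And>t t'. \<lbrakk>t \<in> {1..1 + \<eta>}; t' \<in> {1..1 + \<eta>}\<rbrakk> \<Longrightarrow>
      h * \<bar>t - t'\<bar> \<le> \<bar>(A * t powr a + B * t powr b) - (A * t' powr a + B * t' powr b)\<bar>"
proof -
  define f where "f t = A * t powr a + B * t powr b" for t
  define f' where "f' t = A * (a * t powr (a - 1)) + B * (b * t powr (b - 1))" for t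
  have f'1: "f' 1 \<noteq> 0"
    using assms by (simp add: f'_def)
  have "isCont f' 1"
    unfolding f'_def by (intro continuous_intros) auto
  then obtain \<eta> where \<eta>: "0 < \<eta>" "\<And>t. \<bar>t - 1\<bar> < \<eta> \<Longrightarrow> \<bar>f' t - f' 1\<bar> < \<bar>f' 1\<bar> / 2"
    using f'1 unfolding continuous_at_eps_delta dist_real_def
    by (metis half_gt_zero zero_less_abs_iff)
  have mono: "\<bar>f' 1\<bar> / 2 * \<bar>t - t'\<bar> \<le> \<bar>f t - f t'\<bar>"
    if t: "t \<in> {1..1 + \<eta> / 2}" "t' \<in> {1..1 + \<eta> / 2}" "t < t'" for t t'
  proof -
    have "DERIV f z :> f' z" if "t \<le> z" for z
    proof -
      have "0 < z"
        using t that by auto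
      then show ?thesis
        unfolding f_def f'_def by (intro DERIV_add DERIV_cmult has_real_derivative_powr)
    qed
    then obtain z where z: "t < z" "z < t'" "f t' - f t = (t' - t) * f' z"
      using MVT2[OF t(3), of f f'] by auto
    then have "\<bar>z - 1\<bar> < \<eta>"
      using t \<eta>(1) by auto
    then have "\<bar>f' z - f' 1\<bar> < \<bar>f' 1\<bar> / 2"
      by (rule \<eta>)
    then have "\<bar>f' 1\<bar> / 2 \<le> \<bar>f' z\<bar>"
      by linarith
    then have "\<bar>f' 1\<bar> / 2 * \<bar>t - t'\<bar> \<le> \<bar>f' z\<bar> * \<bar>t - t'\<bar>"
      by (intro mult_right_mono) auto
    also have "\<dots> = \<bar>f t - f t'\<bar>"
      using z(3) by (metis abs_minus_commute abs_mult mult.commute)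
    finally show ?thesis .
  qed
  have "\<bar>f' 1\<bar> / 2 * \<bar>t - t'\<bar> \<le> \<bar>f t - f t'\<bar>"
    if "t \<in> {1..1 + \<eta> / 2}" "t' \<in> {1..1 + \<eta> / 2}" for t t'
    using mono[OF that] mono[OF that(2,1)] by (cases t t' rule: linorder_cases) (auto simp: abs_minus_commute)
  then show thesis
    using that[of "\<eta> / 2" "\<bar>f' 1\<bar> / 2"] \<eta>(1) f'1 by (auto simp: f_def)
qed

section \<open>Second-order remainder of a power\<close>

text \<open>The distance of \<open>(1 + x) ^ d\<close> from its tangent at 0. Rescaled by the
  abscissa of the contact point, it describes a dilated arc relative to its tangent.\<close>

definition binom_rem :: "nat \<Rightarrow> real \<Rightarrow> real" where
  "binom_rem d x = (1 + x) ^ d - 1 - real d * x"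

definition binom_rem_deriv :: "nat \<Rightarrow> real \<Rightarrow> real" where
  "binom_rem_deriv d x = real d * ((1 + x) ^ (d - 1) - 1)"

lemma has_derivative_binom_rem:
  "(binom_rem d has_field_derivative binom_rem_deriv d x) (at x within S)"
  unfolding binom_rem_def[abs_def] binom_rem_deriv_def
  by (auto intro!: derivative_eq_intros simp: algebra_simps)

lemma binom_rem_deriv_bound:
  assumes "0 \<le> x" "x \<le> 1"
  shows "\<bar>binom_rem_deriv d x\<bar> \<le> real d * real d * 2 ^ d * x"
proof -
  have "\<bar>(1 + x) ^ (d - 1) - 1 ^ (d - 1)\<bar> \<le> real (d - 1) * 2 ^ (d - 1 - 1) * \<bar>(1 + x) - 1\<bar>"
    using assms by (intro power_lipschitz) auto
  also have "\<dots> \<le> real d * 2 ^ d * x"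
    using assms by (intro mult_mono power_increasing) auto
  finally have "real d * \<bar>(1 + x) ^ (d - 1) - 1\<bar> \<le> real d * (real d * 2 ^ d * x)"
    by (intro mult_left_mono) auto
  then show ?thesis
    by (simp add: binom_rem_deriv_def abs_mult mult.assoc)
qed

lemma binom_rem_lipschitz:
  assumes "0 \<le> x" "x \<le> l" "0 \<le> y" "y \<le> l" "l \<le> 1"
  shows "\<bar>binom_rem d x - binom_rem d y\<bar> \<le> real d * real d * 2 ^ d * l * \<bar>x - y\<bar>"
proof -
  have "norm (binom_rem d x - binom_rem d y) \<le> real d * real d * 2 ^ d * l * norm (x - y)"
  proof (rule field_differentiable_bound[where S = "{0..l}" and f' = "binom_rem_deriv d"])
    fix z assume z: "z \<in> {0..l}"
    show "(binom_rem d has_field_derivative binom_rem_deriv d z) (at z within {0..l})"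
      by (rule has_derivative_binom_rem)
    have "\<bar>binom_rem_deriv d z\<bar> \<le> real d * real d * 2 ^ d * z"
      using z assms by (intro binom_rem_deriv_bound) auto
    also have "\<dots> \<le> real d * real d * 2 ^ d * l"
      using z by (intro mult_left_mono) auto
    finally show "norm (binom_rem_deriv d z) \<le> real d * real d * 2 ^ d * l"
      by simp
  qed (use assms in auto)
  then show ?thesis
    by simp
qed

text \<open>With \<open>R\<close> for \<open>binom_rem d\<close> and \<open>x = r / z\<close>, the
  derivative of \<open>z * R (r / z)\<close> in \<open>z\<close> is \<open>R x - x * R' x\<close>,
  and both terms are quadratic in \<open>x\<close>. The factor \<open>r\<^sup>2\<close> is what
  contact of order 2 requires when \<open>t\<close> changes.\<close>

lemma scaled_binom_rem_lipschitz:
  assumes "0 < \<sigma>" "\<sigma> \<le> S" "\<sigma> \<le> S'" "0 \<le> r" "r \<le> \<sigma>"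
  shows "\<bar>S * binom_rem d (r / S) - S' * binom_rem d (r / S')\<bar>
    \<le> 2 * (real d * real d * 2 ^ d) / \<sigma>\<^sup>2 * r\<^sup>2 * \<bar>S - S'\<bar>"
proof -
  define K where "K = real d * real d * 2 ^ d"
  have "norm (S * binom_rem d (r / S) - S' * binom_rem d (r / S')) \<le> (2 * K / \<sigma>\<^sup>2 * r\<^sup>2) * norm (S - S')"
  proof (rule field_differentiable_bound[where S = "{\<sigma>..}" and
        f' = "\<lambda>z. binom_rem d (r / z) - r / z * binom_rem_deriv d (r / z)"])
    fix z assume "z \<in> {\<sigma>..}"
    then have z: "0 < z" "\<sigma> \<le> z"
      using assms by auto
    define x where "x = r / z"
    have x: "0 \<le> x" "x \<le> 1"
      using z assms by (auto simp: x_def divide_le_eq)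
    have "((\<lambda>z. r / z) has_field_derivative - r / z\<^sup>2) (at z within {\<sigma>..})"
      using z by (auto intro!: derivative_eq_intros simp: power2_eq_square)
    from DERIV_chain2[OF has_derivative_binom_rem this]
    have "((\<lambda>z. binom_rem d (r / z)) has_field_derivative binom_rem_deriv d (r / z) * (- r / z\<^sup>2)) (at z within {\<sigma>..})" .
    from DERIV_mult[OF DERIV_ident this]
    show "((\<lambda>z. z * binom_rem d (r / z)) has_field_derivative binom_rem d (r / z) - r / z * binom_rem_deriv d (r / z))
        (at z within {\<sigma>..})"
      using z by (simp add: power2_eq_square divide_simps mult_ac)
    have "\<bar>binom_rem d x - binom_rem d 0\<bar> \<le> K * x * \<bar>x - 0\<bar>"
      unfolding K_def using x by (intro binom_rem_lipschitz) auto
    then have 1: "\<bar>binom_rem d x\<bar> \<le> K * x\<^sup>2"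
      using x by (simp add: binom_rem_def power2_eq_square mult.assoc)
    have "\<bar>x * binom_rem_deriv d x\<bar> = x * \<bar>binom_rem_deriv d x\<bar>"
      using x by (simp add: abs_mult)
    also have "\<dots> \<le> x * (K * x)"
      using x binom_rem_deriv_bound[of x d] by (intro mult_left_mono) (auto simp: K_def)
    finally have "\<bar>x * binom_rem_deriv d x\<bar> \<le> K * x\<^sup>2"
      by (simp add: power2_eq_square mult_ac)
    then have "\<bar>binom_rem d x - x * binom_rem_deriv d x\<bar> \<le> 2 * K * x\<^sup>2"
      using 1 by linarith
    also have "x\<^sup>2 \<le> (r / \<sigma>)\<^sup>2"
      unfolding x_def using z assms by (intro power_mono divide_left_mono) auto
    then have "2 * K * x\<^sup>2 \<le> 2 * K * (r / \<sigma>)\<^sup>2"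
      by (intro mult_left_mono) (auto simp: K_def)
    finally show "norm (binom_rem d (r / z) - r / z * binom_rem_deriv d (r / z)) \<le> 2 * K / \<sigma>\<^sup>2 * r\<^sup>2"
      by (simp add: x_def power_divide)
  qed (use assms in auto)
  then show ?thesis
    by (simp add: K_def)
qed

section \<open>Arcs of the curve\<close>

text \<open>The test function is the indicator of the \<open>\<delta>\<close>-neighbourhood of an arc of length \<open>l\<close> of the reflected
  curve with \<open>t = 1\<close>. If the curves for \<open>t \<in> T M\<close> are translated so that their tangents of slope \<open>\<sigma>\<close>
  agree, they stay in this neighbourhood, since \<open>(t - 1) * l ^ m \<lesssim> \<delta>\<close>. This persists for shifts by
  \<open>w = \<delta> / l ^ (m - 1)\<close> along the tangent, and the intercepts \<open>H t\<close> keep the resulting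
  \<open>w \<times> \<delta>\<close> parallelograms disjoint.\<close>

lemma knapp_condition:
  fixes T :: "nat \<Rightarrow> real set" and P :: "real \<Rightarrow> real \<Rightarrow> real" and m :: nat
  assumes est: "maximal_estimate d a1 a2 c E p q" and pq: "1 \<le> p" "1 \<le> q"
    and uv: "exponent_point p q = (u, v)" and E: "E \<subseteq> {1..2}" and a1: "0 < a1"
    and \<rho>: "0 < \<rho>" "\<rho> < 1" and pos: "0 < h" "0 \<le> K0" "0 \<le> K1" "0 < r0"
    and m: "1 \<le> m" and \<xi>: "0 \<le> \<xi>" "real m * \<xi> \<le> 1" "1 - \<theta> \<le> real m * \<xi>"
    and T: "\<And>M. finite (T M)" "\<And>M. T M \<subseteq> E" "\<And>M. (\<rho> ^ M) powr (- B) \<le> real (card (T M))"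
    and dist: "\<And>M t. t \<in> T M \<Longrightarrow> t - 1 \<le> K0 * (\<rho> ^ M) powr \<theta>"
    and sep: "\<And>M t t'. \<lbrakk>t \<in> T M; t' \<in> T M; t \<noteq> t'\<rbrakk> \<Longrightarrow> h * \<rho> ^ M \<le> \<bar>H t - H t'\<bar>"
    and curve: "\<And>M t r. \<lbrakk>t \<in> T M; 0 \<le> r; r \<le> r0\<rbrakk> \<Longrightarrow> 0 \<le> S t \<and> S t + r \<le> 1 \<and>
      curve_height d a1 a2 c t (S t + r) = H t + \<sigma> * (S t + r) + P t r"
    and lip_r: "\<And>M t r r' l. \<lbrakk>t \<in> T M; 0 \<le> r'; r' \<le> r; r \<le> l; l \<le> r0\<rbrakk> \<Longrightarrow>
      \<bar>P t r - P t r'\<bar> \<le> K1 * l ^ (m - 1) * (r - r')"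
    and lip_t: "\<And>M t r. \<lbrakk>t \<in> T M; 0 \<le> r; r \<le> r0\<rbrakk> \<Longrightarrow> \<bar>P t r - P 1 r\<bar> \<le> K1 * (t - 1) * r ^ m"
    and cont: "continuous_on UNIV (P 1)"
  shows "(1 + \<xi>) * u \<le> \<xi> + (2 - B - (real m - 1) * \<xi>) * v"
proof -
  define g where "g = curve_height d a1 a2 c"
  define \<epsilon> where "\<epsilon> = min 1 r0"
  \<comment> \<open>\<open>h / 4\<close> gives \<open>4 * \<delta> \<le> h * \<rho> ^ M\<close>,
    hence disjoint strips; \<open>\<epsilon> ^ m\<close> gives \<open>\<delta> \<le> l ^ m\<close>,
    hence a shift \<open>w\<close> of at most \<open>l / 2\<close>.\<close>
  define c1 where "c1 = min (h / 4) (\<epsilon> ^ m)"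
  define K where "K = 2 powr a1 + 2 + K1 + K1 * K0 / c1"
  have c: "0 < \<epsilon>" "\<epsilon> \<le> 1" "\<epsilon> \<le> r0" "0 < c1" "c1 \<le> h / 4" "c1 \<le> \<epsilon> ^ m"
    using pos by (auto simp: \<epsilon>_def c1_def)
  have "0 \<le> K1 * K0 / c1"
    using pos c by simp
  moreover have "0 < 2 powr a1"
    by simp
  ultimately have K: "2 powr a1 \<le> K" "1 + K1 + K1 * K0 / c1 \<le> K" "2 \<le> K"
    using pos unfolding K_def by linarith+
  obtain C where "0 < C" and C: "\<And>T \<alpha> \<psi> \<phi> z \<delta> l w. \<lbrakk>finite T; T \<subseteq> E; T \<noteq> {}; 0 < \<delta>; 0 < l; 0 < w;
       \<And>t. t \<in> T \<Longrightarrow> continuous_on UNIV (\<psi> t); continuous_on UNIV \<phi>;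
       \<And>t t' x. \<lbrakk>t \<in> T; t' \<in> T; t \<noteq> t'; x \<in> {\<alpha> t..\<alpha> t + w}; x \<in> {\<alpha> t'..\<alpha> t' + w}\<rbrakk> \<Longrightarrow> 2 * \<delta> < \<bar>\<psi> t x - \<psi> t' x\<bar>;
       \<And>t x y. \<lbrakk>t \<in> T; x \<in> {\<alpha> t..\<alpha> t + w}; \<bar>y - \<psi> t x\<bar> \<le> \<delta>\<rbrakk> \<Longrightarrow> \<exists>r\<ge>0. r + l \<le> 1 \<and>
         (\<forall>s\<in>{r..r + l}. x - s \<in> {z..z + K * l} \<and> \<bar>y - g t s - \<phi> (x - s)\<bar> \<le> K * \<delta>)\<rbrakk>
     \<Longrightarrow> l * (real (card T) * w * \<delta>) powr v \<le> C * (l * \<delta>) powr u"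
    using strips_test[OF est pq uv E K(1) a1] unfolding g_def by blast
  have v: "0 \<le> v"
    using uv by (auto simp: exponent_point_def)
  \<comment> \<open>With \<open>D = \<rho> ^ M\<close>, about \<open>D powr (- B)\<close> strips of
    width of order \<open>D powr (1 - (m - 1) * \<xi>)\<close> and thickness of order
    \<open>D\<close> have total measure of order \<open>D powr X\<close>.\<close>
  define X where "X = 2 - B - (real m - 1) * \<xi>"
  define k where "k = \<epsilon> / 2 * (c1 * c1 / (2 * \<epsilon> ^ (m - 1))) powr v"
  have k: "0 < k"
    using c by (simp add: k_def)
  have "(\<rho> ^ M) powr (\<xi> + X * v) \<le> (C * (\<epsilon> / 2 * c1) powr u / k) * (\<rho> ^ M) powr ((1 + \<xi>) * u)" for M
  proof -
    define D where "D = \<rho> ^ M"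
    have D: "0 < D" "D \<le> 1"
      using \<rho> by (auto simp: D_def power_le_one)
    define l where "l = \<epsilon> * D powr \<xi>"
    define \<delta> where "\<delta> = c1 * D"
    define w where "w = \<delta> / l ^ (m - 1) / 2"
    have D\<xi>: "0 < D powr \<xi>" "D powr \<xi> \<le> 1"
      using D \<xi> by (auto intro: powr_le1)
    have "l \<le> \<epsilon> * 1"
      unfolding l_def using c D\<xi> by (intro mult_left_mono) auto
    also have "\<dots> \<le> r0"
      using c by simp
    finally have l: "0 < l" "l \<le> r0" "0 < \<delta>"
      using c D D\<xi> by (auto simp: l_def \<delta>_def)
    have lm: "l ^ m = \<epsilon> ^ m * D powr (real m * \<xi>)"
      using D by (simp add: l_def power_mult_distrib powr_powr mult.commute flip: powr_realpow)
    have "\<delta> \<le> \<epsilon> ^ m * D powr 1"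
      using c D by (simp add: \<delta>_def mult_right_mono)
    also have "\<dots> \<le> l ^ m"
      unfolding lm using c D \<xi> by (intro mult_left_mono powr_mono') auto
    finally have "\<delta> / l ^ (m - 1) \<le> l"
      using l m by (simp add: divide_le_eq power_eq_if[of l m])
    then have w: "0 < w" "w \<le> l / 2"
      using l by (auto simp: w_def)
    have lw: "l ^ (m - 1) * w \<le> \<delta>"
      using l by (simp add: w_def)
    have lt: "(t - 1) * l ^ m \<le> K0 / c1 * \<delta>" if "t \<in> T M" for t
    proof -
      have "(t - 1) * l ^ m \<le> (K0 * D powr \<theta>) * (1 * D powr (real m * \<xi>))"
      proof (rule mult_mono)
        show "t - 1 \<le> K0 * D powr \<theta>"
          using dist[OF that] by (simp add: D_def)
        show "l ^ m \<le> 1 * D powr (real m * \<xi>)"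
          unfolding lm using c by (intro mult_right_mono power_le_one) auto
      qed (use pos l in auto)
      also have "\<dots> = K0 * D powr (\<theta> + real m * \<xi>)"
        by (simp add: powr_add)
      \<comment> \<open>This is where \<open>1 - \<theta> \<le> m * \<xi>\<close> enters: on so
        short an arc the dilations of the cluster differ by no more than the thickness.\<close>
      also have "\<dots> \<le> K0 * D powr 1"
        using D \<xi> pos by (intro mult_left_mono powr_mono') auto
      also have "\<dots> = K0 / c1 * \<delta>"
        using D c by (simp add: \<delta>_def)
      finally show ?thesis .
    qed
    have "0 < (\<rho> ^ M) powr (- B)"
      using \<rho> by simp
    then have ne: "T M \<noteq> {}"
      using T(3)[of M] by (intro notI) simp
    \<comment> \<open>Only the second half of each arc is used: from \<open>S t + l / 2\<close> on,
      a shift by at most \<open>l / 2\<close> keeps the parameter nonnegative. \<open>\<phi>\<close>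
      is the reflected arc for \<open>t = 1\<close>.\<close>
    have "l / 2 * (real (card (T M)) * w * \<delta>) powr v \<le> C * (l / 2 * \<delta>) powr u"
    proof (rule C[where \<alpha> = S and \<psi> = "\<lambda>t x. H t + \<sigma> * x" and \<phi> = "\<lambda>x. \<sigma> * x - P 1 (- x)" and z = "- l"])
      show "continuous_on UNIV (\<lambda>x. H t + \<sigma> * x)" for t
        by (intro continuous_intros)
      show "continuous_on UNIV (\<lambda>x. \<sigma> * x - P 1 (- x))"
        by (intro continuous_intros continuous_on_compose2[OF cont]) auto
      show "2 * \<delta> < \<bar>(H t + \<sigma> * x) - (H t' + \<sigma> * x)\<bar>"
        if "t \<in> T M" "t' \<in> T M" "t \<noteq> t'" for t t' x
      proof -
        have "4 * \<delta> \<le> h * D"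
          using c D by (simp add: \<delta>_def)
        then show ?thesis
          using sep[OF that] l by (simp add: D_def)
      qed
      fix t x y assume t: "t \<in> T M" and x: "x \<in> {S t..S t + w}" and y: "\<bar>y - (H t + \<sigma> * x)\<bar> \<le> \<delta>"
      have "1 \<le> t"
        using t T(2) E by fastforce
      have St: "0 \<le> S t" "S t + l \<le> 1"
        using curve[OF t, of l] l by auto
      have main: "x - s \<in> {- l..- l + K * (l / 2)} \<and> \<bar>y - g t s - (\<sigma> * (x - s) - P 1 (- (x - s)))\<bar> \<le> K * \<delta>"
        if s: "s \<in> {S t + l / 2..S t + l / 2 + l / 2}" for s
      proof -
        define r' where "r' = s - S t"
        define r where "r = x - S t"
        have r: "0 \<le> r" "r \<le> w" "l / 2 \<le> r'" "r' \<le> l"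
          using x s by (auto simp: r_def r'_def)
        then have rr: "0 \<le> r' - r" "r' - r \<le> r'" "r' - r \<le> l"
          using w l by auto
        have gs: "g t s = H t + \<sigma> * s + P t r'"
          using curve[OF t, of r'] r l by (simp add: g_def r'_def)
        have e1: "\<bar>P t r' - P t (r' - r)\<bar> \<le> K1 * \<delta>"
        proof -
          have "\<bar>P t r' - P t (r' - r)\<bar> \<le> K1 * l ^ (m - 1) * (r' - (r' - r))"
            using rr r l by (intro lip_r[OF t]) auto
          also have "\<dots> \<le> K1 * l ^ (m - 1) * w"
            using r l pos by (intro mult_left_mono) auto
          also have "\<dots> \<le> K1 * \<delta>"
            using lw pos by (simp add: mult.assoc mult_left_mono)
          finally show ?thesis .
        qed
        have e2: "\<bar>P t (r' - r) - P 1 (r' - r)\<bar> \<le> K1 * K0 / c1 * \<delta>"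
        proof -
          have "\<bar>P t (r' - r) - P 1 (r' - r)\<bar> \<le> K1 * (t - 1) * (r' - r) ^ m"
            using rr l by (intro lip_t[OF t]) auto
          also have "\<dots> \<le> K1 * (t - 1) * l ^ m"
            using rr pos \<open>1 \<le> t\<close> by (intro mult_left_mono power_mono) auto
          also have "\<dots> \<le> K1 * (K0 / c1 * \<delta>)"
            using mult_left_mono[OF lt[OF t] pos(3)] by (simp only: mult.assoc)
          finally show ?thesis
            by simp
        qed
        \<comment> \<open>Three errors: the thickness of the strip, the shift along the tangent, and
          the replacement of \<open>t\<close> by 1. \<open>K\<close> dominates their sum.\<close>
        have "y - g t s - (\<sigma> * (x - s) - P 1 (- (x - s))) =
            (y - (H t + \<sigma> * x)) - (P t r' - P t (r' - r)) - (P t (r' - r) - P 1 (r' - r))"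
          unfolding gs by (simp add: r'_def r_def algebra_simps)
        also have "\<bar>\<dots>\<bar> \<le> \<delta> + K1 * \<delta> + K1 * K0 / c1 * \<delta>"
          using y e1 e2 by linarith
        also have "\<dots> = (1 + K1 + K1 * K0 / c1) * \<delta>"
          by (simp add: distrib_right)
        also have "\<dots> \<le> K * \<delta>"
          using K l by (intro mult_right_mono) auto
        finally have "\<bar>y - g t s - (\<sigma> * (x - s) - P 1 (- (x - s)))\<bar> \<le> K * \<delta>" .
        moreover have "2 * (l / 2) \<le> K * (l / 2)"
          using K l by (intro mult_right_mono) auto
        then have "x - s \<in> {- l..- l + K * (l / 2)}"
          using rr by (auto simp: r'_def r_def)
        ultimately show ?thesis
          by blast
      qed
      show "\<exists>r\<ge>0. r + l / 2 \<le> 1 \<and> (\<forall>s\<in>{r..r + l / 2}. x - s \<in> {- l..- l + K * (l / 2)} \<and>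
          \<bar>y - g t s - (\<sigma> * (x - s) - P 1 (- (x - s)))\<bar> \<le> K * \<delta>)"
        using main St l by (intro exI[of _ "S t + l / 2"]) (simp add: add.assoc)
    qed (use T ne l w in auto)
    moreover have "k * D powr (\<xi> + X * v) \<le> l / 2 * (real (card (T M)) * w * \<delta>) powr v"
    proof -
      define \<kappa> where "\<kappa> = c1 * c1 / (2 * \<epsilon> ^ (m - 1))"
      have \<kappa>: "0 < \<kappa>"
        using c by (simp add: \<kappa>_def)
      have "l ^ (m - 1) = \<epsilon> ^ (m - 1) * D powr (real (m - 1) * \<xi>)"
        using D by (simp add: l_def power_mult_distrib powr_powr mult.commute flip: powr_realpow)
      also have "real (m - 1) = real m - 1"
        using m by (simp add: of_nat_diff)
      finally have lm1: "l ^ (m - 1) = \<epsilon> ^ (m - 1) * D powr ((real m - 1) * \<xi>)" .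
      have "D powr X = D powr (- B) * D powr 2 * D powr (- ((real m - 1) * \<xi>))"
        unfolding powr_add[symmetric] by (simp add: X_def)
      also have "\<dots> = D powr (- B) * (D * D) / D powr ((real m - 1) * \<xi>)"
        using D by (simp add: powr_minus_divide power2_eq_square)
      finally have "\<kappa> * D powr X = D powr (- B) * w * \<delta>"
        unfolding w_def lm1 by (simp add: \<delta>_def \<kappa>_def mult_ac)
      also have "\<dots> \<le> real (card (T M)) * w * \<delta>"
        using T(3)[of M] w l by (intro mult_right_mono) (auto simp: D_def)
      finally have "(\<kappa> * D powr X) powr v \<le> (real (card (T M)) * w * \<delta>) powr v"
        using v \<kappa> by (intro powr_mono2) auto
      then have "l / 2 * (\<kappa> * D powr X) powr v \<le> l / 2 * (real (card (T M)) * w * \<delta>) powr v"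
        using l by simp
      also have "l / 2 * (\<kappa> * D powr X) powr v = k * D powr (\<xi> + X * v)"
      proof -
        have "k = \<epsilon> / 2 * \<kappa> powr v"
          by (simp add: k_def \<kappa>_def)
        then show ?thesis
          using \<kappa> by (simp add: l_def powr_mult powr_powr powr_add)
      qed
      finally show ?thesis .
    qed
    moreover have "(l / 2 * \<delta>) powr u = (\<epsilon> / 2 * c1) powr u * D powr ((1 + \<xi>) * u)"
    proof -
      have "l / 2 * \<delta> = (\<epsilon> / 2 * c1) * D powr (1 + \<xi>)"
        using D by (simp add: l_def \<delta>_def powr_add)
      then have "(l / 2 * \<delta>) powr u = (\<epsilon> / 2 * c1) powr u * (D powr (1 + \<xi>)) powr u"
        using c by (simp only: powr_mult)
      then show ?thesis
        by (simp only: powr_powr)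
    qed
    ultimately have "k * D powr (\<xi> + X * v) \<le> C * (\<epsilon> / 2 * c1) powr u * D powr ((1 + \<xi>) * u)"
      by (simp add: mult.assoc)
    then show ?thesis
      using k by (simp add: D_def field_simps)
  qed
  from exponent_le_of_powr_le[OF \<rho> this] show ?thesis
    by (simp add: X_def)
qed

text \<open>At \<open>s = 0\<close> every dilated curve has a horizontal tangent and contact of
  order \<open>d\<close>, so \<open>S\<close> and \<open>\<sigma>\<close> vanish and the intercept
  is \<open>c * t powr a2\<close>.\<close>

lemma flat_knapp_condition:
  fixes T :: "nat \<Rightarrow> real set"
  assumes est: "maximal_estimate d a1 a2 c E p q" and pq: "1 \<le> p" "1 \<le> q"
    and uv: "exponent_point p q = (u, v)" and E: "E \<subseteq> {1..2}" and a1: "0 < a1"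
    and \<rho>: "0 < \<rho>" "\<rho> < 1" and pos: "0 < h" "0 \<le> K0"
    and d: "1 \<le> d" and \<xi>: "0 \<le> \<xi>" "real d * \<xi> \<le> 1" "1 - \<theta> \<le> real d * \<xi>"
    and T: "\<And>M. finite (T M)" "\<And>M. T M \<subseteq> E" "\<And>M. (\<rho> ^ M) powr (- B) \<le> real (card (T M))"
    and dist: "\<And>M t. t \<in> T M \<Longrightarrow> t - 1 \<le> K0 * (\<rho> ^ M) powr \<theta>"
    and sep: "\<And>M t t'. \<lbrakk>t \<in> T M; t' \<in> T M; t \<noteq> t'\<rbrakk> \<Longrightarrow> h * \<rho> ^ M \<le> \<bar>c * t powr a2 - c * t' powr a2\<bar>"
  shows "(1 + \<xi>) * u \<le> \<xi> + (2 - B - (real d - 1) * \<xi>) * v"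
proof -
  define b where "b = a2 - real d * a1"
  define K1 where "K1 = 2 powr \<bar>b\<bar> * real d + \<bar>b\<bar> * 2 powr \<bar>b - 1\<bar>"
  have TE: "t \<in> {1..2}" if "t \<in> T M" for t M
    using that T(2) E by blast
  show ?thesis
  proof (rule knapp_condition[OF est pq uv E a1 \<rho> pos _ zero_less_one d \<xi> T dist sep, where
        S = "\<lambda>_. 0" and \<sigma> = 0 and P = "\<lambda>t r. t powr b * r ^ d" and ?K1.0 = K1])
    show "0 \<le> K1"
      by (simp add: K1_def)
    show "0 \<le> (0::real) \<and> 0 + r \<le> 1 \<and> curve_height d a1 a2 c t (0 + r) = c * t powr a2 + 0 * (0 + r) + t powr b * r ^ d"
      if "r \<le> 1" for t r
      using that by (simp add: curve_height_def b_def)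
    show "\<bar>t powr b * r ^ d - t powr b * r' ^ d\<bar> \<le> K1 * l ^ (d - 1) * (r - r')"
      if "t \<in> T M" "0 \<le> r'" "r' \<le> r" "r \<le> l" for M t r r' l
    proof -
      have "\<bar>t powr b * r ^ d - t powr b * r' ^ d\<bar> = t powr b * \<bar>r ^ d - r' ^ d\<bar>"
        by (simp add: abs_mult flip: right_diff_distrib)
      also have "\<dots> \<le> 2 powr \<bar>b\<bar> * (real d * l ^ (d - 1) * \<bar>r - r'\<bar>)"
        using that TE[OF that(1)] by (intro mult_mono powr_le_two_powr power_lipschitz) auto
      also have "\<dots> = (2 powr \<bar>b\<bar> * real d) * (l ^ (d - 1) * (r - r'))"
        using that by simp
      also have "\<dots> \<le> K1 * (l ^ (d - 1) * (r - r'))"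
        using that by (intro mult_right_mono) (auto simp: K1_def)
      finally show ?thesis
        by (simp add: mult.assoc)
    qed
    show "\<bar>t powr b * r ^ d - 1 powr b * r ^ d\<bar> \<le> K1 * (t - 1) * r ^ d"
      if "t \<in> T M" "0 \<le> r" for M t r
    proof -
      have "\<bar>t powr b * r ^ d - 1 powr b * r ^ d\<bar> = \<bar>t powr b - 1 powr b\<bar> * r ^ d"
        using that by (simp only: left_diff_distrib[symmetric] abs_mult) simp
      also have "\<dots> \<le> (\<bar>b\<bar> * 2 powr \<bar>b - 1\<bar> * \<bar>t - 1\<bar>) * r ^ d"
        using that TE[OF that(1)] by (intro mult_right_mono powr_lipschitz) auto
      also have "\<dots> = (\<bar>b\<bar> * 2 powr \<bar>b - 1\<bar>) * ((t - 1) * r ^ d)"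
        using TE[OF that(1)] by simp
      also have "\<dots> \<le> K1 * ((t - 1) * r ^ d)"
        using that TE[OF that(1)] by (intro mult_right_mono) (auto simp: K1_def)
      finally show ?thesis
        by (simp add: mult.assoc)
    qed
    show "continuous_on UNIV (\<lambda>r. 1 powr b * r ^ d)"
      by (simp add: continuous_intros)
  qed
qed

text \<open>\<open>S t = s0 * t powr b\<close> is the point where the curve with parameter \<open>t\<close> has slope \<open>d * s0 ^ (d - 1)\<close>,
  independently of \<open>t\<close>.\<close>

lemma curved_knapp_condition:
  fixes T :: "nat \<Rightarrow> real set"
  assumes est: "maximal_estimate d a1 a2 c E p q" and pq: "1 \<le> p" "1 \<le> q"
    and uv: "exponent_point p q = (u, v)" and E: "E \<subseteq> {1..2}" and a1: "0 < a1"
    and \<rho>: "0 < \<rho>" "\<rho> < 1" and pos: "0 < h" "0 \<le> K0"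
    and d: "2 \<le> d" and s0: "0 < s0" "s0 \<le> 1 / 2"
    and b: "b = (real d * a1 - a2) / (real d - 1)"
    and tb: "\<And>t. t \<in> E \<Longrightarrow> t powr b \<in> {1 / 2..3 / 2}"
    and \<xi>: "0 \<le> \<xi>" "2 * \<xi> \<le> 1" "1 - \<theta> \<le> 2 * \<xi>"
    and T: "\<And>M. finite (T M)" "\<And>M. T M \<subseteq> E" "\<And>M. (\<rho> ^ M) powr (- B) \<le> real (card (T M))"
    and dist: "\<And>M t. t \<in> T M \<Longrightarrow> t - 1 \<le> K0 * (\<rho> ^ M) powr \<theta>"
    and sep: "\<And>M t t'. \<lbrakk>t \<in> T M; t' \<in> T M; t \<noteq> t'\<rbrakk> \<Longrightarrow> h * \<rho> ^ M \<le>
      \<bar>(c * t powr a2 + (- (real d - 1) * s0 ^ d) * t powr b)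
        - (c * t' powr a2 + (- (real d - 1) * s0 ^ d) * t' powr b)\<bar>"
  shows "(1 + \<xi>) * u \<le> \<xi> + (2 - B - \<xi>) * v"
proof -
  define S where "S t = s0 * t powr b" for t
  define \<kappa> where "\<kappa> = s0 ^ (d - 1)"
  define K where "K = real d * real d * 2 ^ d"
  define P where "P t r = \<kappa> * (S t * binom_rem d (r / S t))" for t r
  define Kr where "Kr = \<kappa> * K * (2 / s0)"
  define Kt where "Kt = \<kappa> * (2 * K / (s0 / 2)\<^sup>2) * (s0 * (\<bar>b\<bar> * 2 powr \<bar>b - 1\<bar>))"
  have K: "0 < \<kappa>" "0 \<le> K" "0 \<le> Kr" "0 \<le> Kt"
    using s0 by (auto simp: \<kappa>_def K_def Kr_def Kt_def)
  have TE: "t \<in> {1..2}" "t \<in> E" if "t \<in> T M" for t M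
    using that T(2) E by blast+
  \<comment> \<open>The upper bound leaves room for an arc of length \<open>s0 / 2\<close> below 1;
    the lower bound keeps \<open>r / S t \<le> 1\<close> in the remainder estimates.\<close>
  have S: "s0 / 2 \<le> S t" "S t \<le> 3 / 4" "0 < S t" if "t \<in> T M" for t M
  proof -
    have "s0 * (1 / 2) \<le> S t" "S t \<le> 1 / 2 * (3 / 2)"
      unfolding S_def using tb[OF TE(2)[OF that]] s0 by (intro mult_mono; auto)+
    then show "s0 / 2 \<le> S t" "S t \<le> 3 / 4" "0 < S t"
      using s0 by auto
  qed
  have \<kappa>S: "t powr (a2 - real d * a1) * S t ^ (d - 1) = \<kappa>" if "t \<in> T M" for t M
  proof -
    have "b * real (d - 1) = real d * a1 - a2"
      using d by (simp add: b of_nat_diff)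
    then have "(t powr b) ^ (d - 1) = t powr (real d * a1 - a2)"
      using TE[OF that] by (simp add: powr_powr flip: powr_realpow)
    then show ?thesis
      using TE[OF that] by (simp add: S_def \<kappa>_def power_mult_distrib flip: powr_add)
  qed
  have \<kappa>s0: "s0 ^ d = \<kappa> * s0"
    using d by (simp add: \<kappa>_def power_eq_if)
  have "(1 + \<xi>) * u \<le> \<xi> + (2 - B - (real 2 - 1) * \<xi>) * v"
  \<comment> \<open>The contact point has height \<open>\<kappa> * S t + c * t powr a2\<close> with
    \<open>\<kappa> * S t = s0 ^ d * t powr b\<close>, so following the tangent of slope
    \<open>real d * \<kappa>\<close> back to abscissa 0 gives \<open>H\<close>. The remainder
    \<open>P\<close> is quadratic, hence \<open>m = 2\<close>.\<close>
  proof (rule knapp_condition[OF est pq uv E a1 \<rho> pos, where S = S and \<sigma> = "real d * \<kappa>" and P = P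
        and H = "\<lambda>t. c * t powr a2 + (- (real d - 1) * s0 ^ d) * t powr b" and T = T and ?r0.0 = "s0 / 2"
        and ?K1.0 = "Kr + Kt" and \<theta> = \<theta>])
    show "0 \<le> S t \<and> S t + r \<le> 1 \<and> curve_height d a1 a2 c t (S t + r) =
        c * t powr a2 + (- (real d - 1) * s0 ^ d) * t powr b + real d * \<kappa> * (S t + r) + P t r"
      if t: "t \<in> T M" and r: "0 \<le> r" "r \<le> s0 / 2" for M t r
    proof -
      have "(S t + r) ^ d = S t ^ d * (1 + r / S t) ^ d"
        using S[OF t] by (simp add: distrib_left flip: power_mult_distrib)
      also have "S t ^ d = S t ^ (d - 1) * S t"
        using d by (simp add: power_eq_if)
      finally have "t powr (a2 - real d * a1) * (S t + r) ^ d
          = (t powr (a2 - real d * a1) * S t ^ (d - 1)) * (S t * (1 + r / S t) ^ d)"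
        by simp
      then have eq: "t powr (a2 - real d * a1) * (S t + r) ^ d = \<kappa> * (S t * (1 + r / S t) ^ d)"
        unfolding \<kappa>S[OF t] .
      have "P t r = \<kappa> * (S t * (1 + r / S t) ^ d) - \<kappa> * S t - real d * \<kappa> * r"
        using S[OF t] by (simp add: P_def binom_rem_def field_simps)
      then have "curve_height d a1 a2 c t (S t + r) =
        c * t powr a2 + (- (real d - 1) * s0 ^ d) * t powr b + real d * \<kappa> * (S t + r) + P t r"
        unfolding curve_height_def eq \<kappa>s0 by (simp add: S_def algebra_simps)
      then show ?thesis
        using S[OF t] r s0 by auto
    qed
    show "\<bar>P t r - P t r'\<bar> \<le> (Kr + Kt) * l ^ (2 - 1) * (r - r')"
      if t: "t \<in> T M" and r: "0 \<le> r'" "r' \<le> r" "r \<le> l" "l \<le> s0 / 2" for M t r r' l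
    proof -
      note St = S[OF t]
      have "\<bar>binom_rem d (r / S t) - binom_rem d (r' / S t)\<bar> \<le> K * (l / S t) * \<bar>r / S t - r' / S t\<bar>"
        unfolding K_def using r St by (intro binom_rem_lipschitz) (auto simp: divide_right_mono)
      then have "\<kappa> * S t * \<bar>binom_rem d (r / S t) - binom_rem d (r' / S t)\<bar> \<le> \<kappa> * S t * (K * (l / S t) * \<bar>r / S t - r' / S t\<bar>)"
        using St K by (intro mult_left_mono) auto
      also have "\<bar>r / S t - r' / S t\<bar> = (r - r') / S t"
        using r St by (simp flip: diff_divide_distrib)
      also have "\<kappa> * S t * (K * (l / S t) * ((r - r') / S t)) = \<kappa> * K * (1 / S t) * (l * (r - r'))"
        using St by simp
      also have "\<dots> \<le> Kr * (l * (r - r'))"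
      proof -
        have "1 / S t \<le> 2 / s0"
          using St s0 by (simp add: field_simps)
        then show ?thesis
          unfolding Kr_def using K r by (intro mult_right_mono mult_left_mono) auto
      qed
      also have "\<dots> \<le> (Kr + Kt) * (l * (r - r'))"
        using K r by (intro mult_right_mono) auto
      finally show ?thesis
        using St K by (simp add: P_def abs_mult mult.assoc flip: right_diff_distrib)
    qed
    show "\<bar>P t r - P 1 r\<bar> \<le> (Kr + Kt) * (t - 1) * r ^ 2"
      if t: "t \<in> T M" and r: "0 \<le> r" "r \<le> s0 / 2" for M t r
    proof -
      have "\<bar>S t * binom_rem d (r / S t) - S 1 * binom_rem d (r / S 1)\<bar>
          \<le> 2 * K / (s0 / 2)\<^sup>2 * r\<^sup>2 * \<bar>S t - S 1\<bar>"
        unfolding K_def using S[OF t] r s0 by (intro scaled_binom_rem_lipschitz) (auto simp: S_def)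
      also have "\<bar>S t - S 1\<bar> = s0 * \<bar>t powr b - 1 powr b\<bar>"
      proof -
        have "S t - S 1 = s0 * (t powr b - 1 powr b)"
          by (simp add: S_def right_diff_distrib)
        then show ?thesis
          using s0 by (simp only: abs_mult abs_of_pos)
      qed
      also have "2 * K / (s0 / 2)\<^sup>2 * r\<^sup>2 * \<dots> \<le> 2 * K / (s0 / 2)\<^sup>2 * r\<^sup>2 * (s0 * (\<bar>b\<bar> * 2 powr \<bar>b - 1\<bar> * \<bar>t - 1\<bar>))"
        using TE[OF t] s0 K by (intro mult_left_mono powr_lipschitz) auto
      finally have "\<kappa> * \<bar>S t * binom_rem d (r / S t) - S 1 * binom_rem d (r / S 1)\<bar>
          \<le> \<kappa> * (2 * K / (s0 / 2)\<^sup>2 * r\<^sup>2 * (s0 * (\<bar>b\<bar> * 2 powr \<bar>b - 1\<bar> * \<bar>t - 1\<bar>)))"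
        using K by (intro mult_left_mono) auto
      also have "\<dots> = Kt * ((t - 1) * r\<^sup>2)"
        using TE[OF t] by (simp add: Kt_def mult_ac)
      also have "\<dots> \<le> (Kr + Kt) * ((t - 1) * r\<^sup>2)"
        using TE[OF t] K by (intro mult_right_mono) auto
      finally show ?thesis
        using K by (simp add: P_def abs_mult mult.assoc flip: right_diff_distrib)
    qed
    show "continuous_on UNIV (P 1)"
      unfolding P_def[abs_def] binom_rem_def S_def using s0 by (intro continuous_intros) auto
  qed (use K s0 \<xi> T dist sep in auto)
  then show ?thesis
    by simp
qed

section \<open>Base point and separation of the dilated curves\<close>

text \<open>The expression is injective in \<open>s ^ d\<close>, so it cannot vanish at both
  \<open>1 / 4\<close> and \<open>1 / 2\<close>.\<close>

lemma exists_base_point: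
  assumes "2 \<le> d" "A \<noteq> (0::real)"
  obtains s :: real where "0 < s" "s \<le> 1 / 2" "C + s ^ d * A \<noteq> 0"
proof -
  have "(1 / 4 :: real) ^ d < (1 / 2) ^ d"
    using assms by (intro power_strict_mono) auto
  then have "C + (1 / 4) ^ d * A \<noteq> C + (1 / 2) ^ d * A"
    using assms by simp
  then have "C + (1 / 4) ^ d * A \<noteq> 0 \<or> C + (1 / 2) ^ d * A \<noteq> 0"
    by linarith
  then show thesis
    using that[of "1 / 4"] that[of "1 / 2"] by fastforce
qed

lemma powr_near_one:
  obtains \<eta> :: real where "0 < \<eta>" "\<And>t. t \<in> {1..1 + \<eta>} \<Longrightarrow> t powr b \<in> {1 / 2..3 / 2}"
proof -
  have "isCont (\<lambda>t::real. t powr b) 1"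
    by (intro continuous_intros) auto
  then obtain \<eta> where \<eta>: "0 < \<eta>" "\<And>t. \<bar>t - 1\<bar> < \<eta> \<Longrightarrow> \<bar>t powr b - 1 powr b\<bar> < 1 / 2"
    unfolding continuous_at_eps_delta dist_real_def by (metis half_gt_zero zero_less_one)
  show thesis
  proof (rule that[of "\<eta> / 2"])
    fix t assume "t \<in> {1..1 + \<eta> / 2}"
    then have "\<bar>t powr b - 1 powr b\<bar> < 1 / 2"
      using \<eta>(1) by (intro \<eta>(2)) auto
    then show "t powr b \<in> {1 / 2..3 / 2}"
      unfolding powr_one_eq_one by (auto simp: abs_if split: if_splits)
  qed (use \<eta> in simp)
qed

text \<open>Moving from \<open>s0\<close> to \<open>s\<close> changes the difference of two heights
  by at most a multiple of \<open>\<bar>t - t'\<bar> * \<bar>s - s0\<bar>\<close>. On a short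
  interval this uses up at most half of the separation at \<open>s0\<close>.\<close>

lemma curve_height_separation:
  assumes "0 < h" "0 < s0" "s0 < 1"
    and sep: "\<And>t t'. \<lbrakk>t \<in> E; t' \<in> E\<rbrakk> \<Longrightarrow> h * \<bar>t - t'\<bar> \<le>
      \<bar>curve_height d a1 a2 c t s0 - curve_height d a1 a2 c t' s0\<bar>"
    and E: "E \<subseteq> {1..2}"
  obtains s1 where "s0 < s1" "s1 < 1" "\<And>t t' s. \<lbrakk>t \<in> E; t' \<in> E; s \<in> {s0..s1}\<rbrakk> \<Longrightarrow>
    h / 2 * \<bar>t - t'\<bar> \<le> \<bar>curve_height d a1 a2 c t s - curve_height d a1 a2 c t' s\<bar>"
proof -
  define b where "b = a2 - real d * a1"
  define K where "K = 1 + \<bar>b\<bar> * 2 powr \<bar>b - 1\<bar> * real d"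
  have K: "1 \<le> K"
    by (simp add: K_def)
  define e where "e = min ((1 - s0) / 2) (h / (2 * K))"
  have e: "0 < e" "e \<le> (1 - s0) / 2" "e \<le> h / (2 * K)"
    using assms(1,3) K by (simp add: e_def) (simp_all only: e_def min.cobounded1 min.cobounded2)
  have eK: "K * e \<le> h / 2"
    using e K by (simp add: field_simps)
  show thesis
  proof (rule that[of "s0 + e"])
    fix t t' s assume t: "t \<in> E" "t' \<in> E" and s: "s \<in> {s0..s0 + e}"
    have tt: "t \<in> {1..2}" "t' \<in> {1..2}"
      using t E by auto
    have s1: "0 \<le> s" "s \<le> 1"
      using s e assms by auto
    have "\<bar>s ^ d - s0 ^ d\<bar> \<le> real d * 1 ^ (d - 1) * \<bar>s - s0\<bar>"
      using s1 assms by (intro power_lipschitz) auto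
    then have "\<bar>s ^ d - s0 ^ d\<bar> \<le> real d * \<bar>s - s0\<bar>"
      by simp
    also have "\<dots> \<le> real d * e"
      using s by (intro mult_left_mono) auto
    finally have 1: "\<bar>s ^ d - s0 ^ d\<bar> \<le> real d * e" .
    have "\<bar>(t powr b - t' powr b) * (s ^ d - s0 ^ d)\<bar> \<le> (\<bar>b\<bar> * 2 powr \<bar>b - 1\<bar> * \<bar>t - t'\<bar>) * (real d * e)"
      unfolding abs_mult using tt 1 by (intro mult_mono powr_lipschitz) auto
    also have "\<dots> = (\<bar>b\<bar> * 2 powr \<bar>b - 1\<bar> * real d) * e * \<bar>t - t'\<bar>"
      by simp
    also have "\<dots> \<le> K * e * \<bar>t - t'\<bar>"
      using e by (intro mult_right_mono) (auto simp: K_def)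
    also have "\<dots> \<le> h / 2 * \<bar>t - t'\<bar>"
      using eK by (intro mult_right_mono) auto
    finally have 2: "\<bar>(t powr b - t' powr b) * (s ^ d - s0 ^ d)\<bar> \<le> h / 2 * \<bar>t - t'\<bar>" .
    have eq: "curve_height d a1 a2 c t s - curve_height d a1 a2 c t' s =
        (curve_height d a1 a2 c t s0 - curve_height d a1 a2 c t' s0) + (t powr b - t' powr b) * (s ^ d - s0 ^ d)"
      by (simp add: curve_height_def b_def algebra_simps)
    have "\<bar>x\<bar> - \<bar>y\<bar> \<le> \<bar>x + y\<bar>" for x y :: real
      by linarith
    then have "h * \<bar>t - t'\<bar> - h / 2 * \<bar>t - t'\<bar> \<le> \<bar>curve_height d a1 a2 c t s - curve_height d a1 a2 c t' s\<bar>"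
      unfolding eq using 2 sep[OF t] by (meson diff_mono order_trans)
    then show "h / 2 * \<bar>t - t'\<bar> \<le> \<bar>curve_height d a1 a2 c t s - curve_height d a1 a2 c t' s\<bar>"
      by simp
  qed (use e assms in auto)
qed

lemma curve_height_lipschitz:
  assumes "t \<in> {1..2}" "s \<in> {0..1}" "s' \<in> {0..1}"
  shows "\<bar>curve_height d a1 a2 c t s - curve_height d a1 a2 c t s'\<bar>
    \<le> (2 powr \<bar>a2 - real d * a1\<bar> * real d) * \<bar>s - s'\<bar>"
proof -
  have "\<bar>s ^ d - s' ^ d\<bar> \<le> real d * 1 ^ (d - 1) * \<bar>s - s'\<bar>"
    using assms by (intro power_lipschitz) auto
  then have "t powr (a2 - real d * a1) * \<bar>s ^ d - s' ^ d\<bar> \<le> 2 powr \<bar>a2 - real d * a1\<bar> * (real d * \<bar>s - s'\<bar>)"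
    using assms by (intro mult_mono powr_le_two_powr) auto
  moreover have "curve_height d a1 a2 c t s - curve_height d a1 a2 c t s' = t powr (a2 - real d * a1) * (s ^ d - s' ^ d)"
    by (simp add: curve_height_def right_diff_distrib)
  ultimately show ?thesis
    by (simp add: abs_mult mult.assoc)
qed

section \<open>Assembly: choice of the parameters and of the test exponents\<close>

theorem theorem4p1:
  fixes d :: nat and a1 a2 c \<beta> \<gamma> :: real
  assumes "d \<ge> 2" and "a1 > 0" and "a2 > 0" and "real d * a1 \<noteq> a2"
    and "0 < \<beta>" and "\<beta> < 1" and "0 < \<gamma>" and "\<gamma> < 1" and "\<beta> \<le> \<gamma>"
  shows "\<exists>E. E \<subseteq> {1..2} \<and> has_upper_minkowski_dim E \<beta> \<and> has_upper_assouad_dim E \<gamma> \<and>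
    (c \<noteq> 0 \<longrightarrow> (\<forall>p q. 1 \<le> p \<and> 1 \<le> q \<and> exponent_point p q \<notin> closure (Delta_tilde d \<beta> \<gamma>)
        \<longrightarrow> \<not> maximal_estimate d a1 a2 c E p q)) \<and>
    (c = 0 \<longrightarrow> (\<forall>p q. 1 \<le> p \<and> 1 \<le> q \<and> exponent_point p q \<notin> closure (Delta d \<beta> \<gamma>)
        \<longrightarrow> \<not> maximal_estimate d a1 a2 c E p q))"
proof -
  define \<rho> where "\<rho> = (1 / 2 :: real) powr (1 / \<gamma>)"
  define \<theta> where "\<theta> = 1 - \<beta> / \<gamma>"
  define b where "b = (real d * a1 - a2) / (real d - 1)"
  have d: "real d \<ge> 2"
    using assms(1) by linarith
  have \<rho>\<gamma>: "\<rho> powr \<gamma> = 1 / 2"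
    using assms(7) by (simp add: \<rho>_def powr_powr)
  have \<rho>: "0 < \<rho>" "\<rho> < 1 / 2"
  proof -
    have "(1 / 2 :: real) powr (1 / \<gamma>) < (1 / 2) powr 1"
      using assms(7,8) by (intro powr_less_mono') auto
    then show "0 < \<rho>" "\<rho> < 1 / 2"
      by (simp_all add: \<rho>_def)
  qed
  then have \<rho>1: "\<rho> < 1"
    by simp
  have \<theta>: "0 \<le> \<theta>" "\<theta> < 1" "\<gamma> * (1 - \<theta>) = \<beta>"
    using assms(5,7,9) by (auto simp: \<theta>_def)
  obtain s0 where s0: "0 < s0" "s0 \<le> 1 / 2" "c * a2 + s0 ^ d * (a2 - real d * a1) \<noteq> 0"
    using exists_base_point[of d "a2 - real d * a1" "c * a2"] assms(1,4) by auto
  obtain \<eta>1 h1 where \<eta>1: "0 < \<eta>1" "0 < h1" and h1: "\<And>t t'. \<lbrakk>t \<in> {1..1 + \<eta>1}; t' \<in> {1..1 + \<eta>1}\<rbrakk> \<Longrightarrow>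
      h1 * \<bar>t - t'\<bar> \<le> \<bar>(c * t powr a2 + s0 ^ d * t powr (a2 - real d * a1))
        - (c * t' powr a2 + s0 ^ d * t' powr (a2 - real d * a1))\<bar>"
    using powr_sum_expanding[OF s0(3)] by blast
  \<comment> \<open>At \<open>t = 1\<close> the tangent intercept and the height over
    \<open>s0\<close> have the same derivative in \<open>t\<close>: to first order the contact point
    only moves along its tangent. So the choice of \<open>s0\<close> settles both
    separations.\<close>
  have "(real d - 1) * b = real d * a1 - a2"
    using d by (simp add: b_def)
  moreover have "(- (real d - 1) * s0 ^ d) * b = - (s0 ^ d * ((real d - 1) * b))"
    by (simp only: minus_mult_left[symmetric] mult_ac)
  ultimately have "(- (real d - 1) * s0 ^ d) * b = s0 ^ d * (a2 - real d * a1)"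
    by (simp only: minus_mult_right minus_diff_eq)
  then have "c * a2 + (- (real d - 1) * s0 ^ d) * b \<noteq> 0"
    using s0(3) by (simp only: not_False_eq_True)
  then obtain \<eta>2 h2 where \<eta>2: "0 < \<eta>2" "0 < h2" and h2: "\<And>t t'. \<lbrakk>t \<in> {1..1 + \<eta>2}; t' \<in> {1..1 + \<eta>2}\<rbrakk> \<Longrightarrow>
      h2 * \<bar>t - t'\<bar> \<le> \<bar>(c * t powr a2 + (- (real d - 1) * s0 ^ d) * t powr b)
        - (c * t' powr a2 + (- (real d - 1) * s0 ^ d) * t' powr b)\<bar>"
    using powr_sum_expanding by blast
  \<comment> \<open>Stated as an implication so that a single choice of \<open>\<eta>\<close> covers
    \<open>c = 0\<close>, where the intercept at the origin does not move.\<close>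
  have "\<exists>\<eta>>0. \<exists>h>0. c \<noteq> 0 \<longrightarrow> (\<forall>t\<in>{1..1 + \<eta>}. \<forall>t'\<in>{1..1 + \<eta>}. h * \<bar>t - t'\<bar> \<le> \<bar>c * t powr a2 - c * t' powr a2\<bar>)"
  proof (cases "c = 0")
    case False
    then have "c * a2 + 0 * 0 \<noteq> 0"
      using assms(3) by simp
    from powr_sum_expanding[OF this] show ?thesis
      by (metis (no_types, lifting) add.right_neutral mult_zero_left)
  qed (auto intro: exI[of _ 1])
  then obtain \<eta>3 h3 where \<eta>3: "0 < \<eta>3" "0 < h3" and h3: "\<And>t t'. \<lbrakk>c \<noteq> 0; t \<in> {1..1 + \<eta>3}; t' \<in> {1..1 + \<eta>3}\<rbrakk> \<Longrightarrow>
      h3 * \<bar>t - t'\<bar> \<le> \<bar>c * t powr a2 - c * t' powr a2\<bar>"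
    by blast
  obtain \<eta>4 where \<eta>4: "0 < \<eta>4" and tb: "\<And>t. t \<in> {1..1 + \<eta>4} \<Longrightarrow> t powr b \<in> {1 / 2..3 / 2}"
    using powr_near_one by blast
  \<comment> \<open>The entry 1 keeps \<open>E\<close> inside \<open>{1..2}\<close>; the others keep
    it where the separations hold and \<open>t powr b\<close> is near 1.\<close>
  define \<eta>0 where "\<eta>0 = Min {1, \<eta>1, \<eta>2, \<eta>3, \<eta>4}"
  have \<eta>0: "0 < \<eta>0" "\<eta>0 \<le> 1" "\<eta>0 \<le> \<eta>1" "\<eta>0 \<le> \<eta>2" "\<eta>0 \<le> \<eta>3" "\<eta>0 \<le> \<eta>4"
    using \<eta>1 \<eta>2 \<eta>3 \<eta>4 by (auto simp: \<eta>0_def)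
  define \<eta> where "\<eta> = \<eta>0 * (1 - \<rho>)"
  have \<eta>: "0 < \<eta>" "\<eta> \<le> 1 - \<rho>" "\<eta> / (1 - \<rho>) = \<eta>0"
    using \<eta>0 \<rho>1 by (auto simp: \<eta>_def mult_left_le_one_le)
  define E where "E = dilation_set \<eta> \<rho> \<theta>"
  define T where "T = window_set \<eta> \<rho> \<theta>"
  have E: "E \<subseteq> {1..1 + \<eta>0}"
    using dilation_set_range[OF \<eta>(1,2) \<rho> \<theta>(1)] \<eta>(3) by (simp add: E_def)
  then have E2: "E \<subseteq> {1..2}"
    using \<eta>0(2) by fastforce
  have E1: "1 \<in> E"
    by (simp add: E_def one_in_dilation_set)
  define k where "k = \<eta> * gap \<rho>"
  have k: "0 < k"
    using scaled_gap[OF \<eta>(1,2) \<rho>] by (simp add: k_def)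
  have T: "finite (T M)" "T M \<subseteq> E" "(\<rho> ^ M) powr (- \<beta>) \<le> real (card (T M))" for M
    using card_window_set_ge[OF \<eta>(1) \<rho> \<rho>\<gamma> \<theta>(1,2), of M] \<theta>(3)
    by (auto simp: T_def E_def intro!: window_set_subset)
  have Tsep: "h * k * \<rho> ^ M \<le> X"
    if "t \<in> T M" "t' \<in> T M" "t \<noteq> t'" "0 < h" "h * \<bar>t - t'\<bar> \<le> X" for M t t' h X
  proof -
    have "h * (k * \<rho> ^ M) \<le> h * \<bar>t - t'\<bar>"
      using window_set_separation[OF \<eta>(1) \<rho>, of t \<theta> M t'] that
      by (intro mult_left_mono) (auto simp: T_def k_def)
    with that(5) show ?thesis
      by (simp add: mult.assoc)
  qed
  have Tdist: "t - 1 \<le> 1 / \<rho> * (\<rho> ^ M) powr \<theta>" if "t \<in> T M" for M t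
    using window_set_range(3)[OF \<eta>(1,2) \<rho> \<theta>(1)] that by (simp add: T_def)
  have sep_s0: "h1 * \<bar>t - t'\<bar> \<le> \<bar>curve_height d a1 a2 c t s0 - curve_height d a1 a2 c t' s0\<bar>"
    if "t \<in> E" "t' \<in> E" for t t'
  proof -
    have "h1 * \<bar>t - t'\<bar> \<le> \<bar>(c * t powr a2 + s0 ^ d * t powr (a2 - real d * a1))
        - (c * t' powr a2 + s0 ^ d * t' powr (a2 - real d * a1))\<bar>"
      using that E \<eta>0(3) by (intro h1) fastforce+
    then show ?thesis
      by (simp add: curve_height_def algebra_simps)
  qed
  have "s0 < 1"
    using s0 by auto
  then obtain s1 where s1: "s0 < s1" "s1 < 1" and sep_s1: "\<And>t t' s. \<lbrakk>t \<in> E; t' \<in> E; s \<in> {s0..s1}\<rbrakk> \<Longrightarrow>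
      h1 / 2 * \<bar>t - t'\<bar> \<le> \<bar>curve_height d a1 a2 c t s - curve_height d a1 a2 c t' s\<bar>"
    using curve_height_separation[OF \<eta>1(2) s0(1) _ sep_s0 E2] by blast
  have necessary: "exponent_point p q \<in> closure (if c = 0 then Delta d \<beta> \<gamma> else Delta_tilde d \<beta> \<gamma>)"
    if pq: "1 \<le> p" "1 \<le> q" and est: "maximal_estimate d a1 a2 c E p q" for p q
  proof -
    obtain u v where uv: "exponent_point p q = (u, v)"
      by fastforce
    note test = est pq uv E2 assms(2) \<rho>(1) \<rho>1
    have d1: "1 \<le> d"
      using assms(1) by simp
    have n1: "v \<le> u"
      by (rule translation_condition[OF est pq uv E1])
    have n2: "2 * u \<le> 1 + (1 - \<beta>) * v"
    proof (rule ball_condition[OF test, where T = T and ?s0.0 = s0 and ?s1.0 = s1])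
      show "h1 / 2 * k * \<rho> ^ M \<le> \<bar>curve_height d a1 a2 c t s - curve_height d a1 a2 c t' s\<bar>"
        if "t \<in> T M" "t' \<in> T M" "t \<noteq> t'" "s \<in> {s0..s1}" for M t t' s
        using that T(2)[of M] \<eta>1 by (intro Tsep[OF that(1-3)] sep_s1) auto
      show "\<bar>curve_height d a1 a2 c t s - curve_height d a1 a2 c t s'\<bar>
          \<le> (2 powr \<bar>a2 - real d * a1\<bar> * real d) * \<bar>s - s'\<bar>"
        if "t \<in> E" "s \<in> {0..1}" "s' \<in> {0..1}" for t s s'
        using that E2 by (intro curve_height_lipschitz) auto
    qed (use \<eta>1 k s0 s1 T in auto)
    have tbE: "t powr b \<in> {1 / 2..3 / 2}" if "t \<in> E" for t
      using that E \<eta>0(6) by (intro tb) fastforce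
    \<comment> \<open>A single dilation is a cluster with \<open>B = 0\<close>. It may be used with
      \<open>\<theta> = 1\<close>, which admits \<open>\<xi> = 0\<close>, an arc of fixed
      length.\<close>
    have T1: "finite {1::real}" "{1} \<subseteq> E" "(\<rho> ^ M) powr (- 0) \<le> real (card {1::real})" for M
      using E1 \<rho> by auto
    have "(1 + 0) * u \<le> 0 + (2 - 0 - 0) * v"
      by (rule curved_knapp_condition[OF test zero_less_one order_refl assms(1) s0(1,2) b_def tbE, where
            T = "\<lambda>_. {1}" and \<theta> = 1]) (use T1 in auto)
    then have n3: "u \<le> 2 * v"
      by simp
    \<comment> \<open>The smallest exponent allowed by \<open>1 - \<theta> \<le> 2 * \<xi>\<close>,
      so the longest arc compatible with the whole cluster.\<close>
    define \<xi> where "\<xi> = \<beta> / (2 * \<gamma>)"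
    have \<xi>: "0 \<le> \<xi>" "2 * \<xi> \<le> 1" "1 - \<theta> \<le> 2 * \<xi>" and \<gamma>\<xi>: "2 * \<gamma> * \<xi> = \<beta>"
      using assms(5,7,9) by (auto simp: \<xi>_def \<theta>_def divide_simps)
    have "(1 + \<xi>) * u \<le> \<xi> + (2 - \<beta> - \<xi>) * v"
    proof (rule curved_knapp_condition[OF test _ _ assms(1) s0(1,2) b_def tbE \<xi> T Tdist])
      show "0 < h2 * k" "0 \<le> 1 / \<rho>"
        using \<eta>2 k \<rho> by auto
      show "h2 * k * \<rho> ^ M \<le> \<bar>(c * t powr a2 + (- (real d - 1) * s0 ^ d) * t powr b)
          - (c * t' powr a2 + (- (real d - 1) * s0 ^ d) * t' powr b)\<bar>"
        if "t \<in> T M" "t' \<in> T M" "t \<noteq> t'" for M t t'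
      proof (rule Tsep[OF that \<eta>2(2) h2])
        show "t \<in> {1..1 + \<eta>2}" "t' \<in> {1..1 + \<eta>2}"
          using that T(2)[of M] E \<eta>0(4) by fastforce+
      qed
    qed
    then have "2 * \<gamma> * ((1 + \<xi>) * u) \<le> 2 * \<gamma> * (\<xi> + (2 - \<beta> - \<xi>) * v)"
      using assms(7) by (intro mult_left_mono) auto
    also have "2 * \<gamma> * ((1 + \<xi>) * u) = u * (2 * \<gamma> + 2 * \<gamma> * \<xi>)"
      by (simp add: algebra_simps)
    also have "2 * \<gamma> * (\<xi> + (2 - \<beta> - \<xi>) * v) = 2 * \<gamma> * \<xi> + v * (4 * \<gamma> - 2 * \<beta> * \<gamma> - 2 * \<gamma> * \<xi>)"
      by (simp add: algebra_simps)
    finally have n4: "u * (2 * \<gamma> + \<beta>) \<le> \<beta> + v * (4 * \<gamma> - 2 * \<beta> * \<gamma> - \<beta>)"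
      unfolding \<gamma>\<xi> .
    show ?thesis
    proof (cases "c = 0")
      case True
      \<comment> \<open>The largest exponent allowed: the arc at the origin is then about as high as
        its neighbourhood is thick.\<close>
      define \<xi> where "\<xi> = 1 / real d"
      have \<xi>: "0 \<le> \<xi>" "real d * \<xi> \<le> 1" "1 - 1 \<le> real d * \<xi>" and d\<xi>: "real d * \<xi> = 1"
        using d by (auto simp: \<xi>_def)
      have "(1 + \<xi>) * u \<le> \<xi> + (2 - 0 - (real d - 1) * \<xi>) * v"
        by (rule flat_knapp_condition[OF test zero_less_one order_refl d1 \<xi>, where T = "\<lambda>_. {1}"])
          (use T1 in auto)
      then have "real d * ((1 + \<xi>) * u) \<le> real d * (\<xi> + (2 - 0 - (real d - 1) * \<xi>) * v)"
        using d by (intro mult_left_mono) auto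
      also have "real d * ((1 + \<xi>) * u) = real d * u + real d * \<xi> * u"
        by (simp add: algebra_simps)
      also have "real d * (\<xi> + (2 - 0 - (real d - 1) * \<xi>) * v) = real d * \<xi> + 2 * real d * v - (real d - 1) * (real d * \<xi>) * v"
        by (simp add: algebra_simps)
      finally have "(real d + 1) * (u - v) \<le> 1"
        unfolding d\<xi> by (simp add: algebra_simps)
      then show ?thesis
        using closure_DeltaI[OF assms(5-7) n1 n3 n2 n4] uv True by simp
    next
      case False
      \<comment> \<open>The two ends of the admissible range are used: \<open>1 / real d\<close>
        gives the first line of \<open>Delta_tilde\<close>, and
        \<open>\<beta> / (real d * \<gamma>)\<close> the second.\<close>
      have flat: "(1 + \<xi>) * u \<le> \<xi> + (2 - \<beta> - (real d - 1) * \<xi>) * v"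
        if \<xi>: "0 \<le> \<xi>" "real d * \<xi> \<le> 1" "1 - \<theta> \<le> real d * \<xi>" for \<xi>
      proof (rule flat_knapp_condition[OF test _ _ d1 \<xi> T Tdist])
        show "0 < h3 * k" "0 \<le> 1 / \<rho>"
          using \<eta>3 k \<rho> by auto
        show "h3 * k * \<rho> ^ M \<le> \<bar>c * t powr a2 - c * t' powr a2\<bar>"
          if "t \<in> T M" "t' \<in> T M" "t \<noteq> t'" for M t t'
        proof (rule Tsep[OF that \<eta>3(2) h3[OF False]])
          show "t \<in> {1..1 + \<eta>3}" "t' \<in> {1..1 + \<eta>3}"
            using that T(2)[of M] E \<eta>0(5) by fastforce+
        qed
      qed
      define \<omega> where "\<omega> = 1 / real d"
      have d\<omega>: "real d * \<omega> = 1"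
        using d by (simp add: \<omega>_def)
      have "(1 + \<omega>) * u \<le> \<omega> + (2 - \<beta> - (real d - 1) * \<omega>) * v"
        using d\<omega> \<theta> by (intro flat) (auto simp: \<omega>_def)
      then have "real d * ((1 + \<omega>) * u) \<le> real d * (\<omega> + (2 - \<beta> - (real d - 1) * \<omega>) * v)"
        using d by (intro mult_left_mono) auto
      also have "real d * ((1 + \<omega>) * u) = u * (real d + real d * \<omega>)"
        by (simp add: algebra_simps)
      also have "real d * (\<omega> + (2 - \<beta> - (real d - 1) * \<omega>) * v)
          = real d * \<omega> + v * (real d * (2 - \<beta>) - (real d - 1) * (real d * \<omega>))"
        by (simp add: algebra_simps)
      finally have n5: "u * (real d + 1) \<le> 1 + v * (real d - real d * \<beta> + 1)"
        unfolding d\<omega> by (simp add: algebra_simps)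
      define \<xi> where "\<xi> = \<beta> / (real d * \<gamma>)"
      have d\<xi>: "real d * \<xi> = \<beta> / \<gamma>" "real d * \<gamma> * \<xi> = \<beta>"
        using d assms(7) by (auto simp: \<xi>_def)
      have "(1 + \<xi>) * u \<le> \<xi> + (2 - \<beta> - (real d - 1) * \<xi>) * v"
        using d\<xi> assms(5,7,9) by (intro flat) (auto simp: \<xi>_def \<theta>_def)
      then have "real d * \<gamma> * ((1 + \<xi>) * u) \<le> real d * \<gamma> * (\<xi> + (2 - \<beta> - (real d - 1) * \<xi>) * v)"
        using d assms(7) by (intro mult_left_mono) auto
      also have "real d * \<gamma> * ((1 + \<xi>) * u) = u * (real d * \<gamma> + real d * \<gamma> * \<xi>)"
        by (simp add: algebra_simps)
      also have "real d * \<gamma> * (\<xi> + (2 - \<beta> - (real d - 1) * \<xi>) * v)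
          = real d * \<gamma> * \<xi> + v * (real d * \<gamma> * (2 - \<beta>) - (real d - 1) * (real d * \<gamma> * \<xi>))"
        by (simp add: algebra_simps)
      finally have n6: "u * (real d * \<gamma> + \<beta>)
          \<le> \<beta> + v * (2 * (real d * \<gamma> + \<beta>) - \<beta> * (real d + 1 + real d * \<gamma>))"
        unfolding d\<xi> by (simp add: algebra_simps)
      show ?thesis
        using closure_Delta_tildeI[OF assms(5-7,9,1) n1 n3 n2 n4 n5 n6] uv False by simp
    qed
  qed
  have "has_upper_minkowski_dim E \<beta>"
    using has_upper_minkowski_dim_dilation_set[OF \<eta>(1,2) \<rho> \<rho>\<gamma> assms(7) \<theta>(1,2)] \<theta>(3) by (simp add: E_def)
  moreover have "has_upper_assouad_dim E \<gamma>"
    using has_upper_assouad_dim_dilation_set[OF \<eta>(1,2) \<rho> \<rho>\<gamma> assms(7) \<theta>(1,2)] by (simp add: E_def)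
  ultimately show ?thesis
    using E2 necessary by (intro exI[of _ E]) auto
qed

end
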